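(* Assume $\Bbbk$ has characteristic zero. In the (completed) Grothendieck group of $\Bbbk\mathbf{FB}$-bimodules there are equalities $$[\hom_{\Bbbk\mathbf{FA}}(\overline P^{\otimes\bullet},\overline P^{\otimes *})]=[\Bbbk\mathbf{FS}]\odot_{\mathbf{FB}^{\mathrm{op}}}\mathcal S(0)+\sum_{k\ge1}\mathcal S(k)\boxtimes[\mathsf{sgn}_{k-1}]_{\mathbf{FB}} =[\Bbbk\mathbf{FS}]\odot_{\mathbf{FB}^{\mathrm{op}}}\mathcal S(0)+\sum_{k\ge1}\sum_{t\in\mathbb N}(-1)^t[\mathsf{sgn}_{k+t}]_{\mathbf{FB}^{\mathrm{op}}}\boxtimes[\mathsf{sgn}_{k-1}]_{\mathbf{FB}}.$$ Here the left side is the bimodule $(\mathbf m,\mathbf n)\mapsto\hom_{\Bbbk\mathbf{FA}}(\overline P^{\otimes m},\overline P^{\otimes n})$, covariant (an $\mathbf{FB}$-module) in $\mathbf m=\bullet$ and contravariant (an $\mathbf{FB}^{\mathrm{op}}$-module) in $\mathbf n=*$; $[\Bbbk\mathbf{FS}]$ is the class of the bimodule $(\mathbf m,\mathbf n)\mapsto\Bbbk\mathbf{FS}(\mathbf n,\mathbf m)$; the convolution $\odot_{\mathbf{FB}^{\mathrm{op}}}$ and the classes $\mathcal S(k)$, $[\mathsf{sgn}_{k+t}]_{\mathbf{FB}^{\mathrm{op}}}$ concern the contravariant variable $*$, and $[\mathsf{sgn}_{k-1}]_{\mathbf{FB}}$ the covariant variable $\bullet$.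
   Context: Let $\Bbbk$ be a field. $\mathbf{FA}$ denotes the category of finite sets and all maps, and $\mathbf{FI}$, $\mathbf{FS}$, $\mathbf{FB}$ its wide subcategories of injections, surjections and bijections respectively; $\mathbf n=\{1,\dots,n\}$ for $n\in\mathbb N$ ($\mathbf 0=\emptyset$), and $\mathfrak S_n$ is the symmetric group. For a category $\mathcal C$, $\Bbbk\mathcal C(X,Y)$ is the $\Bbbk$-vector space with basis $\mathcal C(X,Y)$. A $\Bbbk\mathbf{FA}$-module is a functor from $\mathbf{FA}$ to $\Bbbk$-vector spaces (these form the abelian category $\mathcal F(\mathbf{FA})$); $\otimes$ denotes the pointwise tensor product over $\Bbbk$, and $\hom_{\Bbbk\mathbf{FA}}$ denotes natural transformations. $P^{\mathbf{FA}}_{\mathbf n}:=\Bbbk\mathbf{FA}(\mathbf n,-)$, so $P^{\mathbf{FA}}_{\mathbf n}(X)\cong\Bbbk[X]^{\otimes n}$ (where $\Bbbk[X]$ has basis $\{[x]:x\in X\}$), with the right $\mathfrak S_n$-action by precomposition, equivalently place permutation of tensor factors; write $P^{\mathbf{FA}}:=P^{\mathbf{FA}}_{\mathbf 1}$. Let $\overline{\Bbbk}$ be the functor with value $\Bbbk$ on non-empty sets (all maps acting by the identity) and $0$ on $\emptyset$, and $\Bbbk_{\mathbf 0}$ the functor with value $\Bbbk$ on $\emptyset$ and $0$ on non-empty sets. $\overline P$ is the kernel of the surjection $P^{\mathbf{FA}}\to\overline\Bbbk$, $[x]\mapsto 1$; thus $\overline P(X)=\{\sum_x a_x[x]:\sum_x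 a_x=0\}$. For $n\ge1$, $\overline P^{\otimes n}$ is the $n$-fold pointwise tensor power, a subfunctor of $P^{\mathbf{FA}}_{\mathbf n}$ stable under the place-permutation right action of $\mathfrak S_n$; by convention $\overline P^{\otimes 0}:=\overline\Bbbk$. The $\mathfrak S_m$- and $\mathfrak S_n$-actions on $\hom_{\Bbbk\mathbf{FA}}(\overline P^{\otimes m},\overline P^{\otimes n})$ come from the place-permutation actions. A $\Bbbk\mathbf{FB}$-module is a sequence $(M(n))_{n\in\mathbb N}$ of $\Bbbk\mathfrak S_n$-modules; $\Bbbk\mathbf{FB}^{\mathrm{op}}$-modules are similarly sequences of right modules, and a $\Bbbk\mathbf{FB}$-bimodule is a $\Bbbk(\mathbf{FB}\times\mathbf{FB}^{\mathrm{op}})$-module. For those with finite-dimensional values, $[M]$ denotes the class in the completed Grothendieck group (locally finite infinite sums allowed). The Day convolution is $(M\odot N)(S)=\bigoplus_{S=S_1\sqcup S_2}M(S_1)\otimes N(S_2)$ (ordered decompositions), extended bilinearly to classes; $\boxtimes$ is the exterior tensor product. $\mathsf{sgn}_k$ is the sign representation, regarded as a module supported on sets of cardinality $k$, and $\mathcal S(k):=\sum_{j\ge0}(-1)^j[\mathsf{sgn}_{k+j}]$ for $k\in\mathbb N$. *)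

theory Defs
  imports Main "HOL-Combinatorics.Permutations" "HOL-Library.FuncSet" "HOL-Library.Function_Algebras"
begin

text \<open>All vector spaces are subspaces of spaces of functions 'a => 'k (pointwise
operations), where 'k is the ground field.\<close>

definition sc :: "'k::field \<Rightarrow> ('a \<Rightarrow> 'k) \<Rightarrow> ('a \<Rightarrow> 'k)" where
  "sc c f = (\<lambda>x. c * f x)"

definition lin_on :: "('a \<Rightarrow> 'k::field) set \<Rightarrow> (('a \<Rightarrow> 'k) \<Rightarrow> ('b \<Rightarrow> 'k)) \<Rightarrow> bool" where
  "lin_on V f \<longleftrightarrow> (\<forall>u\<in>V. \<forall>v\<in>V. f (u + v) = f u + f v) \<and> (\<forall>c. \<forall>u\<in>V. f (sc c u) = sc c (f u))"

definition fspan :: "('a \<Rightarrow> 'k::field) set \<Rightarrow> ('a \<Rightarrow> 'k) set" where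
  "fspan S = {v. \<exists>F c. finite F \<and> F \<subseteq> S \<and> v = (\<Sum>f\<in>F. sc (c f) f)}"

text \<open>The linear map sending the basis vector [x] (x in L) to c x [T x].\<close>
definition lin_ext :: "('a \<Rightarrow> 'b) \<Rightarrow> ('a \<Rightarrow> 'k::field) \<Rightarrow> 'a set \<Rightarrow> ('a \<Rightarrow> 'k) \<Rightarrow> ('b \<Rightarrow> 'k)" where
  "lin_ext T c L g = (\<lambda>y. \<Sum>x\<in>{x\<in>L. T x = y}. c x * g x)"

text \<open>A value of an FB-bimodule at (m,n) is a space V with an action
act sigma tau (sigma in S_m acting on the left / covariantly, tau in S_n
acting on the right / contravariantly). Permutations of {0..<m}.\<close>

definition rep_iso ::
  "nat \<Rightarrow> nat \<Rightarrow> ('a \<Rightarrow> 'k::field) set \<Rightarrow> ((nat \<Rightarrow> nat) \<Rightarrow> (nat \<Rightarrow> nat) \<Rightarrow> ('a \<Rightarrow> 'k) \<Rightarrow> ('a \<Rightarrow> 'k))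
     \<Rightarrow> ('b \<Rightarrow> 'k) set \<Rightarrow> ((nat \<Rightarrow> nat) \<Rightarrow> (nat \<Rightarrow> nat) \<Rightarrow> ('b \<Rightarrow> 'k) \<Rightarrow> ('b \<Rightarrow> 'k)) \<Rightarrow> bool" where
  "rep_iso m n V \<alpha> W \<beta> \<longleftrightarrow>
     (\<exists>f. lin_on V f \<and> bij_betw f V W \<and>
        (\<forall>\<sigma> \<tau>. \<sigma> permutes {..<m} \<longrightarrow> \<tau> permutes {..<n} \<longrightarrow>
            (\<forall>v\<in>V. f (\<alpha> \<sigma> \<tau> v) = \<beta> \<sigma> \<tau> (f v))))"

definition dsum :: "('a \<Rightarrow> 'k) set \<Rightarrow> ('b \<Rightarrow> 'k) set \<Rightarrow> ('a + 'b \<Rightarrow> 'k) set" where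
  "dsum V W = {(\<lambda>x. case x of Inl a \<Rightarrow> g a | Inr b \<Rightarrow> h b) | g h. g \<in> V \<and> h \<in> W}"

definition dact ::
  "((nat \<Rightarrow> nat) \<Rightarrow> (nat \<Rightarrow> nat) \<Rightarrow> ('a \<Rightarrow> 'k) \<Rightarrow> ('a \<Rightarrow> 'k))
   \<Rightarrow> ((nat \<Rightarrow> nat) \<Rightarrow> (nat \<Rightarrow> nat) \<Rightarrow> ('b \<Rightarrow> 'k) \<Rightarrow> ('b \<Rightarrow> 'k))
   \<Rightarrow> (nat \<Rightarrow> nat) \<Rightarrow> (nat \<Rightarrow> nat) \<Rightarrow> ('a + 'b \<Rightarrow> 'k) \<Rightarrow> ('a + 'b \<Rightarrow> 'k)" where
  "dact \<alpha> \<beta> \<sigma> \<tau> h = (\<lambda>x. case x of Inl a \<Rightarrow> \<alpha> \<sigma> \<tau> (h \<circ> Inl) a | Inr b \<Rightarrow> \<beta> \<sigma> \<tau> (h \<circ> Inr) b)"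

text \<open>P_m^FA(X) = k[X]^{tensor m} is modelled as functions on lists of length m
with entries in X = {0..<N}; the list [x_1,...,x_m] is the basis tensor
[x_1] (x) ... (x) [x_m].\<close>

definition Pmap :: "nat \<Rightarrow> nat \<Rightarrow> (nat \<Rightarrow> nat) \<Rightarrow> (nat list \<Rightarrow> 'k::field) \<Rightarrow> (nat list \<Rightarrow> 'k)" where
  "Pmap m N f t = lin_ext (map f) (\<lambda>_. 1) {l. length l = m \<and> set l \<subseteq> {..<N}} t"

definition place :: "nat \<Rightarrow> (nat \<Rightarrow> nat) \<Rightarrow> (nat list \<Rightarrow> 'k::field) \<Rightarrow> (nat list \<Rightarrow> 'k)" where
  "place m \<pi> t = lin_ext (\<lambda>l. map (\<lambda>i. l ! \<pi> i) [0..<m]) (\<lambda>_. 1) {l. length l = m} t"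

definition Pbar :: "nat \<Rightarrow> (nat \<Rightarrow> 'k::field) set" where
  "Pbar N = {v. (\<forall>x. N \<le> x \<longrightarrow> v x = 0) \<and> (\<Sum>x<N. v x) = 0}"

text \<open>Pbar^{tensor m}({0..<N}); for m = 0 this is kbar.\<close>
definition Pbt :: "nat \<Rightarrow> nat \<Rightarrow> (nat list \<Rightarrow> 'k::field) set" where
  "Pbt m N =
    (if m = 0 then (if N = 0 then {0} else {(\<lambda>l. if l = [] then c else 0) | c. True})
     else fspan {(\<lambda>l. if length l = m \<and> set l \<subseteq> {..<N} then (\<Prod>i<m. v i (l ! i)) else 0)
                 | v. \<forall>i<m. v i \<in> Pbar N})"

text \<open>Natural transformations Pbar^{tensor m} => Pbar^{tensor n} (on the skeleton
of FA), as families of linear maps; extended by 0 off the domain.\<close>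
definition natural :: "nat \<Rightarrow> nat \<Rightarrow> (nat \<Rightarrow> (nat list \<Rightarrow> 'k::field) \<Rightarrow> (nat list \<Rightarrow> 'k)) \<Rightarrow> bool" where
  "natural m n \<phi> \<longleftrightarrow>
     (\<forall>N. lin_on (Pbt m N) (\<phi> N) \<and> (\<forall>t\<in>Pbt m N. \<phi> N t \<in> Pbt n N)
          \<and> (\<forall>t. t \<notin> Pbt m N \<longrightarrow> \<phi> N t = 0)) \<and>
     (\<forall>N M f. f ` {..<N} \<subseteq> {..<M} \<longrightarrow>
          (\<forall>t\<in>Pbt m N. \<phi> M (Pmap m N f t) = Pmap n N f (\<phi> N t)))"

definition Hsp :: "nat \<Rightarrow> nat \<Rightarrow> ((nat \<times> (nat list \<Rightarrow> 'k::field) \<times> nat list) \<Rightarrow> 'k) set" where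
  "Hsp m n = {(\<lambda>(N, t, l). \<phi> N t l) | \<phi>. natural m n \<phi>}"

definition actH :: "nat \<Rightarrow> nat \<Rightarrow> (nat \<Rightarrow> nat) \<Rightarrow> (nat \<Rightarrow> nat)
     \<Rightarrow> ((nat \<times> (nat list \<Rightarrow> 'k::field) \<times> nat list) \<Rightarrow> 'k)
     \<Rightarrow> ((nat \<times> (nat list \<Rightarrow> 'k) \<times> nat list) \<Rightarrow> 'k)" where
  "actH m n \<sigma> \<tau> h = (\<lambda>(N, t, l). place n \<tau> (\<lambda>l'. h (N, place m \<sigma> t, l')) l)"

definition ordsign :: "(nat \<Rightarrow> nat) \<Rightarrow> nat set \<Rightarrow> 'k::field" where
  "ordsign b S = (-1) ^ card {(x, y). x \<in> S \<and> y \<in> S \<and> x < y \<and> b y < b x}"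

text \<open>Basis of ([kFS] Day-convolved (in the contravariant variable) with
sgn_j)(m,n) = direct sum over n = S1 disjoint-union S2 of kFS(S1, m) (x) sgn(S2):
pairs (S2, f) with f a surjection {0..<n} - S2 -> {0..<m}, card S2 = j;
the parity predicate selects which j occur.\<close>
definition labA :: "nat \<Rightarrow> nat \<Rightarrow> (nat \<Rightarrow> bool) \<Rightarrow> (nat set \<times> (nat \<Rightarrow> nat)) set" where
  "labA m n par = {(S, f). S \<subseteq> {..<n} \<and> par (card S) \<and>
       f \<in> ({..<n} - S) \<rightarrow>\<^sub>E {..<m} \<and> f ` ({..<n} - S) = {..<m}}"

definition Asp :: "nat \<Rightarrow> nat \<Rightarrow> (nat \<Rightarrow> bool) \<Rightarrow> ((nat set \<times> (nat \<Rightarrow> nat)) \<Rightarrow> 'k::field) set" where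
  "Asp m n par = {g. \<forall>x. x \<notin> labA m n par \<longrightarrow> g x = 0}"

definition actA :: "nat \<Rightarrow> nat \<Rightarrow> (nat \<Rightarrow> bool) \<Rightarrow> (nat \<Rightarrow> nat) \<Rightarrow> (nat \<Rightarrow> nat)
     \<Rightarrow> ((nat set \<times> (nat \<Rightarrow> nat)) \<Rightarrow> 'k::field) \<Rightarrow> ((nat set \<times> (nat \<Rightarrow> nat)) \<Rightarrow> 'k)" where
  "actA m n par \<sigma> \<tau> g =
     lin_ext (\<lambda>(S, f). (inv \<tau> ` S, restrict (\<sigma> \<circ> f \<circ> \<tau>) ({..<n} - inv \<tau> ` S)))
             (\<lambda>(S, f). ordsign \<tau> (inv \<tau> ` S)) (labA m n par) g"

text \<open>The one-dimensional bimodule value sgn_n (contravariant) boxtimes sgn_m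
(covariant) at (m,n), present when cond holds, and 0 otherwise.\<close>
definition Bsp :: "bool \<Rightarrow> (unit \<Rightarrow> 'k::field) set" where
  "Bsp cond = (if cond then UNIV else {0})"

definition actB :: "(nat \<Rightarrow> nat) \<Rightarrow> (nat \<Rightarrow> nat) \<Rightarrow> (unit \<Rightarrow> 'k::field) \<Rightarrow> (unit \<Rightarrow> 'k)" where
  "actB \<sigma> \<tau> g = (\<lambda>u. of_int (sign \<sigma> * sign \<tau>) * g u)"

end

theory Submission
  imports Defs Complex_Main
begin

text \<open>The labels \<open>(S, f)\<close> of \<open>Asp\<close> are encoded as words in \<open>{..<m}\<close> of length \<open>n\<close>, with a star
  (\<open>None\<close>) at the places of \<open>S\<close>. Replacing a star by a letter, with alternating signs, gives an
  equivariant complex graded by the number of stars. It is exact except at its two ends: in degree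
  \<open>0\<close> its cocycles are the natural transformations, and if \<open>m < n\<close> its cokernel in the top degree
  \<open>n - m\<close> is a line on which the groups act by signs. The differential \<open>d\<close> and its transpose \<open>d\<^sup>T\<close>
  have rational entries, so \<open>d + d\<^sup>T\<close> behaves as in Hodge theory; it maps the odd part to the even
  part, equivariantly, and its kernel consists of the homology at the two ends.\<close>

subsection \<open>Words with stars\<close>

text \<open>The complex reflects the n-fold tensor power of P -> kbar, whose kernel in one factor is
  Pbar: a letter marks a factor P, a star a factor kbar, and the sum over all letters at one place
  is the augmentation of that factor. All letters of \<open>{..<m}\<close> have to occur because a
  map that ignores a tensor factor of its source kills the elements of augmentation zero in that
  factor.

  Exactness alone would give an identity of characters; the operator d + d^T turns it into a
  bijection that can be written down and tested for equivariance. The line at the top end has to be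
  placed by hand. If n - m is odd, it lies in the odd part and d + d^T loses it, so the value of
  \<open>top_sum\<close> is recorded as an extra coordinate of the target. If n - m is even, it lies
  in the even part and is missed, so a multiple of \<open>top_sgn\<close> is added as an extra
  summand of the source. For m = n the top degree is 0 and the line already belongs to the cocycles;
  for m > n there are no words.\<close>

type_synonym word = "nat option list"

abbreviation stars :: "word \<Rightarrow> nat" where
  "stars w \<equiv> count_list w None"

definition letters :: "word \<Rightarrow> nat set" where
  "letters w = {a. Some a \<in> set w}"

lemma letters_simps [simp]:
  "letters [] = {}" "letters (None # w) = letters w" "letters (Some a # w) = insert a (letters w)"
  by (auto simp: letters_def)

definition words :: "nat set \<Rightarrow> nat \<Rightarrow> word set" where
  "words Y n = {w. length w = n \<and> letters w = Y}"

lemma words_0 [simp]: "words Y 0 = (if Y = {} then {[]} else {})"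
  by (auto simp: words_def)

lemma None_in_words [simp]: "None # u \<in> words Y (Suc n) \<longleftrightarrow> u \<in> words Y n"
  by (auto simp: words_def)

lemma Some_in_words:
  "Some a # u \<in> words Y (Suc n) \<longleftrightarrow> a \<in> Y \<and> (u \<in> words Y n \<or> u \<in> words (Y - {a}) n)"
  by (auto simp: words_def)

lemma finite_letters [simp]: "finite (letters w)"
proof (induction w)
  case (Cons c w)
  then show ?case by (cases c) auto
qed simp

lemma card_letters_stars: "card (letters w) + stars w \<le> length w"
proof (induction w)
  case (Cons c w)
  then show ?case
    by (cases c) (auto simp: card_insert_if)
qed simp

text \<open>The \<open>b\<close>-part of the differential; see \<open>repl_eq_sum\<close> for the closed form.\<close>

fun repl :: "nat \<Rightarrow> (word \<Rightarrow> 'k::field) \<Rightarrow> word \<Rightarrow> 'k" where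
  "repl b x [] = 0"
| "repl b x (None # w) = x (Some b # w) - repl b (\<lambda>u. x (None # u)) w"
| "repl b x (Some a # w) = repl b (\<lambda>u. x (Some a # u)) w"

lemma repl_add: "repl b (\<lambda>u. x u + y u) w = repl b x w + repl b y w"
  by (induction b x w arbitrary: y rule: repl.induct) auto

lemma repl_diff: "repl b (\<lambda>u. x u - y u) w = repl b x w - repl b y w"
  by (induction b x w arbitrary: y rule: repl.induct) auto

lemma repl_scale: "repl b (\<lambda>u. c * x u) w = c * repl b x w"
  by (induction b x w rule: repl.induct) (auto simp: algebra_simps)

lemma repl_zero [simp]: "repl b (\<lambda>u. 0) w = 0"
  using repl_scale[of b 0 "\<lambda>u. 0" w] by simp

lemma repl_sum: "repl b (\<lambda>u. \<Sum>i\<in>I. x i u) w = (\<Sum>i\<in>I. repl b (x i) w)"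
  by (induction I rule: infinite_finite_induct) (auto simp: repl_add)

lemma repl_cong:
  assumes "\<And>v. length v = length w \<Longrightarrow> letters v = insert b (letters w) \<Longrightarrow> stars w = Suc (stars v)
            \<Longrightarrow> x v = y v"
  shows "repl b x w = repl b y w"
  using assms
proof (induction b x w arbitrary: y rule: repl.induct)
  case (2 b x w)
  have "repl b (\<lambda>u. x (None # u)) w = repl b (\<lambda>u. y (None # u)) w"
    by (rule 2(1)) (rule 2(2), auto)
  then show ?case using 2(2)[of "Some b # w"] by auto
next
  case (3 b x a w)
  have "repl b (\<lambda>u. x (Some a # u)) w = repl b (\<lambda>u. y (Some a # u)) w"
    by (rule 3(1)) (rule 3(2), auto)
  then show ?case by auto
qed auto

lemma repl_starless: "stars w = 0 \<Longrightarrow> repl b x w = 0"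
  by (induction b x w rule: repl.induct) auto

text \<open>The sign at a star counts the stars to its left. Filling the left one of two stars first
  therefore flips the sign at the right one, while the opposite order leaves the left sign
  alone.\<close>

lemma repl_repl: "repl b (repl c x) w = - repl c (repl b x) w"
proof (induction w arbitrary: x)
  case (Cons d w)
  then show ?case by (cases d) (auto simp: repl_diff)
qed simp

text \<open>Anticommutation alone says that twice the value is zero, which is void in characteristic
  two; hence a separate induction.\<close>

lemma repl_repl_same: "repl b (repl b x) w = 0"
proof (induction w arbitrary: x)
  case (Cons d w)
  then show ?case by (cases d) (auto simp: repl_diff)
qed simp

section \<open>The differential and the functional on the top degree\<close>

definition dif :: "nat set \<Rightarrow> (word \<Rightarrow> 'k::field) \<Rightarrow> word \<Rightarrow> 'k" where
  "dif Y x w = (\<Sum>b\<in>Y. repl b x w)"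

text \<open>A top word uses each letter of Y once and has stars elsewhere. After a first letter a
  there remain \<open>Suc n - card Y\<close> stars, so the exponent has the parity of the number of
  later entries below a, stars counting as smaller than letters. The functional is thus the signed
  sum over the top words, the sign being that of their inversions; \<open>top_sgn_eq\<close> makes
  this precise.\<close>

fun top_sum :: "nat set \<Rightarrow> nat \<Rightarrow> (word \<Rightarrow> 'k::field) \<Rightarrow> 'k" where
  "top_sum Y 0 x = (if Y = {} then x [] else 0)"
| "top_sum Y (Suc n) x = top_sum Y n (\<lambda>u. x (None # u)) +
     (\<Sum>a\<in>Y. (-1) ^ (card {b\<in>Y. b < a} + Suc n + card Y) * top_sum (Y - {a}) n (\<lambda>u. x (Some a # u)))"

lemma top_sum_add: "top_sum Y n (\<lambda>u. x u + y u) = top_sum Y n x + top_sum Y n y"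
proof (induction Y n x arbitrary: y rule: top_sum.induct)
  case (2 Y n x)
  have *: "(\<Sum>a\<in>Y. c a * top_sum (Y - {a}) n (\<lambda>u. x (Some a # u) + y (Some a # u))) =
    (\<Sum>a\<in>Y. c a * top_sum (Y - {a}) n (\<lambda>u. x (Some a # u))) +
    (\<Sum>a\<in>Y. c a * top_sum (Y - {a}) n (\<lambda>u. y (Some a # u)))" for c
    by (simp add: 2(2) sum.distrib distrib_left cong: sum.cong)
  show ?case unfolding top_sum.simps * 2(1) by simp
qed auto

lemma top_sum_scale: "top_sum Y n (\<lambda>u. c * x u) = c * top_sum Y n x"
  by (induction Y n x rule: top_sum.induct)
    (auto simp: sum_distrib_left algebra_simps)

lemma top_sum_zero [simp]: "top_sum Y n (\<lambda>u. 0) = 0"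
  using top_sum_scale[of Y n 0 "\<lambda>u. 0"] by simp

lemma top_sum_diff: "top_sum Y n (\<lambda>u. x u - y u) = top_sum Y n x - top_sum Y n y"
  using top_sum_add[of Y n x "\<lambda>u. (-1) * y u"] unfolding top_sum_scale by simp

lemma top_sum_sum: "top_sum Y n (\<lambda>u. \<Sum>i\<in>I. x i u) = (\<Sum>i\<in>I. top_sum Y n (x i))"
  by (induction I rule: infinite_finite_induct) (auto simp: top_sum_add)

lemma top_sum_cong:
  assumes "finite Y" "\<And>v. v \<in> words Y n \<Longrightarrow> stars v + card Y = n \<Longrightarrow> x v = y v"
  shows "top_sum Y n x = top_sum Y n y"
  using assms
proof (induction Y n x arbitrary: y rule: top_sum.induct)
  case (2 Y n x)
  have "top_sum Y n (\<lambda>u. x (None # u)) = top_sum Y n (\<lambda>u. y (None # u))"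
    by (rule 2(1)) (use 2(3,4) in auto)
  moreover have "top_sum (Y - {a}) n (\<lambda>u. x (Some a # u)) = top_sum (Y - {a}) n (\<lambda>u. y (Some a # u))"
    if "a \<in> Y" for a
  proof (rule 2(2)[OF that])
    fix v assume v: "v \<in> words (Y - {a}) n" "stars v + card (Y - {a}) = n"
    have "card Y > 0" using that 2(3) card_gt_0_iff by blast
    then show "x (Some a # v) = y (Some a # v)"
      using v that 2(3) by (intro 2(4)) (auto simp: Some_in_words)
  qed (use 2(3) in auto)
  ultimately show ?case by simp
qed auto

abbreviation tsgn :: "nat set \<Rightarrow> nat \<Rightarrow> nat \<Rightarrow> 'k::field" where
  "tsgn Y n a \<equiv> (-1) ^ (card {b\<in>Y. b < a} + n + card Y)"

text \<open>Exactly one of a and c is below the other, so deleting the other letter lowers exactly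
  one of the two counts. The step from n to \<open>Suc n\<close> on the right makes up for this
  sign.\<close>

lemma tsgn_remove:
  assumes "finite Y" "a \<in> Y" "c \<in> Y" "a \<noteq> c"
  shows "tsgn (Y - {a}) n c * tsgn (Y - {c}) n a = (tsgn Y (Suc n) a * tsgn Y n c :: 'k::field)"
proof -
  have *: "card {b \<in> Y - {a}. b < c} + (if a < c then 1 else 0) = card {b\<in>Y. b < c}"
    if "a \<in> Y" for a c
  proof (cases "a < c")
    case True
    have "{b\<in>Y. b < c} = insert a {b \<in> Y - {a}. b < c}" using True that by auto
    then show ?thesis using assms(1) True by simp
  next
    case False
    then have "{b\<in>Y. b < c} = {b \<in> Y - {a}. b < c}" by auto
    then show ?thesis using False by simp
  qed
  have c1: "card Y = Suc (card (Y - {a}))" if "a \<in> Y" for a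
    using that assms(1) by (metis card_Suc_Diff1)
  have "even (card {b \<in> Y - {a}. b < c} + n + card (Y - {a}) + (card {b \<in> Y - {c}. b < a} + n + card (Y - {c}))
     + (card {b\<in>Y. b < a} + Suc n + card Y + (card {b\<in>Y. b < c} + n + card Y)))"
    using *[OF assms(2), of c] *[OF assms(3), of a] c1[OF assms(2)] c1[OF assms(3)] assms(4)
    by (cases "a < c") (simp_all, presburger+)
  then show ?thesis
    unfolding power_add[symmetric] minus_one_power_iff by (auto split: if_splits)
qed

text \<open>A top word over Y contains a once. Putting a star there gives a top word over
  \<open>Y - {a}\<close> with a marked star, and every such pair arises once, so both sides have the
  same terms up to one global sign.\<close>

lemma top_sum_repl_remove:
  assumes "finite Y" "a \<in> Y"
  shows "top_sum (Y - {a}) n (repl a y) = tsgn Y n a * top_sum Y n y"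
  using assms
proof (induction n arbitrary: Y y)
  case (Suc n)
  let ?y = "\<lambda>c u. y (Some c # u)"
  have "top_sum (Y - {a}) (Suc n) (repl a y) =
      top_sum (Y - {a}) n (?y a) - tsgn Y n a * top_sum Y n (\<lambda>u. y (None # u)) +
      (\<Sum>c\<in>Y - {a}. tsgn (Y - {a}) (Suc n) c * top_sum (Y - {a} - {c}) n (repl a (?y c)))"
    using Suc by (simp add: top_sum_diff)
  also have "(\<Sum>c\<in>Y - {a}. tsgn (Y - {a}) (Suc n) c * top_sum (Y - {a} - {c}) n (repl a (?y c)))
     = (\<Sum>c\<in>Y - {a}. tsgn Y (Suc n) a * (tsgn Y (Suc n) c * top_sum (Y - {c}) n (?y c)))"
  proof (rule sum.cong[OF refl])
    fix c assume c: "c \<in> Y - {a}"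
    have "Y - {a} - {c} = Y - {c} - {a}" by auto
    then have "top_sum (Y - {a} - {c}) n (repl a (?y c)) = tsgn (Y - {c}) n a * top_sum (Y - {c}) n (?y c)"
      using c Suc by simp
    moreover have "tsgn (Y - {a}) n c * tsgn (Y - {c}) n a = (tsgn Y (Suc n) a * tsgn Y n c :: 'a)"
      using c Suc by (intro tsgn_remove) auto
    ultimately show "tsgn (Y - {a}) (Suc n) c * top_sum (Y - {a} - {c}) n (repl a (?y c))
       = tsgn Y (Suc n) a * (tsgn Y (Suc n) c * top_sum (Y - {c}) n (?y c))"
      by (simp add: algebra_simps)
  qed
  also have "\<dots> = tsgn Y (Suc n) a * (\<Sum>c\<in>Y - {a}. tsgn Y (Suc n) c * top_sum (Y - {c}) n (?y c))"
    by (simp add: sum_distrib_left)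
  finally show ?case
    using Suc.prems by (simp add: sum.remove[of Y a] algebra_simps flip: power_add mult_2)
next
  case 0
  then have "Y \<noteq> {}" by auto
  then show ?case by simp
qed

text \<open>A word with b twice and every other letter once comes from two top words, by putting a
  star for either b. Their signs are opposite and the terms cancel in pairs.\<close>

lemma top_sum_repl:
  assumes "finite Y" "b \<in> Y"
  shows "top_sum Y n (repl b y) = 0"
  using assms
proof (induction n arbitrary: Y y)
  case (Suc n)
  have "top_sum Y n (\<lambda>u. repl b y (None # u)) = top_sum Y n (\<lambda>u. y (Some b # u))"
    using Suc by (simp add: top_sum_diff)
  moreover have "(\<Sum>a\<in>Y. tsgn Y (Suc n) a * top_sum (Y - {a}) n (repl b (\<lambda>u. y (Some a # u))))
    = tsgn Y (Suc n) b * top_sum (Y - {b}) n (repl b (\<lambda>u. y (Some b # u)))"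
    using Suc by (subst sum.remove[of Y b]) (auto intro!: sum.neutral)
  ultimately show ?case
    using Suc.prems top_sum_repl_remove[OF Suc.prems, of n "\<lambda>u. y (Some b # u)"]
    by (simp add: algebra_simps flip: power_add mult_2)
qed simp

lemma top_sum_dif:
  assumes "finite Y"
  shows "top_sum Y n (dif Y y) = 0"
  unfolding dif_def[abs_def] top_sum_sum
  by (intro sum.neutral ballI top_sum_repl assms)

lemma ex_top_word:
  assumes "finite Y" "card Y \<le> n"
  shows "\<exists>v. v \<in> words Y n \<and> stars v + card Y = n"
proof -
  define v where "v = map Some (sorted_list_of_set Y) @ replicate (n - card Y) None"
  have "count_list (map Some xs) (None :: nat option) = 0" for xs :: "nat list"
    by (induction xs) auto
  then have "v \<in> words Y n \<and> stars v + card Y = n"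
    using assms by (auto simp: v_def words_def letters_def count_list_append count_list_eq_length_filter)
  then show ?thesis by blast
qed


definition top_sgn :: "nat set \<Rightarrow> word \<Rightarrow> 'k::field" where
  "top_sgn Y w = top_sum Y (length w) (\<lambda>u. of_bool (u = w))"

lemma top_sgn_Nil [simp]: "top_sgn Y [] = of_bool (Y = {})"
  by (simp add: top_sgn_def)

lemma top_sgn_None [simp]: "top_sgn Y (None # w) = top_sgn Y w"
  by (simp add: top_sgn_def)

lemma top_sgn_Some [simp]:
  "top_sgn Y (Some a # w) = (if a \<in> Y \<and> finite Y then tsgn Y (Suc (length w)) a * top_sgn (Y - {a}) w else 0 :: 'k::field)"
proof (cases "finite Y")
  case True
  have "(\<Sum>c\<in>Y. tsgn Y (Suc (length w)) c * top_sum (Y - {c}) (length w) (\<lambda>u. of_bool (Some c # u = Some a # w)))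
     = (\<Sum>c\<in>Y. if c = a then tsgn Y (Suc (length w)) a * top_sum (Y - {a}) (length w) (\<lambda>u. of_bool (u = w)) else 0 :: 'k)"
    by (intro sum.cong refl) auto
  then show ?thesis using True by (simp add: top_sgn_def)
qed (simp add: top_sgn_def)

lemma finite_words [simp]:
  assumes "finite Y"
  shows "finite (words Y n)"
proof (rule finite_subset)
  show "words Y n \<subseteq> {w. set w \<subseteq> insert None (Some ` Y) \<and> length w = n}"
  proof
    fix w assume w: "w \<in> words Y n"
    have "c \<in> insert None (Some ` Y)" if "c \<in> set w" for c
      using w that by (cases c) (auto simp: words_def letters_def)
    with w show "w \<in> {w. set w \<subseteq> insert None (Some ` Y) \<and> length w = n}"
      by (auto simp: words_def)
  qed
qed (simp add: assms finite_lists_length_eq)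

lemma top_sum_eq_sum:
  assumes "finite Y"
  shows "top_sum Y n x = (\<Sum>w\<in>words Y n. top_sgn Y w * x w)"
proof -
  have "top_sum Y n x = top_sum Y n (\<lambda>u. \<Sum>w\<in>words Y n. x w * of_bool (u = w))"
    using assms by (intro top_sum_cong) (auto simp: of_bool_def if_distrib cong: if_cong)
  also have "\<dots> = (\<Sum>w\<in>words Y n. x w * top_sgn Y w)"
    unfolding top_sum_sum top_sum_scale by (intro sum.cong refl) (auto simp: top_sgn_def words_def)
  finally show ?thesis by (simp add: mult.commute)
qed

lemma top_sgn_nonzero:
  assumes "finite Y" "v \<in> words Y (length v)" "stars v + card Y = length v"
  shows "top_sgn Y v \<noteq> (0::'k::field)"
  using assms
proof (induction v arbitrary: Y)
  case (Cons c v)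
  show ?case
  proof (cases c)
    case None
    then show ?thesis using Cons by simp
  next
    case (Some a)
    have "card Y > 0" using Cons.prems(1,2) Some by (auto simp: Some_in_words card_gt_0_iff)
    \<comment> \<open>If a recurred in v, the letters and stars of v would together exceed its
      length.\<close>
    then have "v \<notin> words Y (length v)" using card_letters_stars[of v] Cons.prems Some by (auto simp: words_def)
    then show ?thesis
      using Cons Some \<open>card Y > 0\<close> by (auto simp: Some_in_words)
  qed
qed simp

lemma ex_top_sum_1:
  assumes "finite Y" "card Y \<le> n"
  shows "\<exists>v. top_sum Y n v = (1::'k::field) \<and> (\<forall>w. stars w + card Y \<noteq> n \<longrightarrow> v w = 0)"
proof -
  obtain v where v: "v \<in> words Y n" "stars v + card Y = n" using ex_top_word[OF assms] by blast
  define c :: 'k where "c = top_sgn Y v"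
  have "c \<noteq> 0" unfolding c_def using v assms by (intro top_sgn_nonzero) (auto simp: words_def)
  moreover have "top_sum Y n (\<lambda>u. inverse c * of_bool (u = v)) = inverse c * c"
    unfolding top_sum_scale using v by (simp add: c_def top_sgn_def words_def)
  ultimately show ?thesis using v by (intro exI[of _ "\<lambda>u. inverse c * of_bool (u = v)"]) auto
qed

lemma dif_Nil [simp]: "dif Y x [] = 0"
  and dif_None [simp]: "dif Y x (None # w) = (\<Sum>b\<in>Y. x (Some b # w)) - dif Y (\<lambda>u. x (None # u)) w"
  and dif_Some [simp]: "dif Y x (Some a # w) = dif Y (\<lambda>u. x (Some a # u)) w"
  by (simp_all add: dif_def sum_subtractf)

lemma dif_cong:
  assumes "w \<in> words Y n" "\<And>v. v \<in> words Y n \<Longrightarrow> stars w = Suc (stars v) \<Longrightarrow> x v = y v"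
  shows "dif Y x w = dif Y y w"
  unfolding dif_def by (intro sum.cong refl repl_cong assms(2)) (use assms(1) in \<open>auto simp: words_def\<close>)

lemma dif_add: "dif Y (\<lambda>u. x u + y u) w = dif Y x w + dif Y y w"
  by (simp add: dif_def repl_add sum.distrib)

lemma dif_diff: "dif Y (\<lambda>u. x u - y u) w = dif Y x w - dif Y y w"
  by (simp add: dif_def repl_diff sum_subtractf)

lemma dif_scale: "dif Y (\<lambda>u. c * x u) w = c * dif Y x w"
  by (simp add: dif_def repl_scale sum_distrib_left)

lemma dif_sum: "dif Y (\<lambda>u. \<Sum>i\<in>I. x i u) w = (\<Sum>i\<in>I. dif Y (x i) w)"
  unfolding dif_def repl_sum by (rule sum.swap)

lemma dif_starless: "stars w = 0 \<Longrightarrow> dif Y x w = 0"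
  by (simp add: dif_def repl_starless)

lemma dif_remove:
  assumes "finite Y" "a \<in> Y"
  shows "dif Y x w = dif (Y - {a}) x w + repl a x w"
  using assms by (simp add: dif_def sum.remove add.commute)

text \<open>Exactness is proved by splitting off the first letter: the components \<open>x\<^sub>a\<close> have
  primitives by induction; these are first made to sum to the component \<open>x\<^sub>*\<close>, and then
  corrected by top-degree cocycles so that the obstruction for the words of the remaining
  letters vanishes.\<close>

lemma exactness:
  fixes x :: "word \<Rightarrow> 'k::field"
  assumes "finite Y"
    and cocycle: "\<And>w. w \<in> words Y n \<Longrightarrow> stars w \<ge> 2 \<Longrightarrow> dif Y x w = 0"
    and top: "card Y < n \<Longrightarrow> top_sum Y n x = 0"
  shows "\<exists>y. \<forall>w\<in>words Y n. stars w \<ge> 1 \<longrightarrow> x w = dif Y y w"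
  using assms
proof (induction n arbitrary: Y x)
  case (Suc n)
  define xs where "xs = (\<lambda>u. x (None # u))"
  define xa where "xa = (\<lambda>a u. x (Some a # u))"
  note fin = Suc.prems(1)
  have cocS: "dif Y (xa a) u = 0" if "a \<in> Y" "u \<in> words Y n \<or> u \<in> words (Y - {a}) n" "stars u \<ge> 2" for a u
    using Suc.prems(2)[of "Some a # u"] that by (auto simp: Some_in_words xa_def)
  have cocN: "(\<Sum>b\<in>Y. xa b u) = dif Y xs u" if "u \<in> words Y n" "stars u \<ge> 1" for u
    using Suc.prems(2)[of "None # u"] that by (auto simp: xa_def xs_def)
  show ?case
  proof (cases "Y = {}")
    case True
    have "top_sum {} n (\<lambda>u. x (None # u)) = 0" using Suc.prems(3) True by simp
    \<comment> \<open>Over the empty alphabet the only word consists of stars. It is a top word, so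
      x vanishes there because \<open>top_sum\<close> does.\<close>
    then have x0: "x (None # u) = 0" if "u \<in> words {} n" for u
    proof -
      have "words {} n = {replicate n (None :: nat option)}"
        by (auto simp: words_def letters_def) (metis in_set_replicate not_Some_eq replicate_eqI)
      moreover have "count_list (replicate n (None :: nat option)) None = n"
        by (induction n) auto
      ultimately show ?thesis
        using that \<open>top_sum {} n _ = 0\<close> top_sgn_nonzero[of "{}" "replicate n None", where 'k = 'k]
        by (auto simp: top_sum_eq_sum)
    qed
    have "x w = 0" if w: "w \<in> words {} (Suc n)" for w
    proof (cases w)
      case (Cons c u)
      show ?thesis using w x0[of u] Cons by (cases c) (auto simp: words_def)
    qed (use w in \<open>auto simp: words_def\<close>)
    then show ?thesis using True by (auto simp: dif_def)
  next
    case False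
    have "\<exists>y. \<forall>w\<in>words Y n. stars w \<ge> 1 \<longrightarrow> xa a w = dif Y y w" if a: "a \<in> Y" for a
    proof (rule Suc.IH[OF fin])
      show "dif Y (xa a) w = 0" if "w \<in> words Y n" "2 \<le> stars w" for w
        using cocS a that by blast
      assume n: "card Y < n"
      \<comment> \<open>Up to sign this is the obstruction to a primitive of \<open>xa a\<close>. On
        the top words without a, the cocycle condition turns the replacement by a into minus the
        differential over \<open>Y - {a}\<close>, which \<open>top_sum\<close> kills.\<close>
      have "top_sum (Y - {a}) n (repl a (xa a)) = top_sum (Y - {a}) n (\<lambda>u. 0 - dif (Y - {a}) (xa a) u)"
      proof (rule top_sum_cong)
        fix v assume v: "v \<in> words (Y - {a}) n" "stars v + card (Y - {a}) = n"
        have "card Y > 0" using a fin card_gt_0_iff by blast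
        then have "stars v \<ge> 2" using v n a fin by simp
        then have "dif Y (xa a) v = 0" using cocS a v by blast
        then show "repl a (xa a) v = 0 - dif (Y - {a}) (xa a) v"
          using dif_remove[OF fin a, of "xa a" v] by (simp add: add_eq_0_iff)
      qed (use fin in auto)
      also have "\<dots> = 0" using fin by (simp only: top_sum_diff top_sum_dif finite_Diff top_sum_zero) simp
      finally show "top_sum Y n (xa a) = 0"
        using top_sum_repl_remove[OF fin a, of n "xa a"] by simp
    qed
    then obtain y0 where y0: "xa a w = dif Y (y0 a) w" if "a \<in> Y" "w \<in> words Y n" "stars w \<ge> 1" for a w
      by metis
    obtain a0 where a0: "a0 \<in> Y" using False by blast
    define z where "z u = xs u - (\<Sum>b\<in>Y. y0 b u)" for u
    have z: "dif Y z w = 0" if "w \<in> words Y n" "stars w \<ge> 1" for w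
    proof -
      have "dif Y z w = dif Y xs w - (\<Sum>b\<in>Y. dif Y (y0 b) w)"
        by (simp add: z_def[abs_def] dif_diff dif_sum)
      also have "\<dots> = dif Y xs w - (\<Sum>b\<in>Y. xa b w)" using y0 that by simp
      finally show ?thesis using cocN that by simp
    qed
    \<comment> \<open>As z has zero differential in positive degrees, it can be added to one
      arbitrarily chosen primitive, which makes the primitives sum to \<open>xs\<close>.\<close>
    define y1 where "y1 a = (if a = a0 then (\<lambda>u. y0 a u + z u) else y0 a)" for a
    have y1: "dif Y (y1 a) w = xa a w" if "a \<in> Y" "w \<in> words Y n" "stars w \<ge> 1" for a w
      using y0 z that by (simp add: y1_def dif_add)
    have y1_sum: "(\<Sum>b\<in>Y. y1 b u) = xs u" for u
    proof -
      have "y1 b u = y0 b u + (if b = a0 then z u else 0)" for b by (simp add: y1_def)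
      then have "(\<Sum>b\<in>Y. y1 b u) = (\<Sum>b\<in>Y. y0 b u) + z u" using a0 fin by (simp add: sum.distrib)
      then show ?thesis by (simp add: z_def)
    qed
    have "\<exists>y2. (\<forall>a\<in>Y. \<forall>w\<in>words Y n. stars w \<ge> 1 \<longrightarrow> dif Y (y2 a) w = xa a w) \<and>
       (\<forall>u\<in>words Y n. (\<Sum>b\<in>Y. y2 b u) = xs u) \<and>
       (card Y \<le> n \<longrightarrow> (\<forall>a\<in>Y. top_sum Y n (y2 a) = tsgn Y n a * top_sum (Y - {a}) n (xa a)))"
    proof (cases "card Y \<le> n")
      case True
      obtain v :: "word \<Rightarrow> 'k" where v: "top_sum Y n v = 1" "\<And>w. stars w + card Y \<noteq> n \<Longrightarrow> v w = 0"
        using ex_top_sum_1[OF fin True] by blast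
      have dv: "dif Y v w = 0" if w: "w \<in> words Y n" for w
      proof -
        have "stars w + card Y \<le> n" using card_letters_stars[of w] w by (auto simp: words_def)
        then have "dif Y v w = dif Y (\<lambda>u. 0) w" using w by (intro dif_cong[of _ Y n] v(2)) auto
        then show ?thesis by (simp add: dif_def)
      qed
      \<comment> \<open>The value that \<open>top_sum\<close> has to take on the primitive for a, if
        the obstruction on the words over \<open>Y - {a}\<close> is to vanish.\<close>
      define t where "t a = tsgn Y n a * top_sum (Y - {a}) n (xa a)" for a
      \<comment> \<open>The hypothesis on x says exactly that these values add up to
        \<open>top_sum\<close> of \<open>xs\<close>. Hence the multiples of v added below cancel in
        the sum over Y.\<close>
      have "top_sum Y (Suc n) x = 0" using Suc.prems(3) True by simp
      then have tsum: "(\<Sum>a\<in>Y. t a) = top_sum Y n xs"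
        by (simp add: t_def xs_def xa_def sum_negf)
      define y2 where "y2 a u = y1 a u + (t a - top_sum Y n (y1 a)) * v u" for a u
      have "(\<Sum>b\<in>Y. t b - top_sum Y n (y1 b)) = top_sum Y n xs - top_sum Y n (\<lambda>u. \<Sum>b\<in>Y. y1 b u)"
        unfolding top_sum_sum by (simp add: sum_subtractf tsum)
      then have "(\<Sum>b\<in>Y. y2 b u) = xs u" for u
        by (simp add: y2_def sum.distrib y1_sum flip: sum_distrib_right)
      moreover have "dif Y (y2 a) w = xa a w" if "a \<in> Y" "w \<in> words Y n" "stars w \<ge> 1" for a w
        using dv y1 that by (simp add: y2_def[abs_def] dif_add dif_scale)
      moreover have "top_sum Y n (y2 a) = t a" for a
        by (simp add: y2_def[abs_def] top_sum_add top_sum_scale v)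
      ultimately show ?thesis unfolding t_def by blast
    qed (use y1 y1_sum in blast)
    then obtain y2 where y2: "\<And>a w. a \<in> Y \<Longrightarrow> w \<in> words Y n \<Longrightarrow> stars w \<ge> 1 \<Longrightarrow> dif Y (y2 a) w = xa a w"
       "\<And>u. u \<in> words Y n \<Longrightarrow> (\<Sum>b\<in>Y. y2 b u) = xs u"
       "\<And>a. card Y \<le> n \<Longrightarrow> a \<in> Y \<Longrightarrow> top_sum Y n (y2 a) = tsgn Y n a * top_sum (Y - {a}) n (xa a)"
      by blast
    have "\<exists>y. \<forall>w\<in>words (Y - {a}) n. stars w \<ge> 1 \<longrightarrow> xa a w - repl a (y2 a) w = dif (Y - {a}) y w"
      if a: "a \<in> Y" for a
    proof (rule Suc.IH)
      have anti: "dif (Y - {a}) (repl a (y2 a)) w = - repl a (dif Y (y2 a)) w" for w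
      proof -
        have "dif (Y - {a}) (repl a (y2 a)) w = - (\<Sum>b\<in>Y - {a}. repl a (repl b (y2 a)) w)"
          by (simp add: dif_def repl_repl[of _ a] sum_negf)
        also have "\<dots> = - repl a (dif Y (y2 a)) w"
          unfolding dif_def[abs_def] repl_sum using a fin by (simp add: sum.remove repl_repl_same)
        finally show ?thesis .
      qed
      show "dif (Y - {a}) (\<lambda>w. xa a w - repl a (y2 a) w) w = 0"
        if w: "w \<in> words (Y - {a}) n" "2 \<le> stars w" for w
      proof -
        have "repl a (dif Y (y2 a)) w = repl a (xa a) w"
          using w a by (intro repl_cong y2) (auto simp: words_def)
        then have "dif (Y - {a}) (\<lambda>w. xa a w - repl a (y2 a) w) w = dif Y (xa a) w"
          by (simp add: dif_diff anti dif_remove[OF fin a])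
        then show ?thesis using cocS a w by simp
      qed
      assume "card (Y - {a}) < n"
      then have n: "card Y \<le> n" using a fin by simp
      show "top_sum (Y - {a}) n (\<lambda>w. xa a w - repl a (y2 a) w) = 0"
        using y2(3)[OF n a] top_sum_repl_remove[OF fin a, of n "y2 a"]
        by (simp add: top_sum_diff flip: power_add mult_2 mult.assoc)
    qed (use fin in simp)
    then obtain y3 where y3: "xa a w - repl a (y2 a) w = dif (Y - {a}) (y3 a) w"
      if "a \<in> Y" "w \<in> words (Y - {a}) n" "stars w \<ge> 1" for a w
      by metis
    \<comment> \<open>The value 0 on words that begin with a star leaves only the sum of the
      \<open>y2\<close> in the differential at \<open>None # u\<close>. Behind a first letter a,
      \<open>y2\<close> serves the words in which a recurs and \<open>y3\<close> the others.\<close>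
    define y where "y w = (case w of Some a # u \<Rightarrow> if a \<in> letters u then y2 a u else y3 a u | _ \<Rightarrow> 0)" for w
    have "x w = dif Y y w" if w: "w \<in> words Y (Suc n)" "stars w \<ge> 1" for w
    proof (cases w)
      case (Cons c u)
      show ?thesis
      proof (cases c)
        case None
        then have u: "u \<in> words Y n" using w Cons by simp
        have "(\<Sum>b\<in>Y. y (Some b # u)) = (\<Sum>b\<in>Y. y2 b u)"
          using u by (intro sum.cong) (auto simp: y_def words_def)
        then show ?thesis
          using y2(2)[OF u] None Cons by (simp add: xs_def) (simp add: y_def dif_def)
      next
        case (Some a)
        then consider "a \<in> Y" "u \<in> words Y n" | "a \<in> Y" "u \<in> words (Y - {a}) n"
          using w Cons by (auto simp: Some_in_words)
        then show ?thesis
        proof cases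
          case 1
          then have "dif Y (\<lambda>u. y (Some a # u)) u = dif Y (y2 a) u"
            by (intro dif_cong[OF 1(2)]) (auto simp: y_def words_def)
          then show ?thesis using y2(1)[of a u] 1 w Cons Some by (simp add: xa_def)
        next
          case 2
          have "dif Y (\<lambda>u. y (Some a # u)) u =
             dif (Y - {a}) (\<lambda>u. y (Some a # u)) u + repl a (\<lambda>u. y (Some a # u)) u"
            using fin 2 by (intro dif_remove) auto
          also have "dif (Y - {a}) (\<lambda>u. y (Some a # u)) u = dif (Y - {a}) (y3 a) u"
            by (intro dif_cong[OF 2(2)]) (auto simp: y_def words_def)
          also have "repl a (\<lambda>u. y (Some a # u)) u = repl a (y2 a) u"
            by (rule repl_cong) (auto simp: y_def)
          finally show ?thesis using y3[of a u] 2 w Cons Some by (simp add: xa_def algebra_simps)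
        qed
      qed
    qed (use w in \<open>auto simp: words_def\<close>)
    then show ?thesis by blast
  qed
qed (auto split: if_splits)

subsection \<open>Signs of inversions\<close>

definition lpairs :: "nat set \<Rightarrow> (nat \<times> nat) set" where
  "lpairs S = {(x, y). x \<in> S \<and> y \<in> S \<and> x < y}"

lemma finite_lpairs [simp]: "finite S \<Longrightarrow> finite (lpairs S)"
  by (rule finite_subset[of _ "S \<times> S"]) (auto simp: lpairs_def)

lemma ordsign_prod:
  assumes "finite S"
  shows "ordsign f S = (\<Prod>(x, y)\<in>lpairs S. if f y < f x then -1 else 1)"
proof -
  have "(\<Prod>(x, y)\<in>lpairs S. if f y < f x then -1 else 1 :: 'a) = (\<Prod>p\<in>lpairs S. if f (snd p) < f (fst p) then -1 else 1)"
    by (intro prod.cong) auto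
  also have "\<dots> = (-1) ^ card {p \<in> lpairs S. f (snd p) < f (fst p)}"
    using assms by (simp add: prod.If_cases Int_def)
  also have "{p \<in> lpairs S. f (snd p) < f (fst p)} = {(x, y). x \<in> S \<and> y \<in> S \<and> x < y \<and> f y < f x}"
    by (auto simp: lpairs_def)
  finally show ?thesis by (simp add: ordsign_def)
qed

lemma ordsign_cong:
  assumes "\<And>x y. x \<in> S \<Longrightarrow> y \<in> S \<Longrightarrow> x < y \<Longrightarrow> f y < f x \<longleftrightarrow> g y < g x"
  shows "ordsign f S = ordsign g S"
proof -
  have "{(x, y). x \<in> S \<and> y \<in> S \<and> x < y \<and> f y < f x} = {(x, y). x \<in> S \<and> y \<in> S \<and> x < y \<and> g y < g x}"
    using assms by blast
  then show ?thesis by (simp add: ordsign_def)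
qed

lemma ordsign_increasing:
  assumes "\<And>x y. x \<in> S \<Longrightarrow> y \<in> S \<Longrightarrow> x < y \<Longrightarrow> f x \<le> f y"
  shows "ordsign f S = 1"
proof -
  have "{(x, y). x \<in> S \<and> y \<in> S \<and> x < y \<and> f y < f x} = {}" using assms by force
  then show ?thesis unfolding ordsign_def by (metis card.empty power_0)
qed

lemma ordsign_sq [simp]: "ordsign f S * ordsign f S = (1::'k::field)"
  by (simp add: ordsign_def flip: power_add mult_2)

text \<open>f carries the pairs of S to the unordered pairs of its image, which min and max write in
  increasing order. The composite inverts a pair if and only if exactly one of f and g does.\<close>

lemma ordsign_comp:
  assumes "finite S" "inj_on f S" "inj_on g (f ` S)"
  shows "ordsign (g \<circ> f) S = ordsign g (f ` S) * (ordsign f S :: 'k::field)"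
proof -
  let ?h = "\<lambda>(x, y). (min (f x) (f y), max (f x) (f y))"
  have inj: "inj_on ?h (lpairs S)"
  proof (rule inj_onI, clarify)
    fix x y x' y' assume *: "(x, y) \<in> lpairs S" "(x', y') \<in> lpairs S"
      "min (f x) (f y) = min (f x') (f y')" "max (f x) (f y) = max (f x') (f y')"
    have "f x = f x' \<and> f y = f y' \<or> f x = f y' \<and> f y = f x'"
      using *(3,4) by linarith
    moreover have "f u = f v \<Longrightarrow> u = v" if "u \<in> S" "v \<in> S" for u v
      using assms(2) that by (auto dest: inj_onD)
    ultimately show "x = x' \<and> y = y'"
      using *(1,2) unfolding lpairs_def by (metis (no_types, lifting) less_asym mem_Collect_eq case_prodD)
  qed
  have img: "?h ` lpairs S = lpairs (f ` S)"
  proof (intro set_eqI iffI)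
    fix p assume "p \<in> ?h ` lpairs S"
    then obtain x y where xy: "x \<in> S" "y \<in> S" "x < y" "p = ?h (x, y)" by (auto simp: lpairs_def)
    then have "f x \<noteq> f y" using assms(2) by (auto dest: inj_onD)
    then show "p \<in> lpairs (f ` S)" using xy by (auto simp: lpairs_def min_def max_def)
  next
    fix p assume "p \<in> lpairs (f ` S)"
    then obtain x y where xy: "x \<in> S" "y \<in> S" "f x < f y" "p = (f x, f y)" by (auto simp: lpairs_def)
    have "\<exists>q\<in>lpairs S. p = ?h q"
    proof (cases "x < y")
      case True
      then show ?thesis using xy by (intro bexI[of _ "(x, y)"]) (simp_all add: lpairs_def)
    next
      case False
      then have "y < x" using xy by (cases x y rule: linorder_cases) auto
      then show ?thesis using xy by (intro bexI[of _ "(y, x)"]) (simp_all add: lpairs_def)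
    qed
    then show "p \<in> ?h ` lpairs S" by blast
  qed
  have "ordsign g (f ` S) = (\<Prod>(x, y)\<in>lpairs (f ` S). if g y < g x then -1 else 1 :: 'k)"
    using assms by (simp add: ordsign_prod)
  also have "\<dots> = (\<Prod>(x, y)\<in>lpairs S. if g (max (f x) (f y)) < g (min (f x) (f y)) then -1 else 1)"
    unfolding img[symmetric] by (subst prod.reindex[OF inj]) (auto intro!: prod.cong)
  finally have "ordsign g (f ` S) * ordsign f S = (\<Prod>(x, y)\<in>lpairs S.
      (if g (max (f x) (f y)) < g (min (f x) (f y)) then -1 else 1) * (if f y < f x then -1 else 1 :: 'k))"
    using assms by (simp add: ordsign_prod prod.distrib case_prod_unfold)
  also have "\<dots> = (\<Prod>(x, y)\<in>lpairs S. if (g \<circ> f) y < (g \<circ> f) x then -1 else 1)"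
  proof (rule prod.cong[OF refl], clarify)
    fix x y assume "(x, y) \<in> lpairs S"
    then have xy: "x \<in> S" "y \<in> S" "x < y" by (auto simp: lpairs_def)
    then have "f x \<noteq> f y" using assms(2) by (auto dest: inj_onD)
    moreover have "g (f x) \<noteq> g (f y)" using calculation xy assms(3) by (auto dest: inj_onD)
    ultimately show "(if g (max (f x) (f y)) < g (min (f x) (f y)) then -1 else 1) * (if f y < f x then -1 else 1)
         = (if (g \<circ> f) y < (g \<circ> f) x then -1 else 1 :: 'k)"
      by (auto simp: min_def max_def)
  qed
  finally show ?thesis using assms by (simp add: ordsign_prod)
qed

lemma ordsign_transpose:
  assumes "a < b" "b < n"
  shows "ordsign (transpose a b) {..<n} = (-1 :: 'k::field)"
proof -
  have "{(x, y). x \<in> {..<n} \<and> y \<in> {..<n} \<and> x < y \<and> transpose a b y < transpose a b x}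
     = insert (a, b) (Pair a ` {a<..<b} \<union> (\<lambda>x. (x, b)) ` {a<..<b})" (is "?L = ?R")
    using assms by (auto simp: transpose_def split: if_splits)
  moreover have "card (Pair a ` {a<..<b} \<union> (\<lambda>x. (x, b)) ` {a<..<b}) = 2 * card {a<..<b}"
    by (subst card_Un_disjoint) (auto simp: card_image inj_on_def)
  ultimately have "card ?L = Suc (2 * card {a<..<b})" by (simp only:) (subst card_insert_disjoint, auto)
  then show ?thesis unfolding ordsign_def by simp
qed

lemma ordsign_permutes:
  assumes "\<tau> permutes {..<n}"
  shows "ordsign \<tau> {..<n} = (of_int (sign \<tau>) :: 'k::field)"
  using assms finite_lessThan
proof (induction rule: permutes_induct)
  case id
  have "ordsign id {..<n} = (1::'k)" by (rule ordsign_increasing) auto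
  then show ?case by (simp only: sign_id of_int_1)
next
  case (swap a b p)
  have p: "p ` {..<n} = {..<n}" using swap by (simp add: permutes_image)
  have "ordsign (transpose a b) {..<n} = (-1::'k)"
  proof (cases "a < b")
    case True
    then show ?thesis using swap ordsign_transpose by blast
  next
    case False
    then have "b < a" "a < n" using swap by simp_all
    then show ?thesis using ordsign_transpose[of b a n] by (subst transpose_commute) blast
  qed
  moreover have "ordsign (transpose a b \<circ> p) {..<n} = ordsign (transpose a b) (p ` {..<n}) * (ordsign p {..<n} :: 'k)"
    by (rule ordsign_comp) (use swap in \<open>simp_all add: permutes_inj_on inj_on_subset[OF inj_transpose]\<close>)
  moreover have "permutation p"
    using swap permutes_imp_permutation[OF finite_lessThan] by blast
  then have "sign (transpose a b \<circ> p) = - sign p"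
    using swap by (simp add: sign_compose permutation_swap_id sign_swap_id)
  ultimately show ?case using swap p by (simp only: of_int_minus mult_minus1)
qed

lemma ordsign_Un:
  assumes "finite S" "finite T" "\<And>s t. s \<in> S \<Longrightarrow> t \<in> T \<Longrightarrow> s < t \<and> f s < f t"
  shows "ordsign f (S \<union> T) = ordsign f S * (ordsign f T :: 'k::field)"
proof -
  let ?I = "\<lambda>S. {(x, y). x \<in> S \<and> y \<in> S \<and> x < y \<and> f y < f x}"
  have fin: "finite (?I S)" "finite (?I T)"
    by (rule finite_subset[of _ "S \<times> S"], auto simp: assms)
       (rule finite_subset[of _ "T \<times> T"], auto simp: assms)
  have "?I (S \<union> T) = ?I S \<union> ?I T" using assms(3) by (auto dest: less_asym)
  moreover have "?I S \<inter> ?I T = {}" using assms(3) by blast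
  ultimately have "card (?I (S \<union> T)) = card (?I S) + card (?I T)"
    using fin by (simp add: card_Un_disjoint)
  then show ?thesis by (simp add: ordsign_def power_add)
qed

lemma ordsign_shift: "ordsign f ((+) n ` S) = ordsign (\<lambda>x. f (n + x)) S"
proof -
  have "{(x, y). x \<in> (+) n ` S \<and> y \<in> (+) n ` S \<and> x < y \<and> f y < f x} =
     (\<lambda>(x, y). (n + x, n + y)) ` {(x, y). x \<in> S \<and> y \<in> S \<and> x < y \<and> f (n + y) < f (n + x)}"
    by auto
  then show ?thesis by (simp add: ordsign_def card_image inj_on_def)
qed

text \<open>With A, B, C as in the proof, A and B make up the elements before i, A and C give the
  values below \<open>f i\<close>, and i takes part in as many inversions as B and C have elements.
  The three parities add up to zero.\<close>

lemma ordsign_remove: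
  assumes "finite S" "i \<in> S" "inj_on f S"
  shows "ordsign f S * (-1) ^ card {j \<in> f ` S. j < f i} =
     (-1) ^ card {j\<in>S. j < i} * (ordsign f (S - {i}) :: 'k::field)"
proof -
  define A where "A = {j\<in>S. j < i \<and> f j < f i}"
  define B where "B = {j\<in>S. j < i \<and> f i < f j}"
  define C where "C = {j\<in>S. i < j \<and> f j < f i}"
  let ?I = "\<lambda>S. {(x, y). x \<in> S \<and> y \<in> S \<and> x < y \<and> f y < f x}"
  have fin: "finite A" "finite B" "finite C" "finite (?I (S - {i}))"
    using assms by (auto simp: A_def B_def C_def) (rule finite_subset[of _ "S \<times> S"], auto)
  have neq: "j < i \<or> i < j" if "f j \<noteq> f i" for j
    using that by (cases j i rule: linorder_cases) auto
  have "A \<union> C = {j\<in>S. f j < f i}" unfolding A_def C_def using neq by force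
  then have "{j \<in> f ` S. j < f i} = f ` (A \<union> C)" by auto
  moreover have "inj_on f (A \<union> C)" by (rule inj_on_subset[OF assms(3)]) (auto simp: A_def C_def)
  moreover have "A \<inter> C = {}" by (auto simp: A_def C_def)
  ultimately have 1: "card {j \<in> f ` S. j < f i} = card A + card C"
    using fin by (simp add: card_image card_Un_disjoint)
  have "f j < f i \<or> f i < f j" if "j \<in> S" "j < i" for j
    using that assms(2,3) by (metis inj_onD linorder_neqE_nat less_irrefl)
  then have "{j\<in>S. j < i} = A \<union> B" unfolding A_def B_def by blast
  moreover have "A \<inter> B = {}" by (auto simp: A_def B_def)
  ultimately have 2: "card {j\<in>S. j < i} = card A + card B" using fin by (simp add: card_Un_disjoint)
  have "?I S = ?I (S - {i}) \<union> ((\<lambda>j. (j, i)) ` B \<union> Pair i ` C)"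
    using assms(2) by (auto simp: B_def C_def)
  moreover have "?I (S - {i}) \<inter> ((\<lambda>j. (j, i)) ` B \<union> Pair i ` C) = {}" by auto
  moreover have "(\<lambda>j. (j, i)) ` B \<inter> Pair i ` C = {}" by (auto simp: B_def)
  ultimately have 3: "card (?I S) = card (?I (S - {i})) + (card B + card C)"
    using fin by (simp add: card_Un_disjoint card_image inj_on_def)
  show ?thesis
    unfolding ordsign_def 1 2 3 by (simp add: power_add mult_ac flip: power_mult_distrib) 
qed

subsection \<open>The symmetric groups act on words\<close>

definition starset :: "word \<Rightarrow> nat set" where
  "starset w = {i. i < length w \<and> w ! i = None}"

lemma finite_starset [simp]: "finite (starset w)"
  by (rule finite_subset[of _ "{..<length w}"]) (auto simp: starset_def)

lemma starset_None: "starset (None # w) = insert 0 (Suc ` starset w)"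
  and starset_Some: "starset (Some a # w) = Suc ` starset w"
proof -
  have "i \<in> starset (None # w) \<longleftrightarrow> i \<in> insert 0 (Suc ` starset w)" for i
    by (cases i) (auto simp: starset_def)
  then show "starset (None # w) = insert 0 (Suc ` starset w)" by blast
  have "i \<in> starset (Some a # w) \<longleftrightarrow> i \<in> Suc ` starset w" for i
    by (cases i) (auto simp: starset_def)
  then show "starset (Some a # w) = Suc ` starset w" by blast
qed

lemma card_starset: "card (starset w) = stars w"
proof (induction w)
  case (Cons c w)
  then show ?case by (cases c) (auto simp: starset_None starset_Some card_image)
qed (simp add: starset_def)

lemma repl_eq_sum:
  "repl b x w = (\<Sum>i\<in>starset w. (-1) ^ card {j\<in>starset w. j < i} * x (w[i := Some b]))"
proof (induction w arbitrary: x)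
  case Nil
  show ?case by (simp add: starset_def)
next
  case (Cons c w)
  show ?case
  proof (cases c)
    case None
    have "{j. (j = 0 \<or> j \<in> Suc ` starset w) \<and> j < Suc i} = insert 0 (Suc ` {j\<in>starset w. j < i})" for i
      by auto
    then have "card {j. (j = 0 \<or> j \<in> Suc ` starset w) \<and> j < Suc i} = Suc (card {j\<in>starset w. j < i})" for i
      by (simp add: card_image)
    moreover have "{j. (j = 0 \<or> j \<in> Suc ` starset w) \<and> j < 0} = {}" by simp
    ultimately show ?thesis
      by (simp add: None starset_None sum.reindex Cons sum_negf)
  next
    case (Some a)
    have "{j \<in> Suc ` starset w. j < Suc i} = Suc ` {j\<in>starset w. j < i}" for i
      by auto
    then have "card {j \<in> Suc ` starset w. j < Suc i} = card {j\<in>starset w. j < i}" for i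
      by (simp add: card_image)
    then show ?thesis
      by (simp add: Some starset_Some sum.reindex Cons)
  qed
qed

definition pull :: "(nat \<Rightarrow> nat) \<Rightarrow> (nat \<Rightarrow> nat) \<Rightarrow> word \<Rightarrow> word" where
  "pull \<sigma> \<tau> w = map (\<lambda>i. map_option (inv \<sigma>) (w ! inv \<tau> i)) [0..<length w]"

text \<open>This is \<open>actA\<close> carried over to words, see \<open>actA_eq\<close>. There the
  labels are moved forward, so a function on words is evaluated at the word pulled back by the
  inverses; the sign is the action of \<open>\<tau>\<close> on the sign representation of the set of
  stars.\<close>

definition wact :: "(nat \<Rightarrow> nat) \<Rightarrow> (nat \<Rightarrow> nat) \<Rightarrow> (word \<Rightarrow> 'k::field) \<Rightarrow> word \<Rightarrow> 'k" where
  "wact \<sigma> \<tau> x w = ordsign \<tau> (starset w) * x (pull \<sigma> \<tau> w)"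

lemma length_pull [simp]: "length (pull \<sigma> \<tau> w) = length w"
  by (simp add: pull_def)

context
  fixes \<sigma> \<tau> :: "nat \<Rightarrow> nat" and m n :: nat
  assumes sig: "\<sigma> permutes {..<m}" and tau: "\<tau> permutes {..<n}"
begin

lemma inv_tau_less: "inv \<tau> i < n \<longleftrightarrow> i < n"
  and tau_less: "\<tau> i < n \<longleftrightarrow> i < n"
  and inv_sig_less: "inv \<sigma> i < m \<longleftrightarrow> i < m"
  and sig_less: "\<sigma> i < m \<longleftrightarrow> i < m"
  using permutes_in_image[OF permutes_inv[OF tau], of i] permutes_in_image[OF tau, of i]
     permutes_in_image[OF permutes_inv[OF sig], of i] permutes_in_image[OF sig, of i] by auto

lemma inv_tau_tau [simp]: "inv \<tau> (\<tau> i) = i" "\<tau> (inv \<tau> i) = i"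
  and inv_sig_sig [simp]: "inv \<sigma> (\<sigma> i) = i" "\<sigma> (inv \<sigma> i) = i"
  using permutes_inverses[OF tau] permutes_inverses[OF sig] by auto

lemma starset_pull:
  assumes "length w = n"
  shows "starset (pull \<sigma> \<tau> w) = \<tau> ` starset w"
proof (intro set_eqI iffI)
  fix i assume "i \<in> starset (pull \<sigma> \<tau> w)"
  then have "inv \<tau> i \<in> starset w" using assms by (auto simp: starset_def pull_def inv_tau_less)
  then show "i \<in> \<tau> ` starset w" by (metis image_eqI inv_tau_tau(2))
next
  fix i assume "i \<in> \<tau> ` starset w"
  then obtain j where "i = \<tau> j" "j < n" "w ! j = None" using assms by (auto simp: starset_def)
  then show "i \<in> starset (pull \<sigma> \<tau> w)" using assms by (simp add: starset_def pull_def tau_less)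
qed

lemma inj_tau: "inj_on \<tau> S"
  using tau by (rule permutes_inj_on)

lemma letters_pull:
  assumes "length w = n" "letters w = {..<m}"
  shows "letters (pull \<sigma> \<tau> w) = {..<m}"
proof -
  have "letters (pull \<sigma> \<tau> w) = inv \<sigma> ` letters w"
  proof (intro set_eqI iffI)
    fix a assume "a \<in> letters (pull \<sigma> \<tau> w)"
    then obtain i b where i: "i < n" "w ! inv \<tau> i = Some b" "a = inv \<sigma> b"
      by (auto simp: letters_def pull_def assms map_option_eq_Some dest!: sym[of "Some a"])
    then have "Some b \<in> set w" using assms(1) inv_tau_less by (metis nth_mem)
    then show "a \<in> inv \<sigma> ` letters w" using i by (auto simp: letters_def)
  next
    fix a assume "a \<in> inv \<sigma> ` letters w"
    then obtain b where b: "Some b \<in> set w" "a = inv \<sigma> b" by (auto simp: letters_def)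
    then obtain i where i: "i < n" "w ! i = Some b" "a = inv \<sigma> b"
      using assms by (metis in_set_conv_nth)
    then have "pull \<sigma> \<tau> w ! \<tau> i = Some a" "\<tau> i < n" using assms by (auto simp: pull_def tau_less)
    then show "a \<in> letters (pull \<sigma> \<tau> w)"
      using assms by (auto simp: letters_def in_set_conv_nth)
  qed
  then show ?thesis using assms permutes_image[OF permutes_inv[OF sig]] by simp
qed

lemma pull_in_words: "w \<in> words {..<m} n \<Longrightarrow> pull \<sigma> \<tau> w \<in> words {..<m} n"
  using letters_pull by (auto simp: words_def)

lemma stars_pull: "length w = n \<Longrightarrow> stars (pull \<sigma> \<tau> w) = stars w"
  by (simp flip: card_starset add: starset_pull card_image inj_tau)

lemma pull_update:
  assumes "length w = n" "i < n"
  shows "pull \<sigma> \<tau> (w[i := Some b]) = (pull \<sigma> \<tau> w)[\<tau> i := Some (inv \<sigma> b)]"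
proof (rule nth_equalityI)
  fix j assume "j < length (pull \<sigma> \<tau> (w[i := Some b]))"
  then have j: "j < n" using assms by simp
  have "inv \<tau> j = i \<longleftrightarrow> j = \<tau> i" by auto
  then show "pull \<sigma> \<tau> (w[i := Some b]) ! j = (pull \<sigma> \<tau> w)[\<tau> i := Some (inv \<sigma> b)] ! j"
    using j assms by (auto simp: pull_def nth_list_update inv_tau_less tau_less)
qed (use assms in simp)

text \<open>Filling the star i of w corresponds to filling the star \<open>\<tau> i\<close> of the
  pulled word. By \<open>ordsign_remove\<close>, the loss of i from the set of stars accounts for
  the changed sign of its position.\<close>

lemma dif_wact:
  assumes w: "length w = n"
  shows "dif {..<m} (wact \<sigma> \<tau> x) w = (wact \<sigma> \<tau> (dif {..<m} x) w :: 'k::field)"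
proof -
  let ?S = "starset w"
  have S: "i < n" if "i \<in> ?S" for i using that w by (simp add: starset_def)
  have rm: "starset (w[i := Some b]) = ?S - {i}" for i b
    by (auto simp: starset_def nth_list_update split: if_splits) (metis nth_list_update_neq option.distinct(1) nth_list_update_eq)+
  have "dif {..<m} (wact \<sigma> \<tau> x) w = (\<Sum>b<m. \<Sum>i\<in>?S. (-1) ^ card {j\<in>?S. j < i} *
      (ordsign \<tau> (?S - {i}) * x ((pull \<sigma> \<tau> w)[\<tau> i := Some (inv \<sigma> b)])))"
    unfolding dif_def repl_eq_sum wact_def rm
    by (intro sum.cong refl) (simp add: pull_update w S)
  also have "\<dots> = (\<Sum>b<m. \<Sum>i\<in>?S. (-1) ^ card {j\<in>\<tau> ` ?S. j < \<tau> i} *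
      (ordsign \<tau> ?S * x ((pull \<sigma> \<tau> w)[\<tau> i := Some (inv \<sigma> b)])))"
    using ordsign_remove[OF finite_starset _ inj_tau, where 'k = 'k, of _ w]
    by (intro sum.cong refl) (simp add: mult.assoc[symmetric] mult.commute[of _ "ordsign \<tau> ?S"])
  also have "\<dots> = (\<Sum>b\<in>inv \<sigma> ` {..<m}. \<Sum>i\<in>\<tau> ` ?S. (-1) ^ card {j\<in>\<tau> ` ?S. j < i} *
      (ordsign \<tau> ?S * x ((pull \<sigma> \<tau> w)[i := Some b])))"
    using inj_tau permutes_inj_on[OF permutes_inv[OF sig]] by (simp add: sum.reindex)
  also have "inv \<sigma> ` {..<m} = {..<m}" by (rule permutes_image[OF permutes_inv[OF sig]])
  finally show ?thesis
    unfolding wact_def dif_def repl_eq_sum starset_pull[OF w]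
    by (simp add: sum_distrib_left mult_ac)
qed

end

subsection \<open>The sign of a top word\<close>

text \<open>Places any star before all letters (for \<open>k \<ge> length w\<close>), so that the inversions of
  \<open>val k w\<close> are those of the word with the stars as distinct smallest letters.\<close>

definition val :: "nat \<Rightarrow> word \<Rightarrow> nat \<Rightarrow> nat" where
  "val k w i = (case w ! i of None \<Rightarrow> i | Some a \<Rightarrow> k + a)"

lemma val_image: "val k w ` {..<length w} = starset w \<union> (+) k ` letters w"
proof (intro set_eqI iffI)
  fix v assume "v \<in> val k w ` {..<length w}"
  then obtain i where i: "i < length w" "v = val k w i" by auto
  then show "v \<in> starset w \<union> (+) k ` letters w"
  proof (cases "w ! i")
    case (Some a)
    then have "a \<in> letters w" using i nth_mem[of i w] by (simp add: letters_def)
    then show ?thesis using i Some by (simp add: val_def)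
  qed (auto simp: starset_def val_def)
next
  fix v assume "v \<in> starset w \<union> (+) k ` letters w"
  then show "v \<in> val k w ` {..<length w}"
  proof
    assume "v \<in> starset w"
    then show ?thesis by (intro image_eqI[of _ _ v]) (auto simp: starset_def val_def)
  next
    assume "v \<in> (+) k ` letters w"
    then obtain a i where "v = k + a" "i < length w" "w ! i = Some a"
      by (auto simp: letters_def in_set_conv_nth)
    then show ?thesis by (intro image_eqI[of _ _ i]) (auto simp: val_def)
  qed
qed

lemma starset_less: "i \<in> starset w \<Longrightarrow> i < length w"
  by (simp add: starset_def)

lemma inj_on_val:
  assumes "stars w + card (letters w) = length w" "length w \<le> k"
  shows "inj_on (val k w) {..<length w}"
proof (rule eq_card_imp_inj_on)
  have "starset w \<inter> (+) k ` letters w = {}"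
    using assms(2) by (auto dest: starset_less)
  then show "card (val k w ` {..<length w}) = card {..<length w}"
    using assms(1) by (simp add: val_image card_Un_disjoint card_image card_starset)
qed simp

lemma ordsign_Suc:
  "ordsign f {..<Suc n} = (-1) ^ card {j. j < n \<and> f (Suc j) < f 0} * (ordsign (\<lambda>i. f (Suc i)) {..<n} :: 'k::field)"
proof -
  let ?J = "{j. j < n \<and> f (Suc j) < f 0}"
  let ?I = "{(x, y). x \<in> {..<n} \<and> y \<in> {..<n} \<and> x < y \<and> f (Suc y) < f (Suc x)}"
  have "{(x, y). x \<in> {..<Suc n} \<and> y \<in> {..<Suc n} \<and> x < y \<and> f y < f x} =
      (\<lambda>j. (0, Suc j)) ` ?J \<union> (\<lambda>(x, y). (Suc x, Suc y)) ` ?I" (is "?L = ?A \<union> ?B")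
  proof (intro set_eqI iffI)
    fix p assume p: "p \<in> ?L"
    show "p \<in> ?A \<union> ?B"
    proof (cases "fst p")
      case 0
      then show ?thesis using p by (cases "snd p") (auto simp: image_iff)
    next
      case (Suc x)
      then show ?thesis using p by (cases "snd p") (auto simp: image_iff)
    qed
  qed auto
  moreover have "card (?A \<union> ?B) = card ?J + card ?I"
  proof -
    have "finite ?I" by (rule finite_subset[of _ "{..<n} \<times> {..<n}"]) auto
    moreover have "?A \<inter> ?B = {}" by auto
    ultimately have "card (?A \<union> ?B) = card ?A + card ?B" by (intro card_Un_disjoint) auto
    also have "card ?A = card ?J" by (rule card_image) (simp add: inj_on_def)
    also have "card ?B = card ?I" by (rule card_image) (auto simp: inj_on_def)
    finally show ?thesis .
  qed
  ultimately have "card ?L = card ?J + card ?I" by (simp only:)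
  then show ?thesis unfolding ordsign_def by (simp only: power_add)
qed

lemma val_Suc_less:
  assumes "j < length w" "i < length w"
  shows "val (Suc (length w)) (c # w) (Suc j) < val (Suc (length w)) (c # w) (Suc i) \<longleftrightarrow>
     val (length w) w j < val (length w) w i"
  using assms by (auto simp: val_def split: option.splits)

text \<open>A permutation of places does not respect the recursion on the first letter. This closed
  form as a sign of inversions is what \<open>wact_top_sgn\<close> can work with.\<close>

lemma top_sgn_eq:
  assumes "finite Y"
  shows "top_sgn Y w = (if letters w = Y \<and> stars w + card Y = length w
     then ordsign (val (length w) w) {..<length w} else (0 :: 'k::field))"
  using assms
proof (induction w arbitrary: Y)
  case Nil
  have "ordsign f {} = (1::'k)" for f by (rule ordsign_increasing) auto
  then show ?case by auto
next
  case (Cons c w)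
  let ?v = "val (Suc (length w)) (c # w)"
  have *: "ordsign (\<lambda>i. ?v (Suc i)) {..<length w} = (ordsign (val (length w) w) {..<length w} :: 'k)"
    by (rule ordsign_cong) (auto simp: val_Suc_less)
  show ?case
  proof (cases c)
    case None
    have "{j. j < length w \<and> ?v (Suc j) < ?v 0} = {}" by (auto simp: val_def None)
    then have "ordsign ?v {..<Suc (length w)} = (ordsign (val (length w) w) {..<length w} :: 'k)"
      by (simp only: ordsign_Suc * card.empty power_0 mult_1)
    then show ?thesis
      using Cons by (simp add: None)
  next
    case (Some a)
    show ?thesis
    proof (cases "a \<in> Y \<and> letters w = Y - {a} \<and> stars w + card (Y - {a}) = length w")
      case True
      then have TY: "a \<in> Y" and TL: "letters w = Y - {a}" and TS: "stars w + card (Y - {a}) = length w"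
        by blast+
      then have TY: "a \<in> Y" and TL: "letters w = Y - {a}" and TS: "stars w + card (Y - {a}) = length w"
        by blast+
      have Y: "card Y = Suc (card (Y - {a}))" using Cons.prems TY by (metis card_Suc_Diff1)
      let ?u = "val (length w) w" and ?J = "{j. j < length w \<and> val (length w) w j < length w + a}"
      have J: "{j. j < length w \<and> ?v (Suc j) < ?v 0} = ?J"
      proof (rule Collect_cong, rule conj_cong[OF refl])
        fix j assume "j < length w"
        then show "?v (Suc j) < ?v 0 \<longleftrightarrow> ?u j < length w + a"
          by (cases "w ! j") (simp_all add: val_def Some)
      qed
      have "stars w + card (letters w) = length w" using TL TS by argo
      then have "inj_on ?u {..<length w}" by (intro inj_on_val) auto
      then have "inj_on ?u ?J" by (rule inj_on_subset) auto
      then have "card ?J = card (?u ` ?J)" by (simp add: card_image)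
      also have "?u ` ?J = {v \<in> ?u ` {..<length w}. v < length w + a}" by auto
      also have "\<dots> = starset w \<union> (+) (length w) ` {b\<in>Y. b < a}"
        unfolding val_image TL by (auto dest: starset_less)
      also have "card \<dots> = stars w + card {b\<in>Y. b < a}"
        using Cons.prems by (subst card_Un_disjoint) (auto simp: card_image card_starset dest: starset_less)
      finally have c: "card {j. j < length w \<and> ?v (Suc j) < ?v 0} = stars w + card {b\<in>Y. b < a}"
        unfolding J .
      have "even (card {b\<in>Y. b < a} + Suc (length w) + card Y + (stars w + card {b\<in>Y. b < a}))"
        using TS unfolding Y by presburger
      then have "(-1) ^ card {j. j < length w \<and> ?v (Suc j) < ?v 0} = (tsgn Y (Suc (length w)) a :: 'k)"
        unfolding c minus_one_power_iff by (auto split: if_splits)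
      then have "ordsign ?v {..<Suc (length w)} = tsgn Y (Suc (length w)) a * (ordsign (val (length w) w) {..<length w} :: 'k)"
        by (simp only: ordsign_Suc *)
      moreover have "top_sgn (Y - {a}) w = (ordsign (val (length w) w) {..<length w} :: 'k)"
        using Cons.IH[of "Y - {a}"] Cons.prems TL TS by (simp only: finite_Diff if_True simp_thms)
      moreover have "insert a (letters w) = Y" using TL TY by auto
      moreover have "stars w + card Y = Suc (length w)" using TS unfolding Y by simp
      ultimately show ?thesis
        using TY Cons.prems by (simp add: Some)
    next
      case False
      have "\<not> (insert a (letters w) = Y \<and> stars w + card Y = Suc (length w))"
      proof
        assume A: "insert a (letters w) = Y \<and> stars w + card Y = Suc (length w)"
        then have "a \<notin> letters w" using card_letters_stars[of w] by (auto simp: insert_absorb)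
        then show False using A False by auto
      qed
      moreover have "a \<in> Y \<Longrightarrow> top_sgn (Y - {a}) w = (0::'k)"
        using Cons.IH[of "Y - {a}"] False Cons.prems by (metis finite_Diff)
      ultimately show ?thesis by (auto simp: Some)
    qed
  qed
qed

lemma ordsign_inv:
  assumes "\<tau> permutes A" "finite S"
  shows "ordsign (inv \<tau>) (\<tau> ` S) = (ordsign \<tau> S :: 'k::field)"
proof -
  have "ordsign (inv \<tau> \<circ> \<tau>) S = ordsign (inv \<tau>) (\<tau> ` S) * (ordsign \<tau> S :: 'k)"
    using assms by (intro ordsign_comp permutes_inj_on[OF permutes_inv[OF assms(1)]] permutes_inj_on[OF assms(1)]) auto
  moreover have "ordsign (inv \<tau> \<circ> \<tau>) S = (1 :: 'k)"
    by (rule ordsign_increasing) (simp add: permutes_inverses[OF assms(1)])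
  ultimately have 1: "ordsign (inv \<tau>) (\<tau> ` S) * ordsign \<tau> S = (1 :: 'k)" by simp
  have "ordsign (inv \<tau>) (\<tau> ` S) = ordsign (inv \<tau>) (\<tau> ` S) * (ordsign \<tau> S * ordsign \<tau> S :: 'k)" by simp
  also have "\<dots> = ordsign \<tau> S" unfolding mult.assoc[symmetric] 1 by simp
  finally show ?thesis .
qed

text \<open>Read the word as an arrangement of distinct values. Permuting the places contributes the
  sign of \<open>\<tau>\<close>, renaming the letters the sign of \<open>\<sigma>\<close>, and
  renaming the stars by their new places the sign of \<open>\<tau>\<close> on the set of stars,
  which is the twist in \<open>wact\<close>.\<close>

lemma wact_top_sgn:
  assumes sig: "\<sigma> permutes {..<m}" and tau: "\<tau> permutes {..<n}" and w: "w \<in> words {..<m} n"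
  shows "wact \<sigma> \<tau> (top_sgn {..<m}) w = of_int (sign \<sigma> * sign \<tau>) * (top_sgn {..<m} w :: 'k::field)"
proof -
  let ?w = "pull \<sigma> \<tau> w"
  have len: "length w = n" and lw: "letters w = {..<m}" "letters ?w = {..<m}" and st: "stars ?w = stars w"
    using w pull_in_words[OF sig tau w] stars_pull[OF sig tau] by (auto simp: words_def)
  show ?thesis
  proof (cases "stars w + m = n")
    case True
    \<comment> \<open>The renaming of values from the pulled word back to w: values below n are
      places of stars, the others are letters shifted by n.\<close>
    define h where "h v = (if v < n then inv \<tau> v else n + \<sigma> (v - n))" for v
    let ?S = "starset w" and ?V = "\<tau> ` starset w \<union> (+) n ` {..<m}"
    have img: "val n ?w ` {..<n} = ?V"
      using val_image[of n ?w] by (simp add: len lw starset_pull[OF sig tau len])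
    have inj1: "inj_on (val n ?w) {..<n}"
      using inj_on_val[of ?w n] True by (simp add: len lw st)
    have less: "\<tau> i < n" if "i \<in> ?S" for i
      using that tau_less[OF sig tau] by (auto simp: starset_def len)
    have comp: "val n w i = (h \<circ> val n ?w \<circ> \<tau>) i" if "i < n" for i
      using that by (auto simp: val_def h_def pull_def len tau_less[OF sig tau] inv_tau_tau[OF sig tau]
        inv_sig_sig[OF sig tau] split: option.splits)
    have injh: "inj_on h (val n ?w ` {..<n})"
    proof (rule inj_on_imageI)
      have "inj_on (val n w \<circ> inv \<tau>) {..<n}"
        using permutes_inv[OF tau] inj_on_val[of w n] True
        by (intro comp_inj_on) (auto simp: permutes_image permutes_inj_on len lw)
      then show "inj_on (h \<circ> val n ?w) {..<n}"
        by (rule inj_on_cong[THEN iffD1, rotated])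
          (simp add: comp inv_tau_less[OF sig tau] inv_tau_tau[OF sig tau])
    qed
    have tim: "\<tau> ` {..<n} = {..<n}" using tau by (rule permutes_image)
    have "ordsign (val n w) {..<n} = (ordsign (h \<circ> val n ?w \<circ> \<tau>) {..<n} :: 'k)"
      by (rule ordsign_cong) (simp only: comp lessThan_iff)
    also have "\<dots> = ordsign (h \<circ> val n ?w) {..<n} * ordsign \<tau> {..<n}"
      using ordsign_comp[of "{..<n}" \<tau> "h \<circ> val n ?w"] inj1 injh tau
      by (simp add: tim permutes_inj_on comp_inj_on)
    also have "ordsign (h \<circ> val n ?w) {..<n} = ordsign h ?V * (ordsign (val n ?w) {..<n} :: 'k)"
      using ordsign_comp[of "{..<n}" "val n ?w" h] inj1 injh by (simp add: img)
    also have "ordsign h ?V = ordsign h (\<tau> ` ?S) * (ordsign h ((+) n ` {..<m}) :: 'k)"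
    proof (rule ordsign_Un)
      fix s t assume "s \<in> \<tau> ` ?S" "t \<in> (+) n ` {..<m}"
      then have "s < n" "n \<le> t" using less by auto
      moreover have "inv \<tau> s < n" using \<open>s < n\<close> inv_tau_less[OF sig tau] by simp
      ultimately show "s < t \<and> h s < h t" by (auto simp: h_def)
    qed auto
    also have "ordsign h (\<tau> ` ?S) = (ordsign (inv \<tau>) (\<tau> ` ?S) :: 'k)"
      using less by (intro ordsign_cong) (auto simp: h_def)
    also have "\<dots> = ordsign \<tau> ?S" using tau by (rule ordsign_inv) simp
    also have "ordsign h ((+) n ` {..<m}) = (ordsign \<sigma> {..<m} :: 'k)"
      unfolding ordsign_shift by (intro ordsign_cong) (auto simp: h_def)
    finally have 1: "ordsign (val n w) {..<n} =
        of_int (sign \<sigma> * sign \<tau>) * (ordsign \<tau> ?S * ordsign (val n ?w) {..<n} :: 'k)"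
      by (simp add: ordsign_permutes[OF sig] ordsign_permutes[OF tau] mult_ac)
    have "(sign \<sigma> * sign \<tau>) * (sign \<sigma> * sign \<tau>) = 1"
      by (simp add: sign_def)
    then have "of_int (sign \<sigma> * sign \<tau>) * of_int (sign \<sigma> * sign \<tau>) = (1 :: 'k)"
      unfolding of_int_mult[symmetric] by (simp only: of_int_1)
    then have "ordsign \<tau> ?S * ordsign (val n ?w) {..<n} = of_int (sign \<sigma> * sign \<tau>) * (ordsign (val n w) {..<n} :: 'k)"
      unfolding 1 mult.assoc[symmetric] by (simp only: mult_1)
    then show ?thesis using True by (simp add: wact_def top_sgn_eq len lw st)
  next
    case False
    then show ?thesis by (simp add: wact_def top_sgn_eq len lw st)
  qed
qed

subsection \<open>Matrices with rational entries\<close>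

definition mat_op :: "'w set \<Rightarrow> ('w \<Rightarrow> 'w \<Rightarrow> 'k::field) \<Rightarrow> ('w \<Rightarrow> 'k) \<Rightarrow> 'w \<Rightarrow> 'k" where
  "mat_op W A x w = (if w \<in> W then \<Sum>v\<in>W. A w v * x v else 0)"

lemma mat_op_add: "mat_op W A (\<lambda>u. x u + y u) w = mat_op W A x w + mat_op W A y w"
  by (simp add: mat_op_def algebra_simps sum.distrib)

lemma mat_op_diff: "mat_op W A (\<lambda>u. x u - y u) w = mat_op W A x w - mat_op W A y w"
  by (simp add: mat_op_def algebra_simps sum_subtractf)

lemma mat_op_scale: "mat_op W A (\<lambda>u. c * x u) w = c * mat_op W A x w"
  by (simp add: mat_op_def sum_distrib_left mult_ac)

lemma mat_op_zero [simp]: "mat_op W A (\<lambda>u. 0) w = 0"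
  by (simp add: mat_op_def)

lemma mat_op_sum: "mat_op W A (\<lambda>u. \<Sum>i\<in>I. x i u) w = (\<Sum>i\<in>I. mat_op W A (x i) w)"
  by (induction I rule: infinite_finite_induct) (auto simp: mat_op_add)

lemma mat_op_outside: "w \<notin> W \<Longrightarrow> mat_op W A x w = 0"
  by (simp add: mat_op_def)

lemma mat_op_adjoint:
  "(\<Sum>w\<in>W. mat_op W A x w * y w) = (\<Sum>w\<in>W. x w * mat_op W (\<lambda>w v. A v w) y w)"
proof -
  have "(\<Sum>w\<in>W. mat_op W A x w * y w) = (\<Sum>w\<in>W. \<Sum>v\<in>W. A w v * x v * y w)"
    by (simp add: mat_op_def sum_distrib_right)
  also have "\<dots> = (\<Sum>v\<in>W. \<Sum>w\<in>W. A w v * x v * y w)" by (rule sum.swap)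
  also have "\<dots> = (\<Sum>w\<in>W. x w * mat_op W (\<lambda>w v. A v w) y w)"
    by (simp add: mat_op_def sum_distrib_left mult_ac)
  finally show ?thesis .
qed

text \<open>The coordinate at y in a basis of the field over the rationals that contains y.\<close>

lemma ex_rat_functional:
  fixes y :: "'k::field_char_0"
  assumes "y \<noteq> 0"
  obtains l :: "'k \<Rightarrow> rat" where "\<And>u v. l (u + v) = l u + l v" "\<And>q u. l (of_rat q * u) = q * l u" "l y \<noteq> 0"
proof -
  interpret vector_space "\<lambda>(q::rat) (u::'k). of_rat q * u"
    by unfold_locales (auto simp: of_rat_mult of_rat_add algebra_simps)
  define B where "B = extend_basis {y}"
  have iy: "independent {y}" using assms by (simp add: dependent_single)
  have B: "independent B" "span B = UNIV" "y \<in> B"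
    using independent_extend_basis[OF iy] span_extend_basis[OF iy] extend_basis_superset[OF iy]
    by (auto simp: B_def)
  show ?thesis
  proof
    show "representation B (u + v) y = representation B u y + representation B v y" for u v
      using B by (simp add: representation_add)
    show "representation B (of_rat q * u) y = q * representation B u y" for q u
      using B by (simp add: representation_scale)
    show "representation B y y \<noteq> 0"
      using B by (simp add: representation_basis)
  qed
qed

text \<open>Over \<open>'k\<close> the form \<open>\<Sum>w. x w * y w\<close> may be isotropic; rational functionals on \<open>'k\<close> reduce the
  claim to positive definiteness over the rationals.\<close>

lemma rat_gram:
  fixes x :: "'w \<Rightarrow> 'k::field_char_0" and B :: "'w \<Rightarrow> 'w \<Rightarrow> rat"
  assumes "finite W"
    and 0: "\<And>w. w \<in> W \<Longrightarrow> mat_op W (\<lambda>w v. of_rat (B v w)) (mat_op W (\<lambda>w v. of_rat (B w v)) x) w = 0"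
  shows "mat_op W (\<lambda>w v. of_rat (B w v)) x w = 0"
proof (rule ccontr)
  define y where "y = mat_op W (\<lambda>w v. of_rat (B w v)) x"
  assume "mat_op W (\<lambda>w v. of_rat (B w v)) x w \<noteq> 0"
  then have w: "w \<in> W" "y w \<noteq> 0" by (auto simp: y_def mat_op_def split: if_splits)
  obtain l :: "'k \<Rightarrow> rat" where l: "\<And>u v. l (u + v) = l u + l v" "\<And>q u. l (of_rat q * u) = q * l u" "l (y w) \<noteq> 0"
    using ex_rat_functional[OF w(2)] by metis
  have l0: "l 0 = 0" using l(1)[of 0 0] by simp
  have lsum: "l (\<Sum>i\<in>I. f i) = (\<Sum>i\<in>I. l (f i))" for f :: "'w \<Rightarrow> 'k" and I
    by (induction I rule: infinite_finite_induct) (auto simp: l0 l)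
  have lmat: "l (mat_op W (\<lambda>w v. of_rat (A w v)) z u) = mat_op W A (\<lambda>u. l (z u)) u" for A z u
    by (simp add: mat_op_def lsum l l0)
  let ?x = "\<lambda>u. l (x u)" and ?y = "\<lambda>u. l (y u)"
  have y: "?y u = mat_op W B ?x u" for u by (simp add: y_def lmat)
  have "mat_op W (\<lambda>w v. B v w) ?y u = l (mat_op W (\<lambda>w v. of_rat (B v w)) y u)" for u by (simp add: lmat)
  then have By: "mat_op W (\<lambda>w v. B v w) ?y u = 0" if "u \<in> W" for u
    using 0[OF that] l0 by (simp add: y_def)
  have "(\<Sum>u\<in>W. ?y u * ?y u) = (\<Sum>u\<in>W. mat_op W B ?x u * ?y u)" by (simp only: y)
  also have "\<dots> = 0" unfolding mat_op_adjoint using By by simp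
  finally have "(\<Sum>u\<in>W. ?y u * ?y u) = 0" .
  then have "?y w * ?y w = 0"
    using assms(1) w by (subst (asm) sum_nonneg_eq_0_iff) auto
  then show False using l by simp
qed

text \<open>Gaussian elimination: a vector k that is non-zero at u clears the coordinate u of all
  the others. The lemma serves to find a polynomial relation among the iterates of an operator on
  one vector.\<close>

lemma ex_relation:
  fixes f :: "'i \<Rightarrow> 'w \<Rightarrow> 'k::field"
  assumes "finite W" "finite I" "card W < card I"
  shows "\<exists>c. (\<exists>i\<in>I. c i \<noteq> 0) \<and> (\<forall>w\<in>W. (\<Sum>i\<in>I. c i * f i w) = 0)"
  using assms
proof (induction W arbitrary: I f rule: finite_induct)
  case empty
  then obtain i where "i \<in> I" by fastforce
  then show ?case by (intro exI[of _ "\<lambda>_. 1"]) auto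
next
  case (insert u W)
  show ?case
  proof (cases "\<forall>i\<in>I. f i u = 0")
    case True
    have "card W < card I" using insert.prems insert.hyps by simp
    from insert.IH[OF insert.prems(1) this, of f]
    obtain c where "\<exists>i\<in>I. c i \<noteq> 0" "\<forall>w\<in>W. (\<Sum>i\<in>I. c i * f i w) = 0"
      by blast
    then show ?thesis using True by (intro exI[of _ c]) auto
  next
    case False
    then obtain k where k: "k \<in> I" "f k u \<noteq> 0" by blast
    define g where "g i w = f i w - f i u / f k u * f k w" for i w
    have "card W < card (I - {k})" using insert.prems insert.hyps k by simp
    from insert.IH[OF finite_Diff[OF insert.prems(1)] this, of g]
    obtain c where c: "\<exists>i\<in>I - {k}. c i \<noteq> 0" "\<forall>w\<in>W. (\<Sum>i\<in>I - {k}. c i * g i w) = 0"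
      by blast
    define c' where "c' i = (if i = k then - (\<Sum>i\<in>I - {k}. c i * (f i u / f k u)) else c i)" for i
    have "(\<Sum>i\<in>I. c' i * f i w) = (\<Sum>i\<in>I - {k}. c i * g i w)" for w
    proof -
      have "(\<Sum>i\<in>I. c' i * f i w) = c' k * f k w + (\<Sum>i\<in>I - {k}. c i * f i w)"
        using insert.prems k by (simp add: sum.remove[of I k] c'_def)
      also have "\<dots> = (\<Sum>i\<in>I - {k}. c i * g i w)"
        by (simp add: g_def c'_def algebra_simps sum_subtractf sum_distrib_left)
      finally show ?thesis .
    qed
    moreover have "g i u = 0" for i using k by (simp add: g_def)
    ultimately have "\<forall>w\<in>insert u W. (\<Sum>i\<in>I. c' i * f i w) = 0" using c by simp
    moreover have "\<exists>i\<in>I. c' i \<noteq> 0" using c by (auto simp: c'_def)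
    ultimately show ?thesis by blast
  qed
qed

text \<open>If the square of an operator T has no larger kernel than T, then kernel and image span.
  Factor the lowest power \<open>T^r\<close> out of a polynomial relation for y: the remaining
  factor u satisfies \<open>T^r u = 0\<close>, hence \<open>T u = 0\<close>, and u is a non-zero
  multiple of y plus an image under T.\<close>

lemma mat_op_decomposition:
  fixes A :: "'w \<Rightarrow> 'w \<Rightarrow> 'k::field"
  assumes "finite W"
    and ker: "\<And>x. (\<And>w. mat_op W A (mat_op W A x) w = 0) \<Longrightarrow> (\<And>w. mat_op W A x w = 0)"
    and y: "\<And>w. w \<notin> W \<Longrightarrow> y w = 0"
  shows "\<exists>h z. (\<forall>w. mat_op W A h w = 0) \<and> (\<forall>w. y w = h w + mat_op W A z w) \<and> (\<forall>w. w \<notin> W \<longrightarrow> h w = 0)"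
proof -
  let ?T = "mat_op W A" and ?N = "card W"
  obtain c where c: "\<exists>i\<in>{..?N}. c i \<noteq> 0" "\<And>w. w \<in> W \<Longrightarrow> (\<Sum>i\<le>?N. c i * (?T ^^ i) y w) = 0"
    using ex_relation[OF assms(1), of "{..?N}" "\<lambda>i. (?T ^^ i) y"] by auto
  have out: "(?T ^^ i) y w = 0" if "w \<notin> W" for i w
    using that y by (cases i) (auto simp: mat_op_def)
  define r where "r = (LEAST i. c i \<noteq> 0)"
  obtain i where i: "c i \<noteq> 0" "i \<le> ?N" using c(1) by auto
  have r: "c r \<noteq> 0" unfolding r_def by (rule LeastI[of "\<lambda>i. c i \<noteq> 0", OF i(1)])
  have rN: "r \<le> ?N" using Least_le[of "\<lambda>i. c i \<noteq> 0", OF i(1)] i(2) by (simp add: r_def)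
  have less: "c i = 0" if "i < r" for i
    using not_less_Least[of i "\<lambda>i. c i \<noteq> 0"] that by (auto simp: r_def)
  define u where "u w = (\<Sum>i\<in>{r..?N}. c i * (?T ^^ (i - r)) y w)" for w
  have Tu: "(?T ^^ j) u w = (\<Sum>i\<in>{r..?N}. c i * (?T ^^ (j + (i - r))) y w)" for j w
  proof (induction j arbitrary: w)
    case (Suc j)
    have "(?T ^^ j) u = (\<lambda>w. \<Sum>i\<in>{r..?N}. c i * (?T ^^ (j + (i - r))) y w)"
      by (rule ext) (rule Suc)
    then have "(?T ^^ Suc j) u w = ?T (\<lambda>w. \<Sum>i\<in>{r..?N}. c i * (?T ^^ (j + (i - r))) y w) w"
      by (simp only: funpow.simps o_apply)
    also have "\<dots> = (\<Sum>i\<in>{r..?N}. c i * (?T ^^ (Suc j + (i - r))) y w)"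
      by (simp only: mat_op_sum mat_op_scale funpow.simps o_apply add_Suc)
    finally show ?case .
  qed (simp add: u_def)
  have "(?T ^^ r) u w = 0" for w
  proof -
    have "(?T ^^ r) u w = (\<Sum>i\<in>{r..?N}. c i * (?T ^^ i) y w)"
      unfolding Tu by (intro sum.cong) auto
    also have "\<dots> = (\<Sum>i\<le>?N. c i * (?T ^^ i) y w)"
      using less by (intro sum.mono_neutral_left) (auto simp: not_le)
    also have "\<dots> = 0" using c(2)[of w] out[of w] by (cases "w \<in> W") auto
    finally show ?thesis .
  qed
  \<comment> \<open>The kernel hypothesis takes off one power of the operator at a time, down to the
    first.\<close>
  then have "?T u w = 0" for w
  proof (induction r)
    case 0
    then have "u = (\<lambda>_. 0)" by auto
    then show ?case by simp
  next
    case (Suc r)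
    show ?case
    proof (cases r)
      case (Suc k)
      have "(?T ^^ Suc r) u w = ?T (?T ((?T ^^ k) u)) w" for w by (simp add: Suc)
      then have "?T ((?T ^^ k) u) w = 0" for w using ker Suc.prems by simp
      then show ?thesis using Suc.IH by (simp add: Suc)
    qed (use Suc.prems in simp)
  qed
  note Tu0 = this
  define z where "z w = (\<Sum>i\<in>{Suc r..?N}. c i * (?T ^^ (i - Suc r)) y w)" for w
  have u: "u w = c r * y w + ?T z w" for w
  proof -
    have "u w = c r * y w + (\<Sum>i\<in>{Suc r..?N}. c i * (?T ^^ (i - r)) y w)"
      using rN by (simp add: u_def sum.atLeast_Suc_atMost)
    also have "(\<Sum>i\<in>{Suc r..?N}. c i * (?T ^^ (i - r)) y w) = ?T z w"
      unfolding z_def[abs_def] mat_op_sum mat_op_scale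
    proof (rule sum.cong[OF refl])
      fix i assume "i \<in> {Suc r..?N}"
      then have "i - r = Suc (i - Suc r)" by auto
      then show "c i * (?T ^^ (i - r)) y w = c i * ?T ((?T ^^ (i - Suc r)) y) w" by simp
    qed
    finally show ?thesis .
  qed
  let ?h = "\<lambda>w. inverse (c r) * u w" and ?z = "\<lambda>w. - inverse (c r) * z w"
  have "?T ?h w = 0" for w unfolding mat_op_scale using Tu0 by simp
  moreover have "y w = ?h w + ?T ?z w" for w
    unfolding mat_op_scale u using r by (simp add: algebra_simps)
  moreover have "?h w = 0" if "w \<notin> W" for w
    using that by (simp add: u y mat_op_outside)
  ultimately show ?thesis by blast
qed

subsection \<open>The complex of words\<close>

definition dmat :: "nat \<Rightarrow> word \<Rightarrow> word \<Rightarrow> 'k::field" where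
  "dmat m w v = dif {..<m} (\<lambda>u. of_bool (u = v)) w"

lemma repl_of_rat: "repl b (\<lambda>u. of_rat (x u)) w = (of_rat (repl b x w) :: 'k::field_char_0)"
  by (induction b x w rule: repl.induct) (auto simp: of_rat_diff)

lemma dmat_of_rat: "dmat m w v = (of_rat (dmat m w v) :: 'k::field_char_0)"
proof -
  have "(\<lambda>u. of_bool (u = v)) = (\<lambda>u. of_rat (of_bool (u = v)) :: 'k)" by auto
  then show ?thesis unfolding dmat_def dif_def by (simp only: repl_of_rat of_rat_sum)
qed

lemma of_rat_mat_flip:
  "(\<lambda>w v. of_rat (dmat m v w) :: 'k::field_char_0) = (\<lambda>w v. dmat m v w)"
  "(\<lambda>w v. of_rat (dmat m w v) :: 'k::field_char_0) = (\<lambda>w v. dmat m w v)"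
  by (simp_all flip: dmat_of_rat)

context
  fixes m n :: nat
begin

private abbreviation (input) "W \<equiv> words {..<m} n"

definition d_op :: "(word \<Rightarrow> 'k::field) \<Rightarrow> word \<Rightarrow> 'k" where
  "d_op = mat_op W (\<lambda>w v. dmat m w v)"

definition ad_op :: "(word \<Rightarrow> 'k::field) \<Rightarrow> word \<Rightarrow> 'k" where
  "ad_op = mat_op W (\<lambda>w v. dmat m v w)"

definition hodge :: "(word \<Rightarrow> 'k::field) \<Rightarrow> word \<Rightarrow> 'k" where
  "hodge = mat_op W (\<lambda>w v. dmat m w v + dmat m v w)"

lemma hodge_eq: "hodge x w = d_op x w + ad_op x w"
  by (simp add: hodge_def d_op_def ad_op_def mat_op_def sum.distrib algebra_simps)

lemma d_op_eq:
  assumes "w \<in> W"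
  shows "d_op x w = dif {..<m} x w"
proof -
  have "dif {..<m} x w = dif {..<m} (\<lambda>u. \<Sum>v\<in>W. x v * of_bool (u = v)) w"
    by (rule dif_cong[OF assms]) (simp add: of_bool_def if_distrib cong: if_cong)
  also have "\<dots> = (\<Sum>v\<in>W. x v * dmat m w v)"
    unfolding dif_sum dif_scale dmat_def ..
  finally show ?thesis using assms by (simp add: d_op_def mat_op_def mult.commute)
qed

lemma d_op_d_op: "d_op (d_op x) w = (0 :: 'k::field_char_0)"
proof (cases "w \<in> W")
  case True
  have "dif {..<m} (d_op x) w = dif {..<m} (dif {..<m} x) w"
    by (rule dif_cong[OF True]) (simp add: d_op_eq)
  also have "\<dots> = (\<Sum>b<m. \<Sum>c<m. repl b (repl c x) w)"
    by (simp add: dif_def[abs_def] repl_sum)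
  finally have 1: "d_op (d_op x) w = (\<Sum>b<m. \<Sum>c<m. repl b (repl c x) w)"
    using True by (simp add: d_op_eq)
  also have "\<dots> = (\<Sum>b<m. \<Sum>c<m. - repl c (repl b x) w)"
    by (intro sum.cong refl repl_repl)
  also have "\<dots> = - (\<Sum>b<m. \<Sum>c<m. repl b (repl c x) w)"
    by (subst sum.swap) (simp add: sum_negf)
  finally have "d_op (d_op x) w = - d_op (d_op x) w" unfolding 1 .
  then show ?thesis by (simp add: eq_neg_iff_add_eq_0)
qed (simp add: d_op_def mat_op_def)

text \<open>Applying d to the equation leaves only d d^T x = 0, because d d = 0. Then
  \<open>rat_gram\<close> for the matrix of d^T gives d^T x = 0.\<close>

lemma hodge_kernel:
  fixes x :: "word \<Rightarrow> 'k::field_char_0"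
  assumes "\<And>w. hodge x w = 0"
  shows "ad_op x w = 0" "d_op x w = 0"
proof -
  have "d_op (ad_op x) w = 0" for w
  proof -
    have "(\<lambda>w. d_op x w + ad_op x w) = (\<lambda>w. 0)"
      using assms by (simp add: fun_eq_iff hodge_eq)
    then have "d_op (\<lambda>w. d_op x w + ad_op x w) w = 0"
      by (simp only:) (simp add: d_op_def)
    moreover have "d_op (\<lambda>w. d_op x w + ad_op x w) w = d_op (d_op x) w + d_op (ad_op x) w"
      by (simp add: d_op_def mat_op_add)
    ultimately show ?thesis by (simp add: d_op_d_op)
  qed
  then have ad: "ad_op x w = 0" for w
    using rat_gram[of W "\<lambda>w v. dmat m v w" x w]
    by (simp add: of_rat_mat_flip ad_op_def d_op_def)
  then show "ad_op x w = 0" .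
  show "d_op x w = 0" using assms[of w] ad[of w] by (simp add: hodge_eq)
qed

text \<open>The matrix of \<open>hodge\<close> is symmetric and rational, so its square is a Gram
  matrix.\<close>

lemma hodge_hodge_kernel:
  fixes x :: "word \<Rightarrow> 'k::field_char_0"
  assumes "\<And>w. hodge (hodge x) w = 0"
  shows "hodge x w = 0"
proof -
  have 1: "(\<lambda>w v. of_rat (dmat m w v + dmat m v w) :: 'k) = (\<lambda>w v. dmat m w v + dmat m v w)"
    by (simp add: of_rat_add flip: dmat_of_rat)
  have 2: "(\<lambda>w v. of_rat (dmat m v w + dmat m w v) :: 'k) = (\<lambda>w v. dmat m w v + dmat m v w)"
    by (simp add: of_rat_add add.commute flip: dmat_of_rat)
  show ?thesis
    using rat_gram[of W "\<lambda>w v. dmat m w v + dmat m v w" x w] assms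
    unfolding 1 2 by (simp add: hodge_def)
qed

lemma ad_d_kernel:
  fixes x :: "word \<Rightarrow> 'k::field_char_0"
  assumes "\<And>w. ad_op (d_op x) w = 0"
  shows "d_op x w = 0"
  using rat_gram[of W "\<lambda>w v. dmat m w v" x w] assms
  by (simp add: of_rat_mat_flip ad_op_def d_op_def)

text \<open>A harmonic x is a cocycle. Without homology at either end it is exact, say d y; as also
  d^T d y = 0, it vanishes.\<close>

lemma hodge_kernel_zero:
  fixes x :: "word \<Rightarrow> 'k::field_char_0"
  assumes T: "\<And>w. hodge x w = 0" and 0: "\<And>w. w \<in> W \<Longrightarrow> stars w = 0 \<Longrightarrow> x w = 0"
    and top: "m < n \<Longrightarrow> top_sum {..<m} n x = 0" and w: "w \<in> W"
  shows "x w = 0"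
proof -
  have "\<exists>y. \<forall>w\<in>W. stars w \<ge> 1 \<longrightarrow> x w = dif {..<m} y w"
  proof (rule exactness)
    show "dif {..<m} x w = 0" if "w \<in> W" for w
      using hodge_kernel(2)[OF T, of w] that by (simp add: d_op_eq)
  qed (use top in auto)
  then obtain y where y: "\<And>w. w \<in> W \<Longrightarrow> stars w \<ge> 1 \<Longrightarrow> x w = dif {..<m} y w" by blast
  have xd: "x w = d_op y w" if "w \<in> W" for w
    using y[OF that] 0[OF that] dif_starless[of w "{..<m}" y] that
    by (cases "stars w = 0") (auto simp: d_op_eq)
  have "ad_op (d_op y) w = ad_op x w" for w
    by (simp add: ad_op_def mat_op_def xd)
  then have "ad_op (d_op y) w = 0" for w using hodge_kernel(1)[OF T] by simp
  then have "d_op y w = 0" by (rule ad_d_kernel)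
  then show ?thesis using xd[OF w] by simp
qed

text \<open>No words have more stars than the top ones, so d kills the vector; d^T kills it because
  it is the coefficient vector of a functional that vanishes on the image of d.\<close>

lemma hodge_top_sgn: "hodge (top_sgn {..<m}) w = (0::'k::field)"
proof -
  have t0: "top_sgn {..<m} v = (0::'k)" if "v \<in> W" "stars v + m \<noteq> n" for v
    using that by (simp add: top_sgn_eq words_def)
  have "d_op (top_sgn {..<m}) w = (0::'k)"
  proof (cases "w \<in> W")
    case True
    have "stars w + m \<le> n" using card_letters_stars[of w] True by (simp add: words_def)
    then have "dif {..<m} (top_sgn {..<m}) w = dif {..<m} (\<lambda>_. 0::'k) w"
      by (intro dif_cong[OF True] t0) auto
    then show ?thesis using True by (simp add: d_op_eq dif_def)
  qed (simp add: d_op_def mat_op_def)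
  moreover have "ad_op (top_sgn {..<m}) w = (0::'k)"
  proof (cases "w \<in> W")
    case True
    have "ad_op (top_sgn {..<m}) w = (\<Sum>v\<in>W. top_sgn {..<m} v * dmat m v w :: 'k)"
      using True by (simp add: ad_op_def mat_op_def mult.commute)
    also have "\<dots> = top_sum {..<m} n (dif {..<m} (\<lambda>u. of_bool (u = w)))"
      by (simp add: top_sum_eq_sum dmat_def)
    also have "\<dots> = 0" by (rule top_sum_dif) simp
    finally show ?thesis .
  qed (simp add: ad_op_def mat_op_def)
  ultimately show ?thesis by (simp add: hodge_eq)
qed

text \<open>The coefficients are signs on the top words, so the value is the number of top words,
  which is not zero in characteristic zero.\<close>

lemma top_sum_top_sgn:
  assumes "m \<le> n"
  shows "top_sum {..<m} n (top_sgn {..<m}) \<noteq> (0::'k::field_char_0)"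
proof -
  let ?U = "{w\<in>W. stars w + m = n}"
  have sq: "top_sgn {..<m} w * top_sgn {..<m} w = (if stars w + m = n then 1 else 0 :: 'k)" if "w \<in> W" for w
    using that by (simp add: top_sgn_eq words_def)
  have "top_sum {..<m} n (top_sgn {..<m}) = (\<Sum>w\<in>W. if stars w + m = n then 1 else 0 :: 'k)"
    by (simp add: top_sum_eq_sum sq)
  also have "\<dots> = of_nat (card ?U)" by (simp add: sum.If_cases Int_def)
  finally have 1: "top_sum {..<m} n (top_sgn {..<m}) = (of_nat (card ?U) :: 'k)" .
  have "?U \<noteq> {}" using ex_top_word[of "{..<m}" n] assms by auto
  then have "card ?U \<noteq> 0" by (simp add: card_eq_0_iff)
  then show ?thesis unfolding 1 by simp
qed

end

section \<open>Parity and equivariance of the Hodge operator\<close>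

lemma pull_inverse:
  assumes "\<sigma> permutes {..<m}" "\<tau> permutes {..<n}" "length w = n"
  shows "pull (inv \<sigma>) (inv \<tau>) (pull \<sigma> \<tau> w) = w"
proof (rule nth_equalityI)
  fix i assume "i < length (pull (inv \<sigma>) (inv \<tau>) (pull \<sigma> \<tau> w))"
  then have i: "i < n" using assms by simp
  have "inv (inv \<sigma>) = \<sigma>" "inv (inv \<tau>) = \<tau>" using assms by (auto simp: permutes_inv_inv)
  then show "pull (inv \<sigma>) (inv \<tau>) (pull \<sigma> \<tau> w) ! i = w ! i"
    using i assms by (simp add: pull_def tau_less[OF assms(1,2)] permutes_inverses option.map_comp o_def option.map_ident)
qed (use assms in simp)

lemma pull_bij:
  assumes "\<sigma> permutes {..<m}" "\<tau> permutes {..<n}"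
  shows "bij_betw (pull \<sigma> \<tau>) (words {..<m} n) (words {..<m} n)"
proof -
  have inj: "inj_on (pull \<sigma> \<tau>) (words {..<m} n)"
    by (rule inj_on_inverseI[where g = "pull (inv \<sigma>) (inv \<tau>)"])
      (simp add: words_def pull_inverse[OF assms])
  moreover have "pull \<sigma> \<tau> ` words {..<m} n = words {..<m} n"
    using pull_in_words[OF assms] inj by (intro endo_inj_surj) auto
  ultimately show ?thesis by (simp add: bij_betw_def)
qed

lemma dmat_degree:
  assumes "w \<in> words {..<m} n" "stars w \<noteq> Suc (stars v)"
  shows "dmat m w v = (0::'k::field)"
proof -
  have "dmat m w v = dif {..<m} (\<lambda>_. 0::'k) w"
    unfolding dmat_def by (rule dif_cong[OF assms(1)]) (use assms(2) in auto)
  then show ?thesis by (simp add: dif_def)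
qed

text \<open>Each of the two summands of \<open>hodge\<close> changes the number of stars by one, so
  only words of the opposite parity contribute.\<close>

lemma hodge_cong:
  assumes "\<And>v. v \<in> words {..<m} n \<Longrightarrow> even (stars v) \<noteq> even (stars w) \<Longrightarrow> x v = y v"
  shows "hodge m n x w = (hodge m n y w :: 'k::field)"
proof -
  have *: "(dmat m w v + dmat m v w) * x v = (dmat m w v + dmat m v w) * y v"
    if "w \<in> words {..<m} n" "v \<in> words {..<m} n" for v
  proof (cases "even (stars v) = even (stars w)")
    case True
    then have "stars w \<noteq> Suc (stars v)" "stars v \<noteq> Suc (stars w)" by auto
    then show ?thesis using that by (simp add: dmat_degree[where 'k = 'k])
  qed (use assms that in simp)
  show ?thesis unfolding hodge_def mat_op_def by (intro if_cong refl sum.cong *)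
qed

lemma hodge_add: "hodge m n (\<lambda>u. x u + y u) w = hodge m n x w + hodge m n y w"
  and hodge_diff: "hodge m n (\<lambda>u. x u - y u) w = hodge m n x w - hodge m n y w"
  and hodge_scale: "hodge m n (\<lambda>u. c * x u) w = c * hodge m n x w"
  and hodge_zero: "hodge m n (\<lambda>u. 0) w = 0"
  by (simp_all add: hodge_def mat_op_add mat_op_diff mat_op_scale)

text \<open>The action is orthogonal for the form \<open>ip\<close>, since \<open>pull\<close>
  permutes the words and the signs square to one. The transpose of an equivariant operator is then
  equivariant.\<close>

lemma ad_op_wact:
  assumes sig: "\<sigma> permutes {..<m}" and tau: "\<tau> permutes {..<n}" and w: "w \<in> words {..<m} n"
  shows "ad_op m n (wact \<sigma> \<tau> x) w = (wact \<sigma> \<tau> (ad_op m n x) w :: 'k::field)"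
proof -
  let ?W = "words {..<m} n" and ?g = "wact \<sigma> \<tau> :: (word \<Rightarrow> 'k) \<Rightarrow> word \<Rightarrow> 'k"
  \<comment> \<open>Chosen so that its image under the action is, up to sign, the indicator of w;
    pairing with that image reads off a value at w.\<close>
  define y :: "word \<Rightarrow> 'k" where "y = (\<lambda>u. of_bool (u = pull \<sigma> \<tau> w))"
  define ip :: "(word \<Rightarrow> 'k) \<Rightarrow> (word \<Rightarrow> 'k) \<Rightarrow> 'k" where "ip f h = (\<Sum>u\<in>?W. f u * h u)" for f h
  have gy: "?g y u = (if u = w then ordsign \<tau> (starset w) else 0)" if "u \<in> ?W" for u
    using that w pull_bij[OF sig tau] by (auto simp: wact_def y_def bij_betw_def dest: inj_onD)
  have ip_gy: "ip f (?g y) = ordsign \<tau> (starset w) * f w" for f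
  proof -
    have "ip f (?g y) = (\<Sum>u\<in>?W. if u = w then ordsign \<tau> (starset w) * f w else 0)"
      unfolding ip_def by (intro sum.cong refl) (simp add: gy)
    then show ?thesis using w by simp
  qed
  have ip_g: "ip (?g f) (?g h) = ip f h" for f h
  proof -
    have "ip (?g f) (?g h) = (\<Sum>u\<in>?W. f (pull \<sigma> \<tau> u) * h (pull \<sigma> \<tau> u))"
      unfolding ip_def wact_def
    proof (rule sum.cong[OF refl])
      fix u
      have "ordsign \<tau> (starset u) * f (pull \<sigma> \<tau> u) * (ordsign \<tau> (starset u) * h (pull \<sigma> \<tau> u)) =
        (ordsign \<tau> (starset u) * ordsign \<tau> (starset u)) * (f (pull \<sigma> \<tau> u) * h (pull \<sigma> \<tau> u))"
        by (simp only: mult_ac)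
      then show "ordsign \<tau> (starset u) * f (pull \<sigma> \<tau> u) * (ordsign \<tau> (starset u) * h (pull \<sigma> \<tau> u)) =
        f (pull \<sigma> \<tau> u) * h (pull \<sigma> \<tau> u)" by simp
    qed
    also have "\<dots> = ip f h" unfolding ip_def by (rule sum.reindex_bij_betw[OF pull_bij[OF sig tau]])
    finally show ?thesis .
  qed
  have ad: "ip (ad_op m n f) h = ip f (d_op m n h)" for f h
    unfolding ip_def ad_op_def d_op_def by (rule mat_op_adjoint)
  have dg: "d_op m n (?g h) u = ?g (d_op m n h) u" if "u \<in> ?W" for u h
  proof -
    have "d_op m n (?g h) u = dif {..<m} (?g h) u" using that by (rule d_op_eq)
    also have "\<dots> = ?g (dif {..<m} h) u" using that by (intro dif_wact[OF sig tau]) (simp add: words_def)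
    also have "\<dots> = ?g (d_op m n h) u"
      using pull_in_words[OF sig tau that] by (simp add: wact_def d_op_eq)
    finally show ?thesis .
  qed
  have "ip (ad_op m n (?g x)) (?g y) = ip (?g x) (?g (d_op m n y))"
    unfolding ad by (simp add: ip_def dg)
  also have "\<dots> = ip (?g (ad_op m n x)) (?g y)" by (simp add: ip_g ad)
  finally have 1: "ordsign \<tau> (starset w) * ad_op m n (?g x) w = ordsign \<tau> (starset w) * ?g (ad_op m n x) w"
    unfolding ip_gy .
  have "ordsign \<tau> (starset w) \<noteq> (0::'k)" by (simp add: ordsign_def)
  then show ?thesis using 1 by simp
qed

lemma hodge_wact:
  assumes sig: "\<sigma> permutes {..<m}" and tau: "\<tau> permutes {..<n}" and w: "w \<in> words {..<m} n"
  shows "hodge m n (wact \<sigma> \<tau> x) w = (wact \<sigma> \<tau> (hodge m n x) w :: 'k::field)"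
proof -
  have "d_op m n (wact \<sigma> \<tau> x) w = wact \<sigma> \<tau> (dif {..<m} x) w"
    using w by (subst d_op_eq) (auto simp: words_def intro!: dif_wact[OF sig tau])
  also have "\<dots> = wact \<sigma> \<tau> (d_op m n x) w"
    using pull_in_words[OF sig tau w] by (simp add: wact_def d_op_eq)
  finally show ?thesis
    using ad_op_wact[OF assms, of x] by (simp add: hodge_eq wact_def distrib_left)
qed

text \<open>Dual to \<open>wact_top_sgn\<close>: re-index the sum along \<open>pull\<close> and move
  the action to the coefficients.\<close>

lemma top_sum_wact:
  assumes sig: "\<sigma> permutes {..<m}" and tau: "\<tau> permutes {..<n}"
  shows "top_sum {..<m} n (wact \<sigma> \<tau> x) = of_int (sign \<sigma> * sign \<tau>) * (top_sum {..<m} n x :: 'k::field)"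
proof -
  let ?W = "words {..<m} n" and ?s = "of_int (sign \<sigma> * sign \<tau>) :: 'k"
  have "(sign \<sigma> * sign \<tau>) * (sign \<sigma> * sign \<tau>) = 1"
    by (simp add: sign_def)
  then have ss: "?s * ?s = 1"
    unfolding of_int_mult[symmetric] by (simp only: of_int_1)
  have "top_sum {..<m} n (wact \<sigma> \<tau> x) = (\<Sum>w\<in>?W. top_sgn {..<m} w * wact \<sigma> \<tau> x w)"
    by (simp add: top_sum_eq_sum)
  also have "\<dots> = (\<Sum>w\<in>?W. ?s * (top_sgn {..<m} (pull \<sigma> \<tau> w) * x (pull \<sigma> \<tau> w)))"
  proof (rule sum.cong[OF refl])
    fix w assume w: "w \<in> ?W"
    have "ordsign \<tau> (starset w) * top_sgn {..<m} (pull \<sigma> \<tau> w) = ?s * top_sgn {..<m} w"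
      using wact_top_sgn[OF sig tau w] by (simp add: wact_def)
    then have "?s * (ordsign \<tau> (starset w) * top_sgn {..<m} (pull \<sigma> \<tau> w)) = top_sgn {..<m} w"
      by (simp only: mult.assoc[symmetric] ss mult_1)
    then have 1: "top_sgn {..<m} w = ?s * (ordsign \<tau> (starset w) * top_sgn {..<m} (pull \<sigma> \<tau> w))" ..
    have "top_sgn {..<m} w * wact \<sigma> \<tau> x w = ?s * (ordsign \<tau> (starset w) * ordsign \<tau> (starset w)) *
        (top_sgn {..<m} (pull \<sigma> \<tau> w) * x (pull \<sigma> \<tau> w))"
      unfolding wact_def 1 by (simp only: mult_ac)
    then show "top_sgn {..<m} w * wact \<sigma> \<tau> x w = ?s * (top_sgn {..<m} (pull \<sigma> \<tau> w) * x (pull \<sigma> \<tau> w))"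
      unfolding ordsign_sq by (simp only: mult_1_right)
  qed
  also have "\<dots> = ?s * (\<Sum>w\<in>?W. top_sgn {..<m} (pull \<sigma> \<tau> w) * x (pull \<sigma> \<tau> w))"
    by (rule sum_distrib_left[symmetric])
  also have "(\<Sum>w\<in>?W. top_sgn {..<m} (pull \<sigma> \<tau> w) * x (pull \<sigma> \<tau> w)) = top_sum {..<m} n x"
    by (subst sum.reindex_bij_betw[OF pull_bij[OF sig tau], of "\<lambda>w. top_sgn {..<m} w * x w"])
      (simp add: top_sum_eq_sum)
  finally show ?thesis .
qed

lemma top_sgn_parity:
  assumes "w \<in> words {..<m} n" "top_sgn {..<m} w \<noteq> (0::'k::field)"
  shows "stars w = n - m" "m \<le> n"
  using assms by (auto simp: top_sgn_eq words_def split: if_splits)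

lemma top_sum_eq_0:
  assumes "\<And>w. w \<in> words {..<m} n \<Longrightarrow> stars w = n - m \<Longrightarrow> x w = 0"
  shows "top_sum {..<m} n x = (0::'k::field)"
proof -
  have "top_sum {..<m} n x = top_sum {..<m} n (\<lambda>_. 0)"
    using assms by (intro top_sum_cong) auto
  then show ?thesis by simp
qed

text \<open>The maps of the word complex split off the homology: in degree \<open>0\<close> the cocycles \<open>k\<close>,
  in degree \<open>n - m\<close> (present only if \<open>m < n\<close>) the line of \<open>top_sgn\<close>.\<close>

lemma words_injective:
  fixes k a :: "word \<Rightarrow> 'k::field_char_0"
  assumes k: "\<And>w. w \<in> words {..<m} n \<Longrightarrow> stars w \<noteq> 0 \<Longrightarrow> k w = 0"
    and dk: "\<And>w. w \<in> words {..<m} n \<Longrightarrow> dif {..<m} k w = 0"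
    and a: "\<And>w. w \<in> words {..<m} n \<Longrightarrow> even (stars w) \<Longrightarrow> a w = 0"
    and b: "\<not> (m < n \<and> odd (n - m - 1)) \<Longrightarrow> b = 0"
    and E: "m < n \<and> even (n - m - 1) \<Longrightarrow> top_sum {..<m} n a = 0"
    and eq: "\<And>w. w \<in> words {..<m} n \<Longrightarrow> even (stars w) \<Longrightarrow> k w + hodge m n a w + b * top_sgn {..<m} w = 0"
  shows "b = 0 \<and> (\<forall>w\<in>words {..<m} n. a w = 0 \<and> k w = 0)"
proof -
  let ?W = "words {..<m} n" and ?e = "top_sgn {..<m} :: word \<Rightarrow> 'k"
  \<comment> \<open>The equation is given on even words only. On odd words every term vanishes:
    \<open>hodge\<close> reverses parity, k lives in degree 0, and b is zero unless n - m is
    even.\<close>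
  have eq0: "hodge m n a w = - k w - b * ?e w" if w: "w \<in> ?W" for w
  proof (cases "even (stars w)")
    case False
    have "hodge m n a w = hodge m n (\<lambda>_. 0) w" by (rule hodge_cong) (use False a in auto)
    moreover have "b * ?e w = 0"
    proof (rule ccontr)
      assume "b * ?e w \<noteq> 0"
      then have "stars w = n - m" "m < n \<and> odd (n - m - 1)"
        using b top_sgn_parity[OF w, where 'k = 'k] by auto
      then show False using False by (auto dest: odd_pos)
    qed
    moreover have "k w = 0" using k[OF w] False by (metis even_zero)
    ultimately show ?thesis by (simp add: hodge_zero)
  qed (use eq[OF w] in \<open>simp add: algebra_simps eq_neg_iff_add_eq_0\<close>)
  have Tk: "hodge m n k w = 0" for w
  proof (cases "w \<in> ?W")
    case True
    have "ad_op m n k w = (\<Sum>v\<in>?W. dmat m v w * k v)" using True by (simp add: ad_op_def mat_op_def)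
    also have "\<dots> = 0"
    proof (rule sum.neutral, rule ballI)
      fix v assume v: "v \<in> ?W"
      then show "dmat m v w * k v = 0" using k[OF v] dmat_degree[OF v, of w, where 'k = 'k] by (cases "stars v = 0") auto
    qed
    finally show ?thesis using True dk by (simp add: hodge_eq d_op_eq)
  qed (simp add: hodge_def mat_op_def)
  \<comment> \<open>Both k and \<open>top_sgn\<close> are harmonic, so a second application of
    \<open>hodge\<close> kills the right side.\<close>
  have "hodge m n (hodge m n a) w = hodge m n (\<lambda>w. - 1 * k w - b * ?e w) w" for w
    unfolding hodge_def mat_op_def using eq0 by (auto simp: hodge_def mat_op_def intro!: sum.cong)
  then have "hodge m n (hodge m n a) w = 0" for w
    by (simp only: hodge_diff hodge_scale Tk hodge_top_sgn) simp
  then have Ta: "hodge m n a w = 0" for w by (rule hodge_hodge_kernel)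
  \<comment> \<open>If n - m is odd, \<open>top_sum\<close> of a vanishes by hypothesis; if it is
    even, a has no entries on top words.\<close>
  have a0: "a w = 0" if "w \<in> ?W" for w
  proof (rule hodge_kernel_zero[OF Ta _ _ that])
    assume "m < n"
    then show "top_sum {..<m} n a = 0"
      using E a by (cases "even (n - m - 1)") (auto intro!: top_sum_eq_0)
  qed (use a in simp)
  have ke: "k w + b * ?e w = 0" if "w \<in> ?W" for w
    using eq0[OF that] Ta[of w] by (simp add: algebra_simps)
  \<comment> \<open>If m < n, the degrees 0 and n - m are different, so k and the multiple of
    \<open>top_sgn\<close> have disjoint supports; otherwise b = 0.\<close>
  have k0: "k w = 0" if w: "w \<in> ?W" for w
  proof (cases "stars w = 0 \<and> m < n")
    case True
    then have "?e w = 0" using top_sgn_parity[OF w, where 'k = 'k] by auto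
    then show ?thesis using ke[OF w] by simp
  next
    case False
    then show ?thesis using k[OF w] b ke[OF w] by auto
  qed
  have "b = 0"
  proof (rule ccontr)
    assume "b \<noteq> 0"
    then have "m \<le> n" using b by fastforce
    moreover have "?e w = 0" if "w \<in> ?W" for w using ke[OF that] k0[OF that] \<open>b \<noteq> 0\<close> by simp
    ultimately show False using top_sum_top_sgn[of m n, where 'k = 'k] by (simp add: top_sum_eq_sum)
  qed
  then show ?thesis using a0 k0 by blast
qed

text \<open>Write y as a harmonic vector plus a value of \<open>hodge\<close>. By
  \<open>hodge_kernel_zero\<close>, the even harmonic part is a cocycle of degree 0 plus a multiple
  of \<open>top_sgn\<close>. The prescribed value c is reached by adding a multiple of
  \<open>top_sgn\<close> to the odd vector, which \<open>hodge\<close> does not see.\<close>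

lemma words_surjective:
  fixes y :: "word \<Rightarrow> 'k::field_char_0"
  assumes c: "\<not> (m < n \<and> even (n - m - 1)) \<Longrightarrow> c = 0"
  shows "\<exists>k a b. (\<forall>w. w \<in> words {..<m} n \<and> stars w = 0 \<or> k w = 0) \<and> (\<forall>w\<in>words {..<m} n. dif {..<m} k w = 0) \<and>
     (\<forall>w. w \<in> words {..<m} n \<and> odd (stars w) \<or> a w = 0) \<and> (\<not> (m < n \<and> odd (n - m - 1)) \<longrightarrow> b = 0) \<and>
     (m < n \<and> even (n - m - 1) \<longrightarrow> top_sum {..<m} n a = c) \<and>
     (\<forall>w\<in>words {..<m} n. even (stars w) \<longrightarrow> y w = k w + hodge m n a w + b * top_sgn {..<m} w)"
proof -
  let ?W = "words {..<m} n" and ?e = "top_sgn {..<m} :: word \<Rightarrow> 'k"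
  define y' where "y' w = (if w \<in> ?W then y w else 0)" for w
  have "\<exists>h z. (\<forall>w. hodge m n h w = 0) \<and> (\<forall>w. y' w = h w + hodge m n z w) \<and> (\<forall>w. w \<notin> ?W \<longrightarrow> h w = 0)"
    unfolding hodge_def
    by (rule mat_op_decomposition)
      (use hodge_hodge_kernel[where 'k = 'k] in \<open>auto simp: y'_def hodge_def\<close>)
  then obtain h z where h: "\<And>w. hodge m n h w = 0" and hz: "\<And>w. y' w = h w + hodge m n z w" by blast
  define he where "he w = (if even (stars w) then h w else 0)" for w
  define k where "k w = (if w \<in> ?W \<and> stars w = 0 then h w else 0)" for w
  define zo where "zo w = (if w \<in> ?W \<and> odd (stars w) then z w else 0)" for w
  \<comment> \<open>\<open>hodge\<close> reverses parity, so the even part of a harmonic vector is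
    harmonic.\<close>
  have The: "hodge m n he w = 0" for w
  proof (cases "even (stars w)")
    case True
    have "hodge m n he w = hodge m n (\<lambda>_. 0) w" by (rule hodge_cong) (use True in \<open>auto simp: he_def\<close>)
    then show ?thesis by (simp add: hodge_zero)
  next
    case False
    have "hodge m n he w = hodge m n h w" by (rule hodge_cong) (use False in \<open>auto simp: he_def\<close>)
    then show ?thesis by (simp add: h)
  qed
  have dk: "dif {..<m} k w = 0" if w: "w \<in> ?W" for w
  proof (cases "stars w = 1")
    case True
    have "dif {..<m} k w = dif {..<m} he w" by (rule dif_cong[OF w]) (use True in \<open>auto simp: k_def he_def\<close>)
    also have "\<dots> = 0" using hodge_kernel(2)[OF The, of w] w by (simp add: d_op_eq)
    finally show ?thesis .
  next
    case False
    have "dif {..<m} k w = dif {..<m} (\<lambda>_. 0) w" by (rule dif_cong[OF w]) (use False in \<open>auto simp: k_def\<close>)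
    then show ?thesis by (simp add: dif_def)
  qed
  have Tk: "hodge m n k w = 0" for w
  proof (cases "w \<in> ?W")
    case True
    have "ad_op m n k w = (\<Sum>v\<in>?W. dmat m v w * k v)" using True by (simp add: ad_op_def mat_op_def)
    also have "\<dots> = 0"
    proof (rule sum.neutral, rule ballI)
      fix v assume v: "v \<in> ?W"
      then show "dmat m v w * k v = 0" using dmat_degree[OF v, of w, where 'k = 'k] by (cases "stars v = 0") (auto simp: k_def)
    qed
    finally show ?thesis using True dk by (simp add: hodge_eq d_op_eq)
  qed (simp add: hodge_def mat_op_def)
  define E where "E = top_sum {..<m} n ?e"
  have E0: "E \<noteq> 0" if "m < n" using that top_sum_top_sgn[of m n, where 'k = 'k] by (simp add: E_def)
  \<comment> \<open>The coefficient for which \<open>top_sum\<close> of the remainder r vanishes. If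
    n - m is odd, r has no top entries and needs no correction.\<close>
  define b where "b = (if m < n \<and> odd (n - m - 1) then top_sum {..<m} n (\<lambda>w. he w - k w) / E else 0)"
  define r where "r w = he w - k w - b * ?e w" for w
  have r0: "r w = 0" if w: "w \<in> ?W" for w
  proof (rule hodge_kernel_zero[OF _ _ _ w])
    show "hodge m n r w = 0" for w
      unfolding r_def[abs_def] hodge_diff hodge_scale The Tk hodge_top_sgn by simp
    show "r w = 0" if "w \<in> ?W" "stars w = 0" for w
    proof -
      have "b * ?e w = 0"
        using that top_sgn_parity[OF that(1), where 'k = 'k] by (auto simp: b_def)
      then show ?thesis using that by (simp add: r_def he_def k_def)
    qed
    assume "m < n"
    show "top_sum {..<m} n r = 0"
    proof (cases "odd (n - m - 1)")
      case True
      have "top_sum {..<m} n r = top_sum {..<m} n (\<lambda>w. he w - k w) - b * E"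
        unfolding r_def[abs_def] top_sum_diff top_sum_scale E_def ..
      then show ?thesis using True \<open>m < n\<close> E0 by (simp add: b_def)
    next
      case False
      then have "odd (n - m)" using \<open>m < n\<close> by auto
      then show ?thesis using False by (intro top_sum_eq_0) (auto simp: r_def he_def k_def b_def)
    qed
  qed
  define s where "s = (if m < n \<and> even (n - m - 1) then (c - top_sum {..<m} n zo) / E else 0)"
  define a where "a w = (if w \<in> ?W then zo w + s * ?e w else 0)" for w
  have "odd (stars w)" if "w \<in> ?W" "s * ?e w \<noteq> 0" for w
    using that top_sgn_parity[OF that(1), where 'k = 'k] by (auto simp: s_def split: if_splits)
  then have a: "w \<in> ?W \<and> odd (stars w) \<or> a w = 0" for w
    by (auto simp: a_def zo_def)
  have Ta: "hodge m n a w = hodge m n z w" if "even (stars w)" for w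
  proof -
    have "hodge m n a w = hodge m n (\<lambda>w. zo w + s * ?e w) w" by (rule hodge_cong) (simp add: a_def)
    also have "\<dots> = hodge m n zo w" by (simp add: hodge_add hodge_scale hodge_top_sgn)
    also have "\<dots> = hodge m n z w" by (rule hodge_cong) (use that in \<open>auto simp: zo_def\<close>)
    finally show ?thesis .
  qed
  have "top_sum {..<m} n a = c" if "m < n \<and> even (n - m - 1)"
  proof -
    have "top_sum {..<m} n a = top_sum {..<m} n (\<lambda>w. zo w + s * ?e w)"
      by (rule top_sum_cong) (auto simp: a_def)
    also have "\<dots> = top_sum {..<m} n zo + s * E" by (simp add: top_sum_add top_sum_scale E_def)
    also have "s = (c - top_sum {..<m} n zo) / E" using that by (simp only: s_def if_True simp_thms)
    also have "top_sum {..<m} n zo + (c - top_sum {..<m} n zo) / E * E = c" using that E0 by simp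
    finally show ?thesis .
  qed
  moreover have "y w = k w + hodge m n a w + b * ?e w" if "w \<in> ?W" "even (stars w)" for w
    using hz[of w] r0[OF that(1)] Ta[OF that(2)] that by (simp add: y'_def r_def he_def diff_eq_eq)
  moreover have "\<forall>w. w \<in> ?W \<and> stars w = 0 \<or> k w = 0" by (simp add: k_def)
  moreover have "\<not> (m < n \<and> odd (n - m - 1)) \<longrightarrow> b = 0" by (simp add: b_def)
  ultimately show ?thesis using dk a by blast
qed

subsection \<open>The functors \<open>Pbt\<close>\<close>

definition tup :: "nat \<Rightarrow> nat \<Rightarrow> nat list set" where
  "tup m N = {l. length l = m \<and> set l \<subseteq> {..<N}}"

lemma finite_tup [simp]: "finite (tup m N)"
  using finite_lists_length_eq[of "{..<N}" m] by (simp add: tup_def conj_commute)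

lemma tup_length: "l \<in> tup m N \<Longrightarrow> length l = m"
  and tup_nth: "l \<in> tup m N \<Longrightarrow> i < m \<Longrightarrow> l ! i < N"
  by (auto simp: tup_def dest: nth_mem)

lemma tup_update: "l \<in> tup m N \<Longrightarrow> x < N \<Longrightarrow> l[i := x] \<in> tup m N"
  using set_update_subset_insert[of l i x] by (auto simp: tup_def)

lemma tup_0 [simp]: "tup 0 N = {[]}"
  by (auto simp: tup_def)

lemma sum_tup_Suc: "(\<Sum>l\<in>tup (Suc m) N. F l) = (\<Sum>x<N. \<Sum>u\<in>tup m N. F (x # u))"
proof -
  have "tup (Suc m) N = (\<lambda>(x, u). x # u) ` ({..<N} \<times> tup m N)"
    by (auto simp: tup_def length_Suc_conv image_iff)
  moreover have "inj_on (\<lambda>(x, u). x # u) ({..<N} \<times> tup m N)" by (auto simp: inj_on_def)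
  ultimately show ?thesis by (simp add: sum.reindex sum.cartesian_product case_prod_unfold)
qed

lemma sum_prod_tup: "(\<Sum>l\<in>tup m N. \<Prod>i<m. g i (l ! i)) = (\<Prod>i<m. \<Sum>x<N. g i x :: 'k::field)"
proof (induction m arbitrary: g)
  case (Suc m)
  have "(\<Sum>l\<in>tup (Suc m) N. \<Prod>i<Suc m. g i (l ! i)) =
      (\<Sum>x<N. \<Sum>u\<in>tup m N. g 0 x * (\<Prod>i<m. g (Suc i) (u ! i)))"
    unfolding sum_tup_Suc prod.lessThan_Suc_shift by simp
  also have "\<dots> = (\<Sum>x<N. g 0 x) * (\<Sum>u\<in>tup m N. \<Prod>i<m. g (Suc i) (u ! i))"
    by (rule sum_product[symmetric])
  also have "\<dots> = (\<Prod>i<Suc m. \<Sum>x<N. g i x)"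
    unfolding Suc.IH[of "\<lambda>i. g (Suc i)"] prod.lessThan_Suc_shift ..
  finally show ?case .
qed simp

text \<open>Along each line in direction i, A is constant and c sums to zero. Instead of choosing
  representatives of the lines, N times the sum is re-indexed by the involution that exchanges the
  entry at i with a free x; cancelling N uses characteristic zero.\<close>

lemma sum_update_invariant:
  fixes c A :: "nat list \<Rightarrow> 'k::field_char_0"
  assumes "finite S" and i: "\<And>l. l \<in> S \<Longrightarrow> i < length l \<and> l ! i < N"
    and closed: "\<And>l x. l \<in> S \<Longrightarrow> x < N \<Longrightarrow> l[i := x] \<in> S"
    and A: "\<And>l x. l \<in> S \<Longrightarrow> x < N \<Longrightarrow> A (l[i := x]) = A l"
    and c: "\<And>l. l \<in> S \<Longrightarrow> (\<Sum>x<N. c (l[i := x])) = 0"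
  shows "(\<Sum>l\<in>S. c l * A l) = 0"
proof (cases "N = 0")
  case True
  then have "S = {}" using i by fastforce
  then show ?thesis by simp
next
  case False
  let ?f = "\<lambda>(l, x). (l[i := x], l ! i)"
  have bij: "bij_betw ?f (S \<times> {..<N}) (S \<times> {..<N})"
    by (rule bij_betwI[where g = ?f]) (use i closed in \<open>auto simp: list_update_swap\<close>)
  have "of_nat N * (\<Sum>l\<in>S. c l * A l) = (\<Sum>(l, x)\<in>S \<times> {..<N}. c l * A l)"
    by (simp add: sum.cartesian_product[symmetric] sum_distrib_left)
  also have "\<dots> = (\<Sum>(l, x)\<in>S \<times> {..<N}. c (l[i := x]) * A (l[i := x]))"
    by (subst sum.reindex_bij_betw[OF bij, symmetric]) (simp add: case_prod_unfold)
  also have "\<dots> = (\<Sum>l\<in>S. \<Sum>x<N. c (l[i := x]) * A (l[i := x]))"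
    by (rule sum.cartesian_product[symmetric])
  also have "\<dots> = (\<Sum>l\<in>S. (\<Sum>x<N. c (l[i := x])) * A l)"
    by (intro sum.cong refl) (simp add: A sum_distrib_right)
  also have "\<dots> = 0" by (simp add: c)
  finally show ?thesis using False by simp
qed

definition ten :: "nat \<Rightarrow> nat \<Rightarrow> (nat \<Rightarrow> nat \<Rightarrow> 'k::field) \<Rightarrow> nat list \<Rightarrow> 'k" where
  "ten m N v l = (if l \<in> tup m N then \<Prod>i<m. v i (l ! i) else 0)"

lemma ten_cong:
  assumes "\<And>i x. i < m \<Longrightarrow> x < N \<Longrightarrow> v i x = v' i x"
  shows "ten m N v = ten m N v'"
  by (rule ext) (auto simp: ten_def tup_nth intro!: prod.cong assms)

lemma ten_scale:
  assumes "j < m" and "\<And>x. x < N \<Longrightarrow> v j x = c * v' j x" and "\<And>i x. i < m \<Longrightarrow> i \<noteq> j \<Longrightarrow> x < N \<Longrightarrow> v i x = v' i x"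
  shows "ten m N v l = c * ten m N v' l"
proof (cases "l \<in> tup m N")
  case True
  have "(\<Prod>i<m. v i (l ! i)) = v j (l ! j) * (\<Prod>i\<in>{..<m} - {j}. v i (l ! i))"
    using assms(1) by (simp add: prod.remove)
  also have "\<dots> = c * (v' j (l ! j) * (\<Prod>i\<in>{..<m} - {j}. v' i (l ! i)))"
    using assms True by (simp add: tup_nth)
  also have "v' j (l ! j) * (\<Prod>i\<in>{..<m} - {j}. v' i (l ! i)) = (\<Prod>i<m. v' i (l ! i))"
    using assms(1) by (simp add: prod.remove)
  finally show ?thesis using True by (simp add: ten_def)
qed (simp add: ten_def)

lemma ten_diff:
  assumes "j < m" and "\<And>x. x < N \<Longrightarrow> v j x = v1 j x - v2 j x"
    and "\<And>i x. i < m \<Longrightarrow> i \<noteq> j \<Longrightarrow> x < N \<Longrightarrow> v i x = v1 i x" and "\<And>i x. i < m \<Longrightarrow> i \<noteq> j \<Longrightarrow> x < N \<Longrightarrow> v i x = v2 i x"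
  shows "ten m N v l = ten m N v1 l - ten m N v2 l"
proof (cases "l \<in> tup m N")
  case True
  have *: "(\<Prod>i<m. w i (l ! i)) = w j (l ! j) * (\<Prod>i\<in>{..<m} - {j}. w i (l ! i))" for w :: "nat \<Rightarrow> nat \<Rightarrow> 'a"
    using assms(1) by (simp add: prod.remove)
  have "(\<Prod>i\<in>{..<m} - {j}. v1 i (l ! i)) = (\<Prod>i\<in>{..<m} - {j}. v i (l ! i))"
    using assms(3) True by (intro prod.cong) (auto simp: tup_nth)
  moreover have "(\<Prod>i\<in>{..<m} - {j}. v2 i (l ! i)) = (\<Prod>i\<in>{..<m} - {j}. v i (l ! i))"
    using assms(4) True by (intro prod.cong) (auto simp: tup_nth)
  ultimately show ?thesis
    using True assms(1,2) by (simp add: ten_def * tup_nth left_diff_distrib)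
qed (simp add: ten_def)

lemma ten_aug:
  assumes "l \<in> tup m N" "i < m" "(\<Sum>x<N. v i x) = 0"
  shows "(\<Sum>x<N. ten m N v (l[i := x])) = 0"
proof -
  have "ten m N v (l[i := x]) = v i x * (\<Prod>j\<in>{..<m} - {i}. v j (l ! j))" if "x < N" for x
  proof -
    have "ten m N v (l[i := x]) = (\<Prod>j<m. v j (l[i := x] ! j))"
      using tup_update[OF assms(1) that] by (simp add: ten_def)
    also have "\<dots> = v i x * (\<Prod>j\<in>{..<m} - {i}. v j (l[i := x] ! j))"
      using assms(1,2) by (simp add: prod.remove[of _ i] tup_length)
    also have "(\<Prod>j\<in>{..<m} - {i}. v j (l[i := x] ! j)) = (\<Prod>j\<in>{..<m} - {i}. v j (l ! j))"
      by (intro prod.cong) auto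
    finally show ?thesis .
  qed
  then have "(\<Sum>x<N. ten m N v (l[i := x])) = (\<Sum>x<N. v i x) * (\<Prod>j\<in>{..<m} - {i}. v j (l ! j))"
    by (simp add: sum_distrib_right)
  then show ?thesis using assms(3) by simp
qed

lemma sum_fun_apply: "(\<Sum>i\<in>I. f i) x = (\<Sum>i\<in>I. f i x :: 'k::comm_monoid_add)"
  by (induction I rule: infinite_finite_induct) auto

lemma vector_space_sc: "vector_space (sc :: 'k::field \<Rightarrow> ('a \<Rightarrow> 'k) \<Rightarrow> 'a \<Rightarrow> 'k)"
  by unfold_locales (auto simp: sc_def algebra_simps)

text \<open>A family may repeat vectors, whereas \<open>fspan\<close> sums over a set; the detour
  over the span of the library takes care of this.\<close>

lemma fspan_combination:
  assumes "\<And>i. i \<in> I \<Longrightarrow> g i \<in> S"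
  shows "(\<Sum>i\<in>I. sc (c i) (g i)) \<in> (fspan S :: ('a \<Rightarrow> 'k::field) set)"
proof -
  interpret vector_space "sc :: 'k \<Rightarrow> ('a \<Rightarrow> 'k) \<Rightarrow> 'a \<Rightarrow> 'k" by (rule vector_space_sc)
  have "fspan S = span S"
    unfolding fspan_def span_explicit by blast
  then show ?thesis by (simp only:) (intro span_sum span_scale span_base assms)
qed

text \<open>\<open>Pbt\<close> by equations instead of generators (\<open>Pbt_eq\<close>): the
  augmentation of every tensor factor vanishes. The last clause speaks for m = 0, where
  \<open>[]\<close> is a tuple even over the empty set and kbar has to be zero there.\<close>

definition balanced :: "nat \<Rightarrow> nat \<Rightarrow> (nat list \<Rightarrow> 'k::field) \<Rightarrow> bool" where
  "balanced m N t \<longleftrightarrow> (\<forall>l. l \<notin> tup m N \<longrightarrow> t l = 0) \<and> (\<forall>l\<in>tup m N. \<forall>i<m. (\<Sum>x<N. t (l[i := x])) = 0) \<and>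
     (N = 0 \<longrightarrow> t = (\<lambda>_. 0))"

abbreviation basic :: "nat list \<Rightarrow> nat \<Rightarrow> nat \<Rightarrow> 'k::field" where
  "basic l i x \<equiv> of_bool (x = l ! i) - of_bool (x = 0)"

text \<open>In one factor, coefficients of sum zero may be attached to [x] - [0] instead of [x], as
  the terms with [0] cancel. This is done factor by factor.\<close>

lemma balanced_expand:
  fixes t :: "nat list \<Rightarrow> 'k::field"
  assumes "N > 0" and t: "\<And>l i. l \<in> tup m N \<Longrightarrow> i < m \<Longrightarrow> (\<Sum>x<N. t (l[i := x])) = 0"
    and l: "l \<in> tup m N"
  shows "t l = (\<Sum>l'\<in>tup m N. t l' * (\<Prod>i<m. basic l' i (l ! i)))"
  using t l
proof (induction m arbitrary: t l)
  case (Suc m)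
  obtain y u where yu: "l = y # u" "y < N" "u \<in> tup m N"
    using Suc.prems(2) by (cases l) (auto simp: tup_def)
  let ?P = "\<lambda>l'. \<Prod>i<m. basic l' i (u ! i) :: 'k"
  have IH: "t (x # u) = (\<Sum>u'\<in>tup m N. t (x # u') * ?P u')" if "x < N" for x
  proof (rule Suc.IH[OF _ yu(3)])
    fix u' i assume "u' \<in> tup m N" "i < m"
    then show "(\<Sum>z<N. t (x # u'[i := z])) = 0"
      using Suc.prems(1)[of "x # u'" "Suc i"] that by (auto simp: tup_def)
  qed
  have "(\<Sum>l'\<in>tup (Suc m) N. t l' * (\<Prod>i<Suc m. basic l' i (l ! i))) =
      (\<Sum>x<N. \<Sum>u'\<in>tup m N. t (x # u') * ((of_bool (y = x) - of_bool (y = 0)) * ?P u'))"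
    unfolding sum_tup_Suc prod.lessThan_Suc_shift yu by simp
  also have "\<dots> = (\<Sum>x<N. (of_bool (y = x) - of_bool (y = 0)) * t (x # u))"
    by (intro sum.cong refl) (simp add: IH sum_distrib_left mult_ac)
  also have "\<dots> = (\<Sum>x<N. of_bool (y = x) * t (x # u)) - of_bool (y = 0) * (\<Sum>x<N. t (x # u))"
    by (simp only: left_diff_distrib sum_subtractf sum_distrib_left)
  also have "(\<Sum>x<N. t (x # u)) = 0"
    using Suc.prems(1)[of l 0] Suc.prems(2) by (simp add: yu)
  also have "(\<Sum>x<N. of_bool (y = x) * t (x # u)) = t l"
    using yu by (simp add: of_bool_def if_distrib if_distribR cong: if_cong)
  finally show ?case by simp
qed auto

lemma Pbt_eq: "t \<in> Pbt m N \<longleftrightarrow> balanced m N (t :: nat list \<Rightarrow> 'k::field)"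
proof (cases "m = 0")
  case True
  have "t \<in> {(\<lambda>l. if l = [] then c else 0) | c. True} \<longleftrightarrow> (\<forall>l. l \<noteq> [] \<longrightarrow> t l = 0)"
  proof
    assume "\<forall>l. l \<noteq> [] \<longrightarrow> t l = 0"
    then have "t = (\<lambda>l. if l = [] then t [] else 0)" by (simp add: fun_eq_iff)
    then show "t \<in> {(\<lambda>l. if l = [] then c else 0) | c. True}" by blast
  qed auto
  then show ?thesis using True by (cases "N = 0") (auto simp: Pbt_def balanced_def zero_fun_def)
next
  case False
  let ?S = "{ten m N v | v. \<forall>i<m. v i \<in> Pbar N} :: (nat list \<Rightarrow> 'k) set"
  have "{(\<lambda>l. if length l = m \<and> set l \<subseteq> {..<N} then (\<Prod>i<m. v i (l ! i)) else 0) | v. \<forall>i<m. v i \<in> Pbar N} = ?S"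
    by (simp add: ten_def[abs_def] tup_def)
  then have P: "Pbt m N = fspan ?S" using False by (simp add: Pbt_def)
  show ?thesis
  proof
    assume "t \<in> Pbt m N"
    then obtain F c where F: "finite F" "F \<subseteq> ?S" "t = (\<Sum>f\<in>F. sc (c f) f)" unfolding P fspan_def by blast
    have t: "t l = (\<Sum>f\<in>F. c f * f l)" for l by (simp add: F sum_fun_apply sc_def)
    have "f l = 0" if "f \<in> F" "l \<notin> tup m N" for f l using F(2) that by (auto simp: ten_def)
    moreover have "(\<Sum>x<N. f (l[i := x])) = 0" if fl: "f \<in> F" "l \<in> tup m N" "i < m" for f l i
    proof -
      obtain v where "f = ten m N v" "\<forall>i<m. v i \<in> Pbar N" using F(2) fl(1) by blast
      then show ?thesis using ten_aug[OF fl(2,3), of v] fl(3) by (simp add: Pbar_def)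
    qed
    moreover have "(\<Sum>x<N. t (l[i := x])) = (\<Sum>f\<in>F. c f * (\<Sum>x<N. f (l[i := x])))" for l i
      unfolding t sum_distrib_left by (rule sum.swap)
    moreover have "tup m 0 = {}" using False by (auto simp: tup_def)
    ultimately show "balanced m N t" by (auto simp: balanced_def t fun_eq_iff intro!: sum.neutral)
  next
    assume t: "balanced m N t"
    show "t \<in> Pbt m N"
    proof (cases "N = 0")
      case True
      then have "t = (\<Sum>f\<in>{}. sc (0 f) f)" using t by (simp add: balanced_def fun_eq_iff)
      then show ?thesis unfolding P fspan_def by blast
    next
      case N: False
      \<comment> \<open>\<open>Pbar N\<close> demands the value 0 from N on, whereas
        \<open>ten\<close> reads only entries below N; the cut-off meets the first without changing
        the tensor.\<close>
      let ?e = "\<lambda>l. ten m N (\<lambda>i x. if x < N then basic l i x else 0) :: nat list \<Rightarrow> 'k"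
      have e: "?e l \<in> ?S" if "l \<in> tup m N" for l
      proof -
        have "(\<Sum>x<N. basic l i x :: 'k) = 0" if "i < m" for i
          using tup_nth[OF \<open>l \<in> tup m N\<close> that] N by (simp add: sum_subtractf of_bool_def)
        then show ?thesis by (auto simp: Pbar_def intro!: exI[of _ "\<lambda>i x. if x < N then basic l i x else 0"])
      qed
      have expand: "t = (\<Sum>l\<in>tup m N. sc (t l) (?e l))"
      proof
        fix l
        show "t l = (\<Sum>l\<in>tup m N. sc (t l) (?e l)) l"
        proof (cases "l \<in> tup m N")
          case True
          have "t l = (\<Sum>l'\<in>tup m N. t l' * (\<Prod>i<m. basic l' i (l ! i)))"
            using t N True by (intro balanced_expand) (auto simp: balanced_def)
          then show ?thesis using True by (simp add: sum_fun_apply sc_def ten_def tup_nth)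
        qed (use t in \<open>simp add: sum_fun_apply sc_def ten_def balanced_def\<close>)
      qed
      show ?thesis unfolding P by (subst expand) (rule fspan_combination[OF e])
    qed
  qed
qed

lemma Pmap_eq: "Pmap m N f t l = (\<Sum>l'\<in>tup m N. t l' * of_bool (map f l' = l))"
proof -
  have "Pmap m N f t l = (\<Sum>l'\<in>{l'\<in>tup m N. map f l' = l}. t l')"
    by (simp add: Pmap_def lin_ext_def tup_def)
  also have "\<dots> = (\<Sum>l'\<in>tup m N. t l' * of_bool (map f l' = l))"
    by (simp add: sum.inter_filter of_bool_def if_distrib cong: if_cong)
  finally show ?thesis .
qed

lemma map_tup: "f ` {..<N} \<subseteq> {..<M} \<Longrightarrow> l \<in> tup m N \<Longrightarrow> map f l \<in> tup m M"
  by (auto simp: tup_def)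

lemma Pmap_outside: "f ` {..<N} \<subseteq> {..<M} \<Longrightarrow> l \<notin> tup m M \<Longrightarrow> Pmap m N f t l = 0"
  using map_tup[of f N M] by (auto simp: Pmap_eq intro!: sum.neutral)

lemma Pmap_ten:
  assumes "f ` {..<N} \<subseteq> {..<M}"
  shows "Pmap m N f (ten m N v) = ten m M (\<lambda>i y. \<Sum>x<N. v i x * of_bool (f x = y))"
proof
  fix l show "Pmap m N f (ten m N v) l = ten m M (\<lambda>i y. \<Sum>x<N. v i x * of_bool (f x = y)) l"
  proof (cases "l \<in> tup m M")
    case True
    have "of_bool (map f l' = l) = (\<Prod>i<m. of_bool (f (l' ! i) = l ! i) :: 'a)" if l': "l' \<in> tup m N" for l'
    proof (cases "map f l' = l")
      case False
      then obtain i where "i < m" "f (l' ! i) \<noteq> l ! i"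
        using l' True by (auto simp: list_eq_iff_nth_eq tup_length)
      then show ?thesis using False by (auto intro!: prod_zero[symmetric] bexI[of _ i])
    qed (use that True in \<open>auto simp: tup_length\<close>)
    then have "Pmap m N f (ten m N v) l = (\<Sum>l'\<in>tup m N. \<Prod>i<m. v i (l' ! i) * of_bool (f (l' ! i) = l ! i))"
      by (simp add: Pmap_eq ten_def prod.distrib)
    also have "\<dots> = (\<Prod>i<m. \<Sum>x<N. v i x * of_bool (f x = l ! i))"
      by (rule sum_prod_tup)
    finally show ?thesis using True by (simp add: ten_def)
  qed (use assms in \<open>simp add: ten_def Pmap_outside\<close>)
qed

lemma map_update_eq_iff:
  assumes "i < length l" "length l' = length l"
  shows "map f l' = l[i := y] \<longleftrightarrow> (\<forall>j<length l. j \<noteq> i \<longrightarrow> f (l' ! j) = l ! j) \<and> f (l' ! i) = y"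
  using assms by (auto simp: list_eq_iff_nth_eq nth_list_update)

text \<open>Summing over the entry at place i of the image removes the condition on that entry of
  the source tuple, so \<open>sum_update_invariant\<close> applies to what is left.\<close>

lemma balanced_Pmap:
  fixes t :: "nat list \<Rightarrow> 'k::field_char_0"
  assumes f: "f ` {..<N} \<subseteq> {..<M}" and t: "balanced m N t"
  shows "balanced m M (Pmap m N f t)"
  unfolding balanced_def
proof (intro conjI allI impI ballI)
  fix l i assume l: "l \<in> tup m M" and i: "i < m"
  let ?A = "\<lambda>l'. of_bool (\<forall>j<m. j \<noteq> i \<longrightarrow> f (l' ! j) = l ! j) :: 'k"
  have "(\<Sum>y<M. Pmap m N f t (l[i := y])) = (\<Sum>l'\<in>tup m N. \<Sum>y<M. t l' * of_bool (map f l' = l[i := y]))"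
    unfolding Pmap_eq by (rule sum.swap)
  also have "\<dots> = (\<Sum>l'\<in>tup m N. t l' * ?A l')"
  proof (rule sum.cong[OF refl])
    fix l' assume l': "l' \<in> tup m N"
    have "f (l' ! i) < M" using f tup_nth[OF l' i] by auto
    moreover have "of_bool (map f l' = l[i := y]) = ?A l' * of_bool (f (l' ! i) = y)" for y
      using map_update_eq_iff[of i l l' f y] l l' i by (simp add: tup_length)
    ultimately show "(\<Sum>y<M. t l' * of_bool (map f l' = l[i := y])) = t l' * ?A l'"
      by (simp only: mult.assoc[symmetric]) (simp add: of_bool_def if_distrib cong: if_cong)
  qed
  also have "\<dots> = 0"
  proof (rule sum_update_invariant[where i = i and N = N])
    show "?A (l'[i := x]) = ?A l'" if "l' \<in> tup m N" for l' x
      using that i by (auto simp: tup_length nth_list_update)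
  qed (use t i in \<open>auto simp: balanced_def tup_length tup_nth tup_update\<close>)
  finally show "(\<Sum>y<M. Pmap m N f t (l[i := y])) = 0" .
next
  assume "M = 0"
  then have "N = 0" using f by auto
  then show "Pmap m N f t = (\<lambda>_. 0)" using t by (simp add: balanced_def fun_eq_iff Pmap_eq)
qed (simp add: Pmap_outside[OF f])

subsection \<open>Natural transformations are determined by one value\<close>

definition dten :: "nat \<Rightarrow> nat \<Rightarrow> (nat \<Rightarrow> nat) \<Rightarrow> (nat \<Rightarrow> nat) \<Rightarrow> nat list \<Rightarrow> 'k::field" where
  "dten m N p q = ten m N (\<lambda>i x. of_bool (x = p i) - of_bool (x = q i))"

lemma sum_of_bool_eq: "a < N \<Longrightarrow> (\<Sum>x<N. of_bool (x = a) * f x) = (f a :: 'k::field)" for a N :: nat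
  by (simp add: of_bool_def if_distrib if_distribR cong: if_cong)

lemma dten_cong:
  assumes "\<And>i. i < m \<Longrightarrow> p i = p' i" "\<And>i. i < m \<Longrightarrow> q i = q' i"
  shows "dten m N p q = dten m N p' q'"
  unfolding dten_def by (rule ten_cong) (simp add: assms)

lemma balanced_dten:
  assumes "N > 0" "\<And>i. i < m \<Longrightarrow> p i < N" "\<And>i. i < m \<Longrightarrow> q i < N"
  shows "balanced m N (dten m N p q)"
proof -
  have "(\<Sum>x<N. of_bool (x = p i) - of_bool (x = q i) :: 'a) = 0" if "i < m" for i
    using sum_of_bool_eq[of "p i" N "\<lambda>_. 1::'a"] sum_of_bool_eq[of "q i" N "\<lambda>_. 1::'a"] assms(2,3)[OF that]
    by (simp add: sum_subtractf)
  then show ?thesis using assms(1) unfolding balanced_def dten_def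
    by (auto intro!: ten_aug) (simp add: ten_def)
qed

lemma Pmap_dten:
  assumes "f ` {..<N} \<subseteq> {..<M}" "\<And>i. i < m \<Longrightarrow> p i < N" "\<And>i. i < m \<Longrightarrow> q i < N"
  shows "Pmap m N f (dten m N p q) = dten m M (f \<circ> p) (f \<circ> q)"
  unfolding dten_def Pmap_ten[OF assms(1)]
proof (rule ten_cong)
  fix i y assume i: "i < m"
  show "(\<Sum>x<N. (of_bool (x = p i) - of_bool (x = q i)) * of_bool (f x = y)) =
      of_bool (y = (f \<circ> p) i) - (of_bool (y = (f \<circ> q) i) :: 'a)"
    unfolding left_diff_distrib sum_subtractf sum_of_bool_eq[OF assms(2)[OF i]] sum_of_bool_eq[OF assms(3)[OF i]]
    by (simp add: eq_commute)
qed

lemma dten_flip: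
  assumes "j < m"
  shows "dten m N (p(j := q j)) (q(j := p j)) = sc (-1) (dten m N p q)"
  unfolding sc_def dten_def by (rule ext, rule ten_scale[OF assms]) auto

text \<open>In factor j, [p] - [q] = ([p] - [r]) - ([q] - [r]).\<close>

lemma dten_split:
  assumes "j < m"
  shows "dten m N p q = dten m N p (q(j := r)) + sc (-1) (dten m N (p(j := q j)) (q(j := r)))"
proof
  fix l
  have "dten m N p q l = dten m N p (q(j := r)) l - dten m N (p(j := q j)) (q(j := r)) l"
    unfolding dten_def by (rule ten_diff[OF assms]) auto
  then show "dten m N p q l = (dten m N p (q(j := r)) + sc (-1) (dten m N (p(j := q j)) (q(j := r)))) l"
    by (simp add: sc_def)
qed

lemma balanced_add: "balanced m N s \<Longrightarrow> balanced m N t \<Longrightarrow> balanced m N (s + t)"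
  by (auto simp: balanced_def sum.distrib fun_eq_iff)

lemma balanced_sc: "balanced m N t \<Longrightarrow> balanced m N (sc c t)"
  by (auto simp: balanced_def sc_def simp flip: sum_distrib_left)

lemma balanced_0: "balanced m N 0"
  by (auto simp: balanced_def zero_fun_def)

lemma balanced_sum: "(\<And>i. i \<in> I \<Longrightarrow> balanced m N (g i)) \<Longrightarrow> balanced m N (\<Sum>i\<in>I. sc (c i) (g i))"
  by (induction I rule: infinite_finite_induct) (auto simp: balanced_0 balanced_add balanced_sc)

lemma balanced_eq_dten:
  assumes "N > 0" "balanced m N t"
  shows "t = (\<Sum>l\<in>tup m N. sc (t l) (dten m N ((!) l) (\<lambda>_. 0)))"
proof
  fix l
  show "t l = (\<Sum>l\<in>tup m N. sc (t l) (dten m N ((!) l) (\<lambda>_. 0))) l"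
  proof (cases "l \<in> tup m N")
    case True
    have "t l = (\<Sum>l'\<in>tup m N. t l' * (\<Prod>i<m. basic l' i (l ! i)))"
      using assms True by (intro balanced_expand) (auto simp: balanced_def)
    then show ?thesis using True by (simp add: sum_fun_apply sc_def ten_def dten_def)
  qed (use assms in \<open>simp add: sum_fun_apply sc_def ten_def balanced_def dten_def\<close>)
qed

lemma Pmap_perm:
  assumes "\<And>x y. x < N \<Longrightarrow> y < N \<Longrightarrow> f x = y \<longleftrightarrow> x = g y" "\<And>y. y < N \<Longrightarrow> g y < N" "l \<in> tup n N"
  shows "Pmap n N f t l = t (map g l)"
proof -
  have g: "map g l \<in> tup n N" using assms(2) by (intro map_tup[OF _ assms(3)]) auto
  have "map f l' = l \<longleftrightarrow> l' = map g l" if "l' \<in> tup n N" for l'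
    using that assms(3) by (auto simp: list_eq_iff_nth_eq tup_length tup_nth assms(1))
  then have "Pmap n N f t l = (\<Sum>l'\<in>tup n N. if l' = map g l then t l' else 0)"
    unfolding Pmap_eq by (intro sum.cong) auto
  then show ?thesis using g by simp
qed

lemma Pmap_nonzero:
  assumes "Pmap n N f t l \<noteq> 0"
  shows "set l \<subseteq> f ` {..<N}"
proof -
  obtain l' where "l' \<in> tup n N" "t l' * of_bool (map f l' = l) \<noteq> 0"
    using assms unfolding Pmap_eq by (rule sum.not_neutral_contains_not_neutral)
  then have "set l' \<subseteq> {..<N}" "l = map f l'" by (auto simp: tup_def split: if_splits)
  then show ?thesis by (simp add: image_mono)
qed

text \<open>The tensor of the differences \<open>[i] - [m + i]\<close>. The point \<open>2 * m\<close> is a spare base point: it makes the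
  set non-empty for \<open>m = 0\<close> and lets \<open>[i] - [m + i]\<close> be split as a difference of two differences.\<close>

abbreviation evec :: "nat \<Rightarrow> nat list \<Rightarrow> 'k::field" where
  "evec m \<equiv> dten m (2 * m + 1) (\<lambda>i. i) (\<lambda>i. m + i)"

lemma balanced_evec: "balanced m (2 * m + 1) (evec m)"
  by (rule balanced_dten) auto

text \<open>The map of finite sets that carries \<open>evec m\<close> to
  \<open>dten m M p q\<close>, with r as the image of the base point. By naturality, one value of a
  transformation thus gives its values on all tensors of differences, and these span.\<close>

definition merge :: "nat \<Rightarrow> (nat \<Rightarrow> nat) \<Rightarrow> (nat \<Rightarrow> nat) \<Rightarrow> nat \<Rightarrow> nat \<Rightarrow> nat" where
  "merge m p q r x = (if x < m then p x else if x < 2 * m then q (x - m) else r)"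

context
  fixes m n :: nat and \<phi> :: "nat \<Rightarrow> (nat list \<Rightarrow> 'k::field_char_0) \<Rightarrow> nat list \<Rightarrow> 'k"
  assumes nat: "natural m n \<phi>"
begin

lemma natural_lin: "lin_on (Pbt m N) (\<phi> N)"
  using nat by (simp only: natural_def simp_thms)

lemma natural_in: "balanced m N t \<Longrightarrow> balanced n N (\<phi> N t)"
  using nat by (simp only: natural_def flip: Pbt_eq)

lemma natural_out:
  assumes "\<not> balanced m N t"
  shows "\<phi> N t = 0"
proof -
  have "\<forall>t. t \<notin> Pbt m N \<longrightarrow> \<phi> N t = 0" using nat unfolding natural_def by (elim conjE allE[of _ N])
  then show ?thesis using assms by (simp add: Pbt_eq)
qed

lemma natural_Pmap: "f ` {..<N} \<subseteq> {..<M} \<Longrightarrow> balanced m N t \<Longrightarrow> \<phi> M (Pmap m N f t) = Pmap n N f (\<phi> N t)"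
  using nat unfolding natural_def Pbt_eq[symmetric] by (elim conjE) simp

lemma natural_add: "balanced m N s \<Longrightarrow> balanced m N t \<Longrightarrow> \<phi> N (s + t) = \<phi> N s + \<phi> N t"
  using natural_lin[of N] by (simp only: lin_on_def flip: Pbt_eq)

lemma natural_sc: "balanced m N t \<Longrightarrow> \<phi> N (sc c t) = sc c (\<phi> N t)"
  using natural_lin[of N] by (simp only: lin_on_def flip: Pbt_eq)

lemma natural_0: "\<phi> N 0 = 0"
  using natural_sc[OF balanced_0, of N 0] by (simp add: sc_def zero_fun_def)

lemma natural_sum:
  assumes "\<And>i. i \<in> I \<Longrightarrow> balanced m N (g i)"
  shows "\<phi> N (\<Sum>i\<in>I. sc (c i) (g i)) = (\<Sum>i\<in>I. sc (c i) (\<phi> N (g i)))"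
  using assms
  by (induction I rule: infinite_finite_induct)
    (auto simp: natural_0 natural_add natural_sc balanced_sum balanced_sc)

private abbreviation (input) "t0 \<equiv> \<phi> (2 * m + 1) (evec m)"

lemma balanced_t0: "balanced n (2 * m + 1) t0"
  by (rule natural_in[OF balanced_evec])

lemma natural_dten:
  assumes "\<And>i. i < m \<Longrightarrow> p i < M" "\<And>i. i < m \<Longrightarrow> q i < M" "r < M"
  shows "\<phi> M (dten m M p q) = Pmap n (2 * m + 1) (merge m p q r) t0"
proof -
  have r: "merge m p q r ` {..<2 * m + 1} \<subseteq> {..<M}"
    using assms by (auto simp: merge_def)
  have "Pmap m (2 * m + 1) (merge m p q r) (evec m :: nat list \<Rightarrow> 'k) = dten m M (merge m p q r \<circ> (\<lambda>i. i)) (merge m p q r \<circ> (\<lambda>i. m + i))"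
    by (rule Pmap_dten[OF r]) auto
  also have "\<dots> = dten m M p q"
    by (rule dten_cong) (auto simp: merge_def)
  finally have "Pmap m (2 * m + 1) (merge m p q r) (evec m) = (dten m M p q :: nat list \<Rightarrow> 'k)" .
  then show ?thesis using natural_Pmap[OF r balanced_evec] by (simp only:)
qed

text \<open>Sending the base point to 0 and fixing all other points fixes \<open>evec\<close>, hence
  also \<open>t0\<close>; the image of this map avoids the base point.\<close>

lemma t0_base:
  assumes "0 < m" "2 * m \<in> set l"
  shows "t0 l = 0"
proof (rule ccontr)
  assume *: "t0 l \<noteq> 0"
  have eq: "t0 = Pmap n (2 * m + 1) (merge m (\<lambda>i. i) (\<lambda>i. m + i) 0) t0"
    by (rule natural_dten) auto
  have "Pmap n (2 * m + 1) (merge m (\<lambda>i. i) (\<lambda>i. m + i) 0) t0 l \<noteq> 0"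
    using * by (rule back_subst[of "\<lambda>u. u \<noteq> 0"]) (rule fun_cong[OF eq])
  from Pmap_nonzero[OF this] show False
    using assms by (auto simp: merge_def split: if_splits)
qed

text \<open>Split factor j over the base point. One of the two tensors lives on a set without m + j,
  the other on a set without j, and so do their images under \<open>\<phi>\<close>.\<close>

lemma t0_both:
  assumes "j < m" "j \<in> set l" "m + j \<in> set l"
  shows "t0 l = 0"
proof -
  let ?p = "\<lambda>i. i" and ?q = "\<lambda>i. m + i" and ?N = "2 * m + 1"
  let ?q' = "?q(j := 2 * m)" and ?p' = "?p(j := ?q j)"
  have b: "balanced m ?N (dten m ?N ?p ?q' :: nat list \<Rightarrow> 'k)" "balanced m ?N (dten m ?N ?p' ?q' :: nat list \<Rightarrow> 'k)"
    by (rule balanced_dten, use assms(1) in auto)+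
  have "t0 = \<phi> ?N (dten m ?N ?p ?q') + sc (-1) (\<phi> ?N (dten m ?N ?p' ?q'))"
    unfolding natural_sc[OF b(2), symmetric] natural_add[OF b(1) balanced_sc[OF b(2)], symmetric]
    by (subst dten_split[OF assms(1)]) (rule refl)
  then have eq: "t0 l = \<phi> ?N (dten m ?N ?p ?q') l - \<phi> ?N (dten m ?N ?p' ?q') l"
    by (rule fun_cong[THEN trans]) (simp add: sc_def)
  have 1: "\<phi> ?N (dten m ?N ?p ?q') = Pmap n ?N (merge m ?p ?q' (2 * m)) t0"
    by (rule natural_dten) (use assms(1) in auto)
  have 2: "\<phi> ?N (dten m ?N ?p' ?q') = Pmap n ?N (merge m ?p' ?q' (2 * m)) t0"
    by (rule natural_dten) (use assms(1) in auto)
  have "\<phi> ?N (dten m ?N ?p ?q') l = 0"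
  proof (rule ccontr)
    assume "\<phi> ?N (dten m ?N ?p ?q') l \<noteq> 0"
    from Pmap_nonzero[OF this[unfolded 1]] show False
      using assms by (auto simp: merge_def split: if_splits)
  qed
  moreover have "\<phi> ?N (dten m ?N ?p' ?q') l = 0"
  proof (rule ccontr)
    assume "\<phi> ?N (dten m ?N ?p' ?q') l \<noteq> 0"
    from Pmap_nonzero[OF this[unfolded 2]] show False
      using assms by (auto simp: merge_def split: if_splits)
  qed
  ultimately show ?thesis unfolding eq by simp
qed

text \<open>Exchanging the points j and m + j changes the sign of factor j of
  \<open>evec\<close>.\<close>

lemma t0_swap:
  assumes "j < m" "l \<in> tup n (2 * m + 1)"
  shows "t0 (map (transpose j (m + j)) l) = - t0 l"
proof -
  let ?p = "\<lambda>i. i" and ?q = "\<lambda>i. m + i" and ?N = "2 * m + 1"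
  let ?q' = "?q(j := j)" and ?p' = "?p(j := m + j)"
  have "sc (-1) t0 = \<phi> ?N (dten m ?N ?p' ?q')"
    by (subst dten_flip[OF assms(1)]) (rule natural_sc[OF balanced_evec, symmetric])
  also have "\<dots> = Pmap n ?N (merge m ?p' ?q' (2 * m)) t0"
    by (rule natural_dten) (use assms(1) in auto)
  finally have "- t0 l = Pmap n ?N (merge m ?p' ?q' (2 * m)) t0 l"
    by (simp add: sc_def fun_eq_iff)
  also have "\<dots> = t0 (map (transpose j (m + j)) l)"
    by (rule Pmap_perm[OF _ _ assms(2)]) (use assms(1) in \<open>auto simp: merge_def transpose_def\<close>)
  finally show ?thesis ..
qed

lemma t0_neither:
  assumes "j < m" "j \<notin> set l" "m + j \<notin> set l"
  shows "t0 l = 0"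
proof (cases "l \<in> tup n (2 * m + 1)")
  case True
  have "map (transpose j (m + j)) l = l"
    using assms(2,3) by (intro map_idI) (auto simp: transpose_def)
  then have "t0 l = - t0 l" using t0_swap[OF assms(1) True] by simp
  then show ?thesis by (simp add: eq_neg_iff_add_eq_0)
qed (use balanced_t0 in \<open>simp add: balanced_def\<close>)

text \<open>Up to sign, \<open>t0_swap\<close> turns every occurrence of m + j without j into j.
  Once no such points are left, a list is covered by \<open>t0_base\<close> or
  \<open>t0_neither\<close>, or its entries are exactly \<open>{..<m}\<close>.\<close>

lemma t0_zero:
  assumes "\<And>l. length l = n \<Longrightarrow> set l = {..<m} \<Longrightarrow> t0 l = 0"
  shows "t0 = 0"
proof -
  let ?N = "2 * m + 1"
  have "t0 l = 0" if "l \<in> tup n ?N" for l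
  proof (cases "m = 0")
    case True
    show ?thesis
    proof (cases "n = 0")
      case False
      \<comment> \<open>For m = 0 the base point is the only point, and the balance condition is a
        single term.\<close>
      have "(\<Sum>x<?N. t0 (l[0 := x])) = 0" using balanced_t0 that False by (auto simp: balanced_def)
      moreover have "l[0 := 0] = l"
        using that True False tup_nth[OF that, of 0] by (metis bot_nat_0.not_eq_extremum less_one list_update_id mult_0_right add_0)
      ultimately show ?thesis by (simp add: True)
    qed (use True that assms in \<open>auto simp: tup_def\<close>)
  next
    case False
    show ?thesis using that
    proof (induction "card {j. j < m \<and> m + j \<in> set l}" arbitrary: l rule: less_induct)
      case less
      show ?case
      proof (cases "\<exists>j<m. m + j \<in> set l")
        case True
        then obtain j where j: "j < m" "m + j \<in> set l" by blast
        show ?thesis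
        proof (cases "j \<in> set l")
          case True
          then show ?thesis using j t0_both by blast
        next
          case False
          let ?l = "map (transpose j (m + j)) l"
          have set: "m + i \<in> set ?l \<longleftrightarrow> i \<noteq> j \<and> m + i \<in> set l" if "i < m" for i
            using False j that by (auto simp: transpose_def image_iff)
          have "?l \<in> tup n ?N"
            using less.prems j by (intro map_tup[of _ ?N]) (auto simp: transpose_def)
          moreover have "{i. i < m \<and> m + i \<in> set ?l} = {i. i < m \<and> m + i \<in> set l} - {j}"
            using set by blast
          then have "card {i. i < m \<and> m + i \<in> set ?l} < card {i. i < m \<and> m + i \<in> set l}"
            by (simp only:) (rule card_Diff1_less, use j in auto)
          ultimately have "t0 ?l = 0" using less.hyps by blast
          then show ?thesis using t0_swap[OF j(1) less.prems] by simp
        qed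
      next
        case False
        show ?thesis
        proof (cases "2 * m \<in> set l")
          case True
          then show ?thesis using \<open>m \<noteq> 0\<close> by (intro t0_base) auto
        next
          case l2: False
          have sub: "set l \<subseteq> {..<m}"
          proof
            fix x assume x: "x \<in> set l"
            then have "x < ?N" "x \<noteq> 2 * m" using less.prems l2 by (auto simp: tup_def)
            moreover have "\<not> (m \<le> x \<and> x < 2 * m)" using False x
              by (metis le_add_diff_inverse nat_add_left_cancel_less mult_2)
            ultimately show "x \<in> {..<m}" by auto
          qed
          show ?thesis
          proof (cases "set l = {..<m}")
            case True
            then show ?thesis using less.prems assms by (simp add: tup_def)
          next
            case neq: False
            then obtain j where "j < m" "j \<notin> set l" using sub by auto
            moreover from this have "m + j \<notin> set l" using sub by auto
            ultimately show ?thesis by (rule t0_neither)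
          qed
        qed
      qed
    qed
  qed
  then show ?thesis using balanced_t0 by (auto simp: balanced_def fun_eq_iff)
qed

lemma natural_zero:
  assumes "t0 = 0"
  shows "\<phi> N t = 0"
proof (cases "balanced m N t")
  case True
  show ?thesis
  proof (cases "N = 0")
    case N0: True
    then have "t = 0" using True by (simp add: balanced_def zero_fun_def)
    then show ?thesis by (simp only: natural_0)
  next
    case N: False
    have 0: "\<phi> N (dten m N ((!) l) (\<lambda>_. 0)) = 0" if "l \<in> tup m N" for l
    proof -
      have "\<phi> N (dten m N ((!) l) (\<lambda>_. 0)) = Pmap n (2 * m + 1) (merge m ((!) l) (\<lambda>_. 0) 0) t0"
        by (rule natural_dten) (use N tup_nth[OF that] in auto)
      then show ?thesis unfolding assms by (simp add: Pmap_eq fun_eq_iff)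
    qed
    have "\<phi> N (\<Sum>l\<in>tup m N. sc (t l) (dten m N ((!) l) (\<lambda>_. 0))) =
        (\<Sum>l\<in>tup m N. sc (t l) (\<phi> N (dten m N ((!) l) (\<lambda>_. 0))))"
      by (rule natural_sum, rule balanced_dten) (use N tup_nth in auto)
    also have "\<dots> = 0" using 0 by (intro sum.neutral) (simp add: sc_def fun_eq_iff)
    finally show ?thesis by (subst balanced_eq_dten[OF _ True]) (use N in simp_all)
  qed
qed (rule natural_out)

text \<open>The balance condition at place i is a sum over all points. As every j < m occurs at
  another place, the terms at m + j vanish by \<open>t0_both\<close>, and the base point by
  \<open>t0_base\<close>.\<close>

lemma t0_cocycle:
  assumes "length l = n" "i < n" "{..<m} \<subseteq> (!) l ` ({..<n} - {i})" "set l \<subseteq> {..<m}"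
  shows "(\<Sum>b<m. t0 (l[i := b])) = 0"
proof (cases "m = 0")
  case False
  let ?N = "2 * m + 1"
  have sub: "{..<m} \<subseteq> set (l[i := b])" for b
  proof
    fix a assume "a \<in> {..<m}"
    then obtain j where "j < n" "j \<noteq> i" "a = l ! j" using assms(3) by auto
    then show "a \<in> set (l[i := b])" using assms(1) by (metis length_list_update nth_list_update_neq nth_mem)
  qed
  have mem: "b \<in> set (l[i := b])" for b using assms(1,2) by (simp add: set_update_memI)
  have "t0 (l[i := b]) = 0" if "b \<in> {..<?N} - {..<m}" for b
  proof (cases "b = 2 * m")
    case True
    then show ?thesis using False mem[of b] by (intro t0_base) auto
  next
    case b: False
    then have "b - m < m" "m + (b - m) = b" using that by auto
    then show ?thesis using sub[of b] mem[of b] by (intro t0_both[of "b - m"]) auto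
  qed
  then have "(\<Sum>b<m. t0 (l[i := b])) = (\<Sum>b<?N. t0 (l[i := b]))"
    by (intro sum.mono_neutral_left) auto
  also have "\<dots> = 0"
  proof -
    have "l \<in> tup n ?N" using assms(1,4) by (force simp: tup_def)
    then show ?thesis using balanced_t0 assms(2) unfolding balanced_def by blast
  qed
  finally show ?thesis .
qed simp

end

subsection \<open>Natural transformations from cocycles\<close>

definition surj_lists :: "nat \<Rightarrow> nat \<Rightarrow> nat list set" where
  "surj_lists m n = {g. length g = n \<and> set g = {..<m}}"

lemma finite_surj_lists [simp]: "finite (surj_lists m n)"
  by (rule finite_subset[OF _ finite_tup[of n m]]) (auto simp: surj_lists_def tup_def)

text \<open>The restriction to Pbar^m of the linear combination, with coefficients c, of the maps
  from P_m to P_n given by composition with surjections.\<close>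

definition Phi :: "nat \<Rightarrow> nat \<Rightarrow> (nat list \<Rightarrow> 'k) \<Rightarrow> nat \<Rightarrow> (nat list \<Rightarrow> 'k) \<Rightarrow> nat list \<Rightarrow> 'k::field" where
  "Phi m n c N t l = (if balanced m N t
     then \<Sum>g\<in>surj_lists m n. c g * (\<Sum>l'\<in>tup m N. t l' * of_bool (map ((!) l') g = l)) else 0)"

lemma map_nth_tup:
  assumes "l' \<in> tup m N" "g \<in> surj_lists m n"
  shows "map ((!) l') g \<in> tup n N"
proof -
  have "l' ! a < N" if "a < m" for a using tup_nth[OF assms(1) that] .
  then show ?thesis using assms(2) unfolding tup_def surj_lists_def by auto
qed

text \<open>Summing over place i leaves a weight \<open>A g\<close> that does not depend on
  \<open>g ! i\<close>. If g misses a letter a outside place i, then \<open>A g\<close> does not see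
  factor a of t and vanishes, as t is balanced. The remaining g are closed under changes at i, and
  there the hypothesis on c applies.\<close>

lemma balanced_Phi:
  fixes t :: "nat list \<Rightarrow> 'k::field_char_0"
  assumes c: "\<And>g i. length g = n \<Longrightarrow> i < n \<Longrightarrow> set g \<subseteq> {..<m} \<Longrightarrow> {..<m} \<subseteq> (!) g ` ({..<n} - {i}) \<Longrightarrow>
        (\<Sum>b<m. c (g[i := b])) = 0"
    and t: "balanced m N t"
  shows "balanced n N (Phi m n c N t)"
  unfolding balanced_def
proof (intro conjI allI impI ballI)
  fix l assume "l \<notin> tup n N"
  then have "of_bool (map ((!) l') g = l) = (0::'k)" if "g \<in> surj_lists m n" "l' \<in> tup m N" for g l'
    using map_nth_tup[OF that(2,1)] by auto
  then show "Phi m n c N t l = 0" by (simp add: Phi_def)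
next
  assume "N = 0"
  then show "Phi m n c N t = (\<lambda>_. 0)" using t by (simp add: Phi_def balanced_def fun_eq_iff)
next
  fix l i assume l: "l \<in> tup n N" and i: "i < n"
  define A where "A g = (\<Sum>l'\<in>tup m N. t l' * of_bool (\<forall>j<n. j \<noteq> i \<longrightarrow> l' ! (g ! j) = l ! j))" for g
  let ?G1 = "{g \<in> surj_lists m n. {..<m} \<subseteq> (!) g ` ({..<n} - {i})}"
  have glt: "g ! j < m" if "g \<in> surj_lists m n" "j < n" for g j
    using that nth_mem[of j g] by (auto simp: surj_lists_def)
  have inner: "(\<Sum>x<N. \<Sum>l'\<in>tup m N. t l' * of_bool (map ((!) l') g = l[i := x])) = A g" if g: "g \<in> surj_lists m n" for g
  proof -
    have "(\<Sum>x<N. \<Sum>l'\<in>tup m N. t l' * of_bool (map ((!) l') g = l[i := x])) =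
        (\<Sum>l'\<in>tup m N. \<Sum>x<N. t l' * of_bool (map ((!) l') g = l[i := x]))" by (rule sum.swap)
    also have "\<dots> = A g" unfolding A_def
    proof (rule sum.cong[OF refl])
      fix l' assume l': "l' \<in> tup m N"
      let ?B = "of_bool (\<forall>j<n. j \<noteq> i \<longrightarrow> l' ! (g ! j) = l ! j) :: 'k"
      have lt: "l' ! (g ! i) < N" using tup_nth[OF l' glt[OF g i]] .
      have "of_bool (map ((!) l') g = l[i := x]) = of_bool (x = l' ! (g ! i)) * ?B" for x
        using map_update_eq_iff[of i l g "(!) l'" x] l g i by (auto simp: tup_length surj_lists_def)
      then have "(\<Sum>x<N. t l' * of_bool (map ((!) l') g = l[i := x])) = (\<Sum>x<N. of_bool (x = l' ! (g ! i)) * (t l' * ?B))"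
        by (simp add: mult_ac)
      then show "(\<Sum>x<N. t l' * of_bool (map ((!) l') g = l[i := x])) = t l' * ?B"
        by (simp only: sum_of_bool_eq[OF lt])
    qed
    finally show ?thesis .
  qed
  have "(\<Sum>x<N. Phi m n c N t (l[i := x])) = (\<Sum>x<N. \<Sum>g\<in>surj_lists m n.
      c g * (\<Sum>l'\<in>tup m N. t l' * of_bool (map ((!) l') g = l[i := x])))" using t by (simp add: Phi_def)
  also have "\<dots> = (\<Sum>g\<in>surj_lists m n. \<Sum>x<N.
      c g * (\<Sum>l'\<in>tup m N. t l' * of_bool (map ((!) l') g = l[i := x])))" by (rule sum.swap)
  also have "\<dots> = (\<Sum>g\<in>surj_lists m n. c g * A g)"
    unfolding sum_distrib_left[symmetric] by (intro sum.cong refl) (simp only: inner)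
  also have "\<dots> = (\<Sum>g\<in>?G1. c g * A g)"
  proof (rule sum.mono_neutral_right)
    show "\<forall>g\<in>surj_lists m n - ?G1. c g * A g = 0"
    proof
      fix g assume "g \<in> surj_lists m n - ?G1"
      then obtain a where g: "g \<in> surj_lists m n" and a: "a < m" "a \<notin> (!) g ` ({..<n} - {i})" by blast
      have ga: "g ! j \<noteq> a" if "j < n" "j \<noteq> i" for j using a that by blast
      have "A g = 0" unfolding A_def
      proof (rule sum_update_invariant[where i = a and N = N])
        show "of_bool (\<forall>j<n. j \<noteq> i \<longrightarrow> l'[a := x] ! (g ! j) = l ! j) =
          (of_bool (\<forall>j<n. j \<noteq> i \<longrightarrow> l' ! (g ! j) = l ! j) :: 'k)" for l' x
        proof -
          have "l'[a := x] ! (g ! j) = l' ! (g ! j)" if "j < n" "j \<noteq> i" for j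
            using ga[OF that] by (intro nth_list_update_neq) auto
          then show ?thesis by (intro arg_cong[of _ _ of_bool]) metis
        qed
      qed (use t a in \<open>auto simp: balanced_def tup_length tup_nth tup_update\<close>)
      then show "c g * A g = 0" by simp
    qed
  qed auto
  also have "\<dots> = 0"
  proof (rule sum_update_invariant[where i = i and N = m])
    show "g[i := x] \<in> ?G1" if "g \<in> ?G1" "x < m" for g x
    proof -
      have len: "length g = n" and sub: "{..<m} \<subseteq> (!) g ` ({..<n} - {i})" and set: "set g = {..<m}"
        using that by (auto simp: surj_lists_def)
      have img: "(!) (g[i := x]) ` ({..<n} - {i}) = (!) g ` ({..<n} - {i})" by (rule image_cong) auto
      have "(!) (g[i := x]) ` ({..<n} - {i}) \<subseteq> set (g[i := x])" using len
        by (intro image_subsetI nth_mem) simp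
      then have "{..<m} \<subseteq> set (g[i := x])" using sub img by blast
      moreover have "set (g[i := x]) \<subseteq> {..<m}"
        using set_update_subset_insert[of g i x] set that(2) by auto
      ultimately show ?thesis using len sub img by (simp add: surj_lists_def)
    qed
    show "A (g[i := x]) = A g" for g x
    proof -
      have "(\<forall>j<n. j \<noteq> i \<longrightarrow> l' ! (g[i := x] ! j) = l ! j) \<longleftrightarrow> (\<forall>j<n. j \<noteq> i \<longrightarrow> l' ! (g ! j) = l ! j)" for l'
        by auto
      then show ?thesis by (simp only: A_def)
    qed
    show "(\<Sum>x<m. c (g[i := x])) = 0" if "g \<in> ?G1" for g
      using that i by (intro c) (auto simp: surj_lists_def)
    show "i < length g \<and> g ! i < m" if "g \<in> ?G1" for g
      using that i glt[of g i] by (auto simp: surj_lists_def)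
  qed auto
  finally show "(\<Sum>x<N. Phi m n c N t (l[i := x])) = 0" .
qed

lemma natural_Phi:
  fixes c :: "nat list \<Rightarrow> 'k::field_char_0"
  assumes c: "\<And>g i. length g = n \<Longrightarrow> i < n \<Longrightarrow> set g \<subseteq> {..<m} \<Longrightarrow> {..<m} \<subseteq> (!) g ` ({..<n} - {i}) \<Longrightarrow>
        (\<Sum>b<m. c (g[i := b])) = 0"
  shows "natural m n (Phi m n c)"
  unfolding natural_def Pbt_eq lin_on_def
proof (intro conjI allI impI ballI)
  fix N and s t :: "nat list \<Rightarrow> 'k" assume "s \<in> Pbt m N" "t \<in> Pbt m N"
  then show "Phi m n c N (s + t) = Phi m n c N s + Phi m n c N t"
    by (simp add: fun_eq_iff Phi_def Pbt_eq balanced_add distrib_right distrib_left sum.distrib)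
next
  fix N a and t :: "nat list \<Rightarrow> 'k" assume t: "t \<in> Pbt m N"
  show "Phi m n c N (sc a t) = sc a (Phi m n c N t)"
  proof -
    have "(\<Sum>l'\<in>tup m N. sc a t l' * B l') = a * (\<Sum>l'\<in>tup m N. t l' * B l')" for B :: "nat list \<Rightarrow> 'k"
      by (simp only: sc_def sum_distrib_left mult.assoc)
    then have "Phi m n c N (sc a t) l = a * Phi m n c N t l" for l
      using t
      by (simp only: Phi_def Pbt_eq balanced_sc if_True sum_distrib_left[of a] mult.left_commute[of a])
    then show ?thesis by (simp add: fun_eq_iff sc_def[of a "Phi m n c N t"])
  qed
next
  fix N and t :: "nat list \<Rightarrow> 'k" assume "t \<in> Pbt m N"
  then show "balanced n N (Phi m n c N t)" unfolding Pbt_eq by (rule balanced_Phi[rotated]) (rule c)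
next
  fix N and t :: "nat list \<Rightarrow> 'k" assume "\<not> balanced m N t"
  then show "Phi m n c N t = 0" by (simp add: fun_eq_iff Phi_def)
next
  fix N M :: nat and f :: "nat \<Rightarrow> nat" and t :: "nat list \<Rightarrow> 'k" assume f: "f ` {..<N} \<subseteq> {..<M}" and "t \<in> Pbt m N"
  then have t: "balanced m N t" by (simp add: Pbt_eq)
  show "Phi m n c M (Pmap m N f t) = Pmap n N f (Phi m n c N t)"
  proof
    fix l
    have 1: "(\<Sum>l'\<in>tup m M. Pmap m N f t l' * of_bool (map ((!) l') g = l)) =
        (\<Sum>l1\<in>tup n N. (\<Sum>l'\<in>tup m N. t l' * of_bool (map ((!) l') g = l1)) * of_bool (map f l1 = l))"
      if g: "g \<in> surj_lists m n" for g
    proof -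
      have "(\<Sum>l'\<in>tup m M. Pmap m N f t l' * of_bool (map ((!) l') g = l)) =
          (\<Sum>l'\<in>tup m M. \<Sum>u\<in>tup m N. t u * (of_bool (map f u = l') * of_bool (map ((!) l') g = l)))"
        by (simp only: Pmap_eq sum_distrib_right mult.assoc)
      also have "\<dots> = (\<Sum>u\<in>tup m N. \<Sum>l'\<in>tup m M. t u * (of_bool (map f u = l') * of_bool (map ((!) l') g = l)))"
        by (rule sum.swap)
      also have "\<dots> = (\<Sum>u\<in>tup m N. t u * of_bool (map ((!) (map f u)) g = l))"
      proof (rule sum.cong[OF refl])
        fix u assume u: "u \<in> tup m N"
        have "(\<Sum>l'\<in>tup m M. t u * (of_bool (map f u = l') * of_bool (map ((!) l') g = l))) =
          (\<Sum>l'\<in>tup m M. if l' = map f u then t u * of_bool (map ((!) (map f u)) g = l) else 0)"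
          by (intro sum.cong) auto
        then show "(\<Sum>l'\<in>tup m M. t u * (of_bool (map f u = l') * of_bool (map ((!) l') g = l))) =
          t u * of_bool (map ((!) (map f u)) g = l)" using map_tup[OF f u] by simp
      qed
      also have "\<dots> = (\<Sum>u\<in>tup m N. \<Sum>l1\<in>tup n N. t u * of_bool (map ((!) u) g = l1) * of_bool (map f l1 = l))"
      proof (rule sum.cong[OF refl])
        fix u assume u: "u \<in> tup m N"
        have "map f (map ((!) u) g) = map ((!) (map f u)) g"
          using g u by (auto simp: surj_lists_def tup_length)
        then have eq: "(\<Sum>l1\<in>tup n N. t u * of_bool (map ((!) u) g = l1) * of_bool (map f l1 = l)) =
          (\<Sum>l1\<in>tup n N. if l1 = map ((!) u) g then t u * of_bool (map ((!) (map f u)) g = l) else 0)"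
          by (intro sum.cong) auto
        show "t u * of_bool (map ((!) (map f u)) g = l) =
          (\<Sum>l1\<in>tup n N. t u * of_bool (map ((!) u) g = l1) * of_bool (map f l1 = l))"
          unfolding eq using map_nth_tup[OF u g] by simp
      qed
      also have "\<dots> = (\<Sum>l1\<in>tup n N. \<Sum>u\<in>tup m N. t u * of_bool (map ((!) u) g = l1) * of_bool (map f l1 = l))"
        by (rule sum.swap)
      finally show ?thesis by (simp only: sum_distrib_right)
    qed
    have "Phi m n c M (Pmap m N f t) l = (\<Sum>g\<in>surj_lists m n. c g *
        (\<Sum>l'\<in>tup m M. Pmap m N f t l' * of_bool (map ((!) l') g = l)))"
      using balanced_Pmap[OF f t] by (simp add: Phi_def)
    also have "\<dots> = (\<Sum>g\<in>surj_lists m n. \<Sum>l1\<in>tup n N.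
        c g * ((\<Sum>l'\<in>tup m N. t l' * of_bool (map ((!) l') g = l1)) * of_bool (map f l1 = l)))"
      unfolding sum_distrib_left[symmetric] by (intro sum.cong refl) (simp only: 1)
    also have "\<dots> = (\<Sum>l1\<in>tup n N. \<Sum>g\<in>surj_lists m n.
        c g * ((\<Sum>l'\<in>tup m N. t l' * of_bool (map ((!) l') g = l1)) * of_bool (map f l1 = l)))"
      by (rule sum.swap)
    also have "\<dots> = Pmap n N f (Phi m n c N t) l"
      unfolding Pmap_eq Phi_def if_P[OF t] by (simp only: sum_distrib_right mult.assoc)
    finally show "Phi m n c M (Pmap m N f t) l = Pmap n N f (Phi m n c N t) l" .
  qed
qed

text \<open>\<open>evec\<close> is supported on tuples with entry i or m + i at each place i. A
  surjection g reads all these entries, and those of g0 are below m, so only the identity tuple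
  contributes.\<close>

lemma Phi_evec:
  assumes g0: "g0 \<in> surj_lists m n"
  shows "Phi m n c (2 * m + 1) (evec m) g0 = (c g0 :: 'k::field_char_0)"
proof -
  let ?N = "2 * m + 1"
  have id: "[0..<m] \<in> tup m ?N" by (auto simp: tup_def)
  have e1: "evec m [0..<m] = (1::'k)" using id by (auto simp: dten_def ten_def intro!: prod.neutral)
  have *: "(\<Sum>l'\<in>tup m ?N. evec m l' * of_bool (map ((!) l') g = g0)) = (of_bool (g = g0) :: 'k)"
    if g: "g \<in> surj_lists m n" for g
  proof -
    have "evec m l' * of_bool (map ((!) l') g = g0) = (if l' = [0..<m] then of_bool (g = g0) else 0 :: 'k)"
      if l': "l' \<in> tup m ?N" for l'
    proof (cases "l' = [0..<m]")
      case True
      have "map ((!) [0..<m]) g = g" using g by (intro map_idI) (auto simp: surj_lists_def)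
      then show ?thesis using True e1 by simp
    next
      case False
      then obtain i where i: "i < m" "l' ! i \<noteq> i" using l' by (auto simp: list_eq_iff_nth_eq tup_length)
      have "evec m l' = (0::'k)" if eq: "map ((!) l') g = g0"
      proof -
        have "i \<in> set g" using g i by (simp add: surj_lists_def)
        then have "l' ! i \<in> set g0" using eq by auto
        then have "l' ! i < m" using g0 by (auto simp: surj_lists_def)
        then show ?thesis using i by (auto simp: dten_def ten_def intro!: prod_zero bexI[of _ i])
      qed
      then show ?thesis using False by auto
    qed
    then have "(\<Sum>l'\<in>tup m ?N. evec m l' * of_bool (map ((!) l') g = g0)) =
       (\<Sum>l'\<in>tup m ?N. if l' = [0..<m] then of_bool (g = g0) else 0 :: 'k)"
      by (intro sum.cong refl)
    then show ?thesis using id by simp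
  qed
  have "Phi m n c ?N (evec m) g0 = (\<Sum>g\<in>surj_lists m n. c g * of_bool (g = g0))"
    unfolding Phi_def if_P[OF balanced_evec] by (intro sum.cong refl) (simp only: *)
  also have "\<dots> = (\<Sum>g\<in>surj_lists m n. if g = g0 then c g else 0)"
    by (intro sum.cong) auto
  finally show ?thesis using g0 by simp
qed

subsection \<open>Natural transformations and cocycles of degree zero\<close>

lemma place_eq:
  assumes tau: "\<tau> permutes {..<n}" and "length l = n"
  shows "place n \<tau> t l = t (map (\<lambda>i. l ! inv \<tau> i) [0..<n])"
proof -
  have "{l'\<in>{l'. length l' = n}. map (\<lambda>i. l' ! \<tau> i) [0..<n] = l} = {map (\<lambda>i. l ! inv \<tau> i) [0..<n]}"
  proof (intro set_eqI iffI)
    fix l' assume "l' \<in> {l'\<in>{l'. length l' = n}. map (\<lambda>i. l' ! \<tau> i) [0..<n] = l}"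
    then have l': "length l' = n" and eq: "l = map (\<lambda>i. l' ! \<tau> i) [0..<n]" by auto
    have "inv \<tau> i < n" if "i < n" for i
      using permutes_in_image[OF permutes_inv[OF tau], of i] that by simp
    then have "l' = map (\<lambda>i. l ! inv \<tau> i) [0..<n]"
      using l' unfolding eq by (intro nth_equalityI) (auto simp: permutes_inverses[OF tau])
    then show "l' \<in> {map (\<lambda>i. l ! inv \<tau> i) [0..<n]}" by simp
  next
    fix l' assume "l' \<in> {map (\<lambda>i. l ! inv \<tau> i) [0..<n]}"
    moreover have "\<tau> i < n" if "i < n" for i using permutes_in_image[OF tau, of i] that by simp
    ultimately show "l' \<in> {l'\<in>{l'. length l' = n}. map (\<lambda>i. l' ! \<tau> i) [0..<n] = l}"
      using assms(2) by (auto simp: permutes_inverses[OF tau] intro!: nth_equalityI)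
  qed
  then show ?thesis by (simp add: place_def lin_ext_def)
qed

lemma place_length: "length l \<noteq> n \<Longrightarrow> place n \<tau> t l = 0"
  unfolding place_def lin_ext_def by (rule sum.neutral) auto

lemma place_dten:
  assumes sig: "\<sigma> permutes {..<m}"
  shows "place m \<sigma> (dten m N p q) = (dten m N (p \<circ> \<sigma>) (q \<circ> \<sigma>) :: nat list \<Rightarrow> 'k::field)"
proof
  fix l :: "nat list"
  let ?l = "map (\<lambda>i. l ! inv \<sigma> i) [0..<m]"
  have less: "inv \<sigma> i < m \<longleftrightarrow> i < m" "\<sigma> i < m \<longleftrightarrow> i < m" for i
    using permutes_in_image[OF permutes_inv[OF sig], of i] permutes_in_image[OF sig, of i] by auto
  show "place m \<sigma> (dten m N p q) l = (dten m N (p \<circ> \<sigma>) (q \<circ> \<sigma>) l :: 'k)"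
  proof (cases "length l = m")
    case True
    have "set ?l = (\<lambda>i. l ! i) ` inv \<sigma> ` {..<m}" by (auto simp: image_image)
    also have "inv \<sigma> ` {..<m} = {..<m}" by (rule permutes_image[OF permutes_inv[OF sig]])
    also have "(\<lambda>i. l ! i) ` {..<m} = set l" using True by (auto simp: set_conv_nth)
    finally have tup: "?l \<in> tup m N \<longleftrightarrow> l \<in> tup m N" using True by (simp add: tup_def)
    have "(\<Prod>i<m. of_bool (?l ! i = p i) - of_bool (?l ! i = q i)) =
        (\<Prod>i<m. of_bool (l ! inv \<sigma> i = p i) - of_bool (l ! inv \<sigma> i = q i) :: 'k)"
      by (intro prod.cong) auto
    also have "\<dots> = (\<Prod>i<m. of_bool (l ! i = p (\<sigma> i)) - of_bool (l ! i = q (\<sigma> i)))"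
      by (rule prod.reindex_bij_witness[of _ \<sigma> "inv \<sigma>"]) (auto simp: permutes_inverses[OF sig] less)
    finally show ?thesis by (simp add: place_eq[OF sig True] dten_def ten_def tup)
  qed (auto simp: place_length dten_def ten_def tup_def)
qed

text \<open>The coefficients of the image of \<open>evec\<close> at the surjections, which determine
  a natural transformation (\<open>t0_zero\<close>, \<open>natural_zero\<close>), placed in degree 0
  of the word complex.\<close>

definition psi :: "nat \<Rightarrow> nat \<Rightarrow> (nat \<times> (nat list \<Rightarrow> 'k::field) \<times> nat list \<Rightarrow> 'k) \<Rightarrow> word \<Rightarrow> 'k" where
  "psi m n h w = (if w \<in> words {..<m} n \<and> stars w = 0 then h (2 * m + 1, evec m, map the w) else 0)"

lemma starless_nth:
  assumes "w \<in> words {..<m} n" "stars w = 0" "i < n"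
  obtains a where "a < m" "w ! i = Some a"
proof -
  have "starset w = {}" using assms(2) card_starset[of w] by simp
  then have "w ! i \<noteq> None" using assms by (auto simp: starset_def words_def)
  then obtain a where a: "w ! i = Some a" by blast
  then have "Some a \<in> set w" using assms nth_mem[of i w] by (simp add: words_def)
  then have "a < m" using assms(1) by (auto simp: words_def letters_def)
  with a show ?thesis using that by blast
qed

lemma starless_surj:
  assumes "w \<in> words {..<m} n" "stars w = 0"
  shows "map the w \<in> surj_lists m n" "map Some (map the w) = w"
proof -
  have len: "length w = n" and L: "letters w = {..<m}" using assms(1) by (auto simp: words_def)
  show *: "map Some (map the w) = w"
  proof (rule nth_equalityI)
    fix i assume "i < length (map Some (map the w))"
    then have i: "i < n" using len by simp
    then obtain a where "w ! i = Some a" using starless_nth[OF assms] by blast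
    then show "map Some (map the w) ! i = w ! i" using i len by simp
  qed simp
  have "letters (map Some g) = set g" for g by (auto simp: letters_def)
  from this[of "map the w"] have "set (map the w) = {..<m}" unfolding * L by (rule sym)
  then show "map the w \<in> surj_lists m n" using len by (simp add: surj_lists_def)
qed

lemma surj_starless:
  assumes "g \<in> surj_lists m n"
  shows "map Some g \<in> words {..<m} n" "stars (map Some g) = 0" "map the (map Some g) = g"
proof -
  have "count_list (map Some xs) (None :: nat option) = 0" for xs :: "nat list" by (induction xs) auto
  then show "stars (map Some g) = 0" .
  have "letters (map Some g) = set g" by (auto simp: letters_def)
  then show "map Some g \<in> words {..<m} n" using assms by (simp add: words_def surj_lists_def)
  show "map the (map Some g) = g" by (simp add: map_idI)
qed

lemma dif_single:
  assumes "starset w = {i}"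
  shows "dif Y x w = (\<Sum>b\<in>Y. x (w[i := Some b]) :: 'k::field)"
proof -
  have e: "{j \<in> {i}. j < i} = {}" by auto
  have "repl b x w = x (w[i := Some b])" for b
    unfolding repl_eq_sum assms
    by (simp only: sum.insert finite.emptyI empty_iff not_False_eq_True sum.empty e card.empty power_0 mult_1 add_0_right)
  then show ?thesis by (simp add: dif_def)
qed

lemma letters_update_star:
  assumes "i < length w" "w ! i = None"
  shows "letters (w[i := Some b]) = insert b (letters w)"
proof (intro set_eqI iffI)
  fix a assume "a \<in> letters (w[i := Some b])"
  then show "a \<in> insert b (letters w)"
    using set_update_subset_insert[of w i "Some b"] by (auto simp: letters_def)
next
  fix a assume "a \<in> insert b (letters w)"
  then consider "a = b" | j where "j < length w" "w ! j = Some a"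
    by (auto simp: letters_def in_set_conv_nth)
  then show "a \<in> letters (w[i := Some b])"
  proof cases
    case 1
    then show ?thesis using assms by (simp add: letters_def set_update_memI)
  next
    case 2
    then have "j \<noteq> i" using assms by auto
    then have "w[i := Some b] ! j = Some a" using 2 by simp
    then show ?thesis using 2 unfolding letters_def by (metis length_list_update mem_Collect_eq nth_mem)
  qed
qed

lemma psi_cocycle:
  fixes \<phi> :: "nat \<Rightarrow> (nat list \<Rightarrow> 'k::field_char_0) \<Rightarrow> nat list \<Rightarrow> 'k"
  assumes nat: "natural m n \<phi>" and w: "w \<in> words {..<m} n"
  shows "dif {..<m} (psi m n (\<lambda>(N, t, l). \<phi> N t l)) w = 0"
proof (cases "stars w = 1")
  case True
  then obtain i where i: "starset w = {i}" using card_starset[of w] card_1_singletonE by metis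
  have len: "length w = n" and L: "letters w = {..<m}" using w by (auto simp: words_def)
  have iw: "i < n" "w ! i = None" using i len by (auto simp: starset_def)
  have other: "\<exists>a<m. w ! j = Some a" if "j < n" "j \<noteq> i" for j
  proof -
    have "w ! j \<noteq> None" using i that len by (auto simp: starset_def)
    then obtain a where a: "w ! j = Some a" by blast
    then have "Some a \<in> set w" using that len nth_mem[of j w] by simp
    then show ?thesis using L a by (auto simp: letters_def)
  qed
  show ?thesis
  proof (cases "m = 0")
    case False
    \<comment> \<open>A placeholder at the star, always overwritten by b; it is an admissible letter
      because m is positive here.\<close>
    define l where "l = (map the w)[i := 0]"
    have ll: "length l = n" using len by (simp add: l_def)
    have lj: "w ! j = Some (l ! j)" if "j < n" "j \<noteq> i" for j
      using other[OF that] that len by (auto simp: l_def)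
    have "psi m n (\<lambda>(N, t, l). \<phi> N t l) (w[i := Some b]) = \<phi> (2 * m + 1) (evec m) (l[i := b])" if "b < m" for b
    proof -
      have "w[i := Some b] ! j \<noteq> None" if "j < n" for j
        using other[OF that] that len by (cases "j = i") auto
      then have "starset (w[i := Some b]) = {}" using len by (auto simp: starset_def)
      then have "stars (w[i := Some b]) = 0" by (simp flip: card_starset)
      moreover have "w[i := Some b] \<in> words {..<m} n"
        using letters_update_star[of i w b] iw len L that by (auto simp: words_def)
      moreover have "map the (w[i := Some b]) = l[i := b]" by (simp add: l_def map_update)
      ultimately show ?thesis by (simp add: psi_def)
    qed
    then have "dif {..<m} (psi m n (\<lambda>(N, t, l). \<phi> N t l)) w = (\<Sum>b<m. \<phi> (2 * m + 1) (evec m) (l[i := b]))"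
      by (simp add: dif_single[OF i])
    also have "\<dots> = 0"
    proof (rule t0_cocycle[OF nat ll iw(1)])
      show "{..<m} \<subseteq> (!) l ` ({..<n} - {i})"
      proof
        fix a assume "a \<in> {..<m}"
        then have "Some a \<in> set w" using L by (auto simp: letters_def)
        then obtain j where j: "j < n" "w ! j = Some a" using len by (auto simp: in_set_conv_nth)
        then have "j \<noteq> i" using iw by auto
        then show "a \<in> (!) l ` ({..<n} - {i})" using j lj[of j] by (intro image_eqI[of _ _ j]) auto
      qed
      show "set l \<subseteq> {..<m}"
      proof
        fix a assume "a \<in> set l"
        then obtain j where j: "j < n" "a = l ! j" using ll by (auto simp: in_set_conv_nth)
        show "a \<in> {..<m}"
        proof (cases "j = i")
          case True
          then show ?thesis using j False len by (simp add: l_def)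
        next
          case ne: False
          then show ?thesis using other[OF j(1) ne] lj[OF j(1) ne] j by auto
        qed
      qed
    qed
    finally show ?thesis .
  qed (simp add: dif_def)
next
  case False
  have "dif {..<m} (psi m n (\<lambda>(N, t, l). \<phi> N t l)) w = dif {..<m} (\<lambda>_. 0) w"
    by (rule dif_cong[OF w]) (use False in \<open>simp add: psi_def\<close>)
  then show ?thesis by (simp add: dif_def)
qed

lemma psi_zero:
  fixes \<phi> :: "nat \<Rightarrow> (nat list \<Rightarrow> 'k::field_char_0) \<Rightarrow> nat list \<Rightarrow> 'k"
  assumes nat: "natural m n \<phi>" and 0: "\<And>w. w \<in> words {..<m} n \<Longrightarrow> psi m n (\<lambda>(N, t, l). \<phi> N t l) w = 0"
  shows "\<phi> N t l = 0"
proof -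
  have "\<phi> (2 * m + 1) (evec m) = 0"
  proof (rule t0_zero[OF nat])
    fix g assume "length g = n" "set g = {..<m}"
    then have g: "g \<in> surj_lists m n" by (simp add: surj_lists_def)
    then show "\<phi> (2 * m + 1) (evec m) g = 0"
      using 0[OF surj_starless(1)[OF g]] surj_starless[OF g] by (simp add: psi_def)
  qed
  from natural_zero[OF nat this] show ?thesis by simp
qed

text \<open>The condition that \<open>natural_Phi\<close> puts on the coefficients at (g, i) is the
  cocycle equation at the word g with a star at place i.\<close>

lemma psi_surjective:
  fixes k :: "word \<Rightarrow> 'k::field_char_0"
  assumes k: "\<And>w. w \<in> words {..<m} n \<and> stars w = 0 \<or> k w = 0"
    and dk: "\<And>w. w \<in> words {..<m} n \<Longrightarrow> dif {..<m} k w = 0"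
  shows "\<exists>h\<in>Hsp m n. psi m n h = k"
proof -
  define c where "c g = k (map Some g)" for g
  have nat: "natural m n (Phi m n c)"
  proof (rule natural_Phi)
    fix g i assume g: "length g = n" "i < n" "set g \<subseteq> {..<m}" "{..<m} \<subseteq> (!) g ` ({..<n} - {i})"
    define w where "w = (map Some g)[i := None]"
    have len: "length w = n" using g by (simp add: w_def)
    have "w ! j = None \<longleftrightarrow> j = i" if "j < n" for j
      using that g by (cases "j = i") (simp_all add: w_def)
    then have wi: "starset w = {i}" using len g(2) by (auto simp: starset_def)
    have "letters w = {..<m}"
    proof (intro set_eqI iffI)
      fix a assume "a \<in> letters w"
      then show "a \<in> {..<m}"
        using set_update_subset_insert[of "map Some g" i None] g(3) by (auto simp: letters_def w_def)
    next
      fix a assume "a \<in> {..<m}"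
      then obtain j where j: "j < n" "j \<noteq> i" "a = g ! j" using g(4) by auto
      then have "w ! j = Some a" using g by (simp add: w_def)
      then show "a \<in> letters w" using j len unfolding letters_def by (metis mem_Collect_eq nth_mem)
    qed
    then have "dif {..<m} k w = 0" using len by (intro dk) (simp add: words_def)
    then have "(\<Sum>b<m. k (w[i := Some b])) = 0" by (simp add: dif_single[OF wi])
    then show "(\<Sum>b<m. c (g[i := b])) = 0" by (simp add: c_def w_def map_update)
  qed
  have "psi m n (\<lambda>(N, t, l). Phi m n c N t l) w = k w" for w
  proof (cases "w \<in> words {..<m} n \<and> stars w = 0")
    case True
    then show ?thesis
      using starless_surj[of w m n] Phi_evec[of "map the w" m n c] by (simp add: psi_def c_def)
  next
    case False
    then show ?thesis using k[of w] by (auto simp: psi_def)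
  qed
  then show ?thesis using nat unfolding Hsp_def by blast
qed

lemma merge_inverse:
  assumes "\<And>i. i < m \<Longrightarrow> \<sigma> i < m" "\<And>i. i < m \<Longrightarrow> \<sigma>' (\<sigma> i) = i" "x < 2 * m + 1"
  shows "merge m \<sigma>' (\<lambda>i. m + \<sigma>' i) (2 * m) (merge m \<sigma> (\<lambda>i. m + \<sigma> i) (2 * m) x) = x"
proof -
  consider "x < m" | "m \<le> x" "x < 2 * m" | "x = 2 * m" using assms(3) by linarith
  then show ?thesis
  proof cases
    case 2
    then have "x - m < m" by simp
    then show ?thesis using 2 assms(1,2)[of "x - m"] by (simp add: merge_def)
  qed (use assms(1,2)[of x] in \<open>simp_all add: merge_def\<close>)
qed

lemma merge_less:
  assumes "\<And>i. i < m \<Longrightarrow> \<sigma> i < m" "x < 2 * m + 1"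
  shows "merge m \<sigma> (\<lambda>i. m + \<sigma> i) (2 * m) x < 2 * m + 1"
proof -
  consider "x < m" | "m \<le> x" "x < 2 * m" | "x = 2 * m" using assms(2) by linarith
  then show ?thesis
  proof cases
    case 2
    then have "x - m < m" by simp
    then show ?thesis using 2 assms(1)[of "x - m"] by (simp add: merge_def)
  qed (use assms(1)[of x] in \<open>simp_all add: merge_def\<close>)
qed

text \<open>Permuting the factors of \<open>evec\<close> by \<open>\<sigma>\<close> amounts to
  permuting the points, by \<open>\<sigma>\<close> on both blocks. Naturality carries this to the
  target, where it renames letters by the inverse. There is no sign, as there are no stars.\<close>

lemma psi_wact:
  fixes \<phi> :: "nat \<Rightarrow> (nat list \<Rightarrow> 'k::field_char_0) \<Rightarrow> nat list \<Rightarrow> 'k"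
  assumes nat: "natural m n \<phi>" and sig: "\<sigma> permutes {..<m}" and tau: "\<tau> permutes {..<n}"
    and w: "w \<in> words {..<m} n"
  shows "psi m n (actH m n \<sigma> \<tau> (\<lambda>(N, t, l). \<phi> N t l)) w = wact \<sigma> \<tau> (psi m n (\<lambda>(N, t, l). \<phi> N t l)) w"
proof (cases "stars w = 0")
  case True
  let ?N = "2 * m + 1" and ?h = "\<lambda>(N, t, l). \<phi> N t l"
  have len: "length w = n" using w by (simp add: words_def)
  let ?l = "map (\<lambda>i. map the w ! inv \<tau> i) [0..<n]" and ?g = "merge m (inv \<sigma>) (\<lambda>i. m + inv \<sigma> i) (2 * m)"
    and ?f = "merge m \<sigma> (\<lambda>i. m + \<sigma> i) (2 * m)"
  have slt: "\<sigma> i < m" if "i < m" for i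
    using sig_less[OF sig tau, of i] that by auto
  have it: "inv \<tau> i < n" if "i < n" for i using inv_tau_less[OF sig tau] that by simp
  have l: "map the w ! inv \<tau> i < m" "w ! inv \<tau> i = Some (map the w ! inv \<tau> i)" if i: "i < n" for i
  proof -
    obtain a where "a < m" "w ! inv \<tau> i = Some a" using starless_nth[OF w True it[OF i]] by blast
    then show "map the w ! inv \<tau> i < m" "w ! inv \<tau> i = Some (map the w ! inv \<tau> i)"
      using it[OF i] len by simp_all
  qed
  have ltup: "?l \<in> tup n ?N" using l(1) by (fastforce simp: tup_def)
  have "psi m n (actH m n \<sigma> \<tau> ?h) w = place n \<tau> (\<phi> ?N (place m \<sigma> (evec m))) (map the w)"
    using w True by (simp add: psi_def actH_def)
  also have "\<dots> = \<phi> ?N (place m \<sigma> (evec m)) ?l"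
    using len by (intro place_eq[OF tau]) simp
  also have "place m \<sigma> (evec m) = dten m ?N (\<lambda>i. \<sigma> i) (\<lambda>i. m + \<sigma> i)"
    by (simp add: place_dten[OF sig] o_def)
  also have "\<phi> ?N (dten m ?N (\<lambda>i. \<sigma> i) (\<lambda>i. m + \<sigma> i)) = Pmap n ?N ?f (\<phi> ?N (evec m))"
  proof (rule natural_dten[OF nat])
    show "\<sigma> i < ?N" "m + \<sigma> i < ?N" if "i < m" for i using slt[OF that] by linarith+
  qed simp
  also have "Pmap n ?N ?f (\<phi> ?N (evec m)) ?l = \<phi> ?N (evec m) (map ?g ?l)"
  proof (rule Pmap_perm[OF _ _ ltup])
    have 1: "?g (?f x) = x" if "x < ?N" for x
      by (rule merge_inverse[OF _ _ that]) (simp_all add: sig_less[OF sig tau] inv_sig_sig[OF sig tau])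
    have 2: "?f (?g x) = x" if "x < ?N" for x
      by (rule merge_inverse[OF _ _ that]) (simp_all add: inv_sig_less[OF sig tau] inv_sig_sig[OF sig tau])
    show "?f x = y \<longleftrightarrow> x = ?g y" if "x < ?N" "y < ?N" for x y
    proof
      assume "?f x = y"
      then show "x = ?g y" using 1[OF that(1)] by (simp only:)
    next
      assume "x = ?g y"
      then show "?f x = y" using 2[OF that(2)] by (simp only:)
    qed
    show "?g y < ?N" if "y < ?N" for y
      by (rule merge_less[OF _ that]) (simp add: inv_sig_less[OF sig tau])
  qed
  also have "map ?g ?l = map the (pull \<sigma> \<tau> w)"
  proof (rule nth_equalityI)
    fix i assume "i < length (map ?g ?l)"
    then have i: "i < n" by simp
    have "map ?g ?l ! i = inv \<sigma> (map the w ! inv \<tau> i)" using l(1)[OF i] i by (simp add: merge_def)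
    also have "\<dots> = map the (pull \<sigma> \<tau> w) ! i"
      using i l(2)[OF i] len by (simp add: pull_def)
    finally show "map ?g ?l ! i = map the (pull \<sigma> \<tau> w) ! i" .
  qed (simp add: len)
  finally have 1: "psi m n (actH m n \<sigma> \<tau> ?h) w = \<phi> ?N (evec m) (map the (pull \<sigma> \<tau> w))" .
  have "starset w = {}" using True card_starset[of w] by simp
  then have "ordsign \<tau> (starset w) = (1::'k)"
    by (intro ordsign_increasing) auto
  moreover have "psi m n ?h (pull \<sigma> \<tau> w) = \<phi> ?N (evec m) (map the (pull \<sigma> \<tau> w))"
    using pull_in_words[OF sig tau w] stars_pull[OF sig tau len] True by (simp add: psi_def)
  ultimately show ?thesis unfolding 1 wact_def by (simp only: mult_1)
next
  case False
  moreover have "stars (pull \<sigma> \<tau> w) = stars w" using w by (intro stars_pull[OF sig tau]) (simp add: words_def)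
  ultimately show ?thesis by (simp add: psi_def wact_def)
qed

lemma natural_diff:
  fixes \<phi> \<phi>' :: "nat \<Rightarrow> (nat list \<Rightarrow> 'k::field_char_0) \<Rightarrow> nat list \<Rightarrow> 'k"
  assumes nat: "natural m n \<phi>" "natural m n \<phi>'"
  shows "natural m n (\<lambda>N t. \<phi> N t - \<phi>' N t)"
proof -
  have bal: "balanced n N (s - t)" if "balanced n N s" "balanced n N t" for N and s t :: "nat list \<Rightarrow> 'k"
    using balanced_add[OF that(1) balanced_sc[OF that(2), of "-1"]] by (simp add: sc_def fun_diff_def plus_fun_def)
  have Pm: "Pmap n N f (s - t) = Pmap n N f s - Pmap n N f t" for N f and s t :: "nat list \<Rightarrow> 'k"
    by (simp add: fun_eq_iff Pmap_eq left_diff_distrib sum_subtractf)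
  have sc: "sc c (s - t) = sc c s - sc c t" for c and s t :: "nat list \<Rightarrow> 'k"
    by (simp add: fun_eq_iff sc_def right_diff_distrib)
  show ?thesis
    unfolding natural_def lin_on_def Pbt_eq
    by (intro conjI allI impI ballI)
      (simp_all add: Pbt_eq natural_add[OF nat(1)] natural_add[OF nat(2)] natural_sc[OF nat(1)] natural_sc[OF nat(2)]
        natural_out[OF nat(1)] natural_out[OF nat(2)] natural_Pmap[OF nat(1)] natural_Pmap[OF nat(2)]
        bal natural_in[OF nat(1)] natural_in[OF nat(2)] Pm sc)
qed

subsection \<open>Labels and words\<close>

definition lab :: "nat \<Rightarrow> word \<Rightarrow> nat set \<times> (nat \<Rightarrow> nat)" where
  "lab n w = (starset w, restrict (\<lambda>i. the (w ! i)) ({..<n} - starset w))"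

definition unlab :: "nat \<Rightarrow> nat set \<times> (nat \<Rightarrow> nat) \<Rightarrow> word" where
  "unlab n L = map (\<lambda>i. if i \<in> fst L then None else Some (snd L i)) [0..<n]"

lemma length_unlab [simp]: "length (unlab n L) = n"
  by (simp add: unlab_def)

lemma unlab_nth: "i < n \<Longrightarrow> unlab n (S, f) ! i = (if i \<in> S then None else Some (f i))"
  by (simp add: unlab_def)

lemma unlab_labA:
  assumes "L \<in> labA m n par"
  shows "unlab n L \<in> words {..<m} n" "par (stars (unlab n L))" "lab n (unlab n L) = L"
proof -
  obtain S f where L: "L = (S, f)" "S \<subseteq> {..<n}" "par (card S)" "f \<in> ({..<n} - S) \<rightarrow>\<^sub>E {..<m}" "f ` ({..<n} - S) = {..<m}"
    using assms unfolding labA_def by blast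
  have st: "starset (unlab n L) = S"
    using L(2) by (auto simp: starset_def L(1) unlab_nth split: if_splits)
  have "Some a \<in> set (unlab n L) \<longleftrightarrow> a \<in> f ` ({..<n} - S)" for a
    by (auto simp: unlab_def L(1) split: if_splits)
  then show "unlab n L \<in> words {..<m} n" by (auto simp: words_def letters_def L(5))
  show "par (stars (unlab n L))" using L(3) by (simp flip: card_starset add: st)
  have "restrict (\<lambda>i. the (unlab n L ! i)) ({..<n} - S) = f"
  proof
    fix i show "restrict (\<lambda>i. the (unlab n L ! i)) ({..<n} - S) i = f i"
      using L(4) by (cases "i \<in> {..<n} - S") (auto simp: L(1) unlab_nth PiE_def extensional_def)
  qed
  then show "lab n (unlab n L) = L" unfolding lab_def st by (simp only: L(1))
qed

lemma lab_words:
  assumes "w \<in> words {..<m} n"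
  shows "par (stars w) \<Longrightarrow> lab n w \<in> labA m n par" "unlab n (lab n w) = w"
proof -
  have len: "length w = n" and L: "letters w = {..<m}" using assms by (auto simp: words_def)
  have nth: "w ! i = Some (the (w ! i))" if "i < n" "i \<notin> starset w" for i
    using that len by (auto simp: starset_def)
  have "(\<lambda>i. the (w ! i)) ` ({..<n} - starset w) = letters w"
  proof (intro set_eqI iffI)
    fix a assume "a \<in> (\<lambda>i. the (w ! i)) ` ({..<n} - starset w)"
    then obtain i where "i < n" "w ! i = Some a" using nth by fastforce
    then show "a \<in> letters w" using nth_mem[of i w] len by (simp add: letters_def)
  next
    fix a assume "a \<in> letters w"
    then obtain i where "i < n" "w ! i = Some a" using len by (auto simp: letters_def in_set_conv_nth)
    then show "a \<in> (\<lambda>i. the (w ! i)) ` ({..<n} - starset w)"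
      by (intro image_eqI[of _ _ i]) (auto simp: starset_def)
  qed
  then have img: "restrict (\<lambda>i. the (w ! i)) ({..<n} - starset w) ` ({..<n} - starset w) = {..<m}"
    unfolding L[symmetric] by (metis (no_types, lifting) image_cong restrict_apply')
  show "lab n w \<in> labA m n par" if "par (stars w)"
  proof -
    have "starset w \<subseteq> {..<n}" using len by (auto simp: starset_def)
    moreover have "restrict (\<lambda>i. the (w ! i)) ({..<n} - starset w) \<in> ({..<n} - starset w) \<rightarrow>\<^sub>E {..<m}"
    proof (rule PiE_I)
      fix i assume "i \<in> {..<n} - starset w"
      then have "restrict (\<lambda>i. the (w ! i)) ({..<n} - starset w) i \<in>
          restrict (\<lambda>i. the (w ! i)) ({..<n} - starset w) ` ({..<n} - starset w)" by (rule imageI)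
      then show "restrict (\<lambda>i. the (w ! i)) ({..<n} - starset w) i \<in> {..<m}" unfolding img .
    qed (simp only: restrict_apply if_False)
    ultimately show ?thesis using that img by (simp add: labA_def lab_def card_starset)
  qed
  show "unlab n (lab n w) = w"
  proof (rule nth_equalityI)
    fix i assume "i < length (unlab n (lab n w))"
    then have i: "i < n" by simp
    show "unlab n (lab n w) ! i = w ! i"
    proof (cases "i \<in> starset w")
      case True
      then show ?thesis using i by (simp add: lab_def unlab_nth) (simp add: starset_def)
    next
      case False
      then show ?thesis using i nth[OF i False] by (simp add: lab_def unlab_nth)
    qed
  qed (simp add: len)
qed

definition to_word :: "nat \<Rightarrow> nat \<Rightarrow> (nat \<Rightarrow> bool) \<Rightarrow> (nat set \<times> (nat \<Rightarrow> nat) \<Rightarrow> 'k::field) \<Rightarrow> word \<Rightarrow> 'k" where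
  "to_word m n par g w = (if w \<in> words {..<m} n \<and> par (stars w) then g (lab n w) else 0)"

definition of_word :: "nat \<Rightarrow> nat \<Rightarrow> (nat \<Rightarrow> bool) \<Rightarrow> (word \<Rightarrow> 'k::field) \<Rightarrow> nat set \<times> (nat \<Rightarrow> nat) \<Rightarrow> 'k" where
  "of_word m n par x L = (if L \<in> labA m n par then x (unlab n L) else 0)"

lemma to_word_of_word:
  "to_word m n par (of_word m n par x) w = (if w \<in> words {..<m} n \<and> par (stars w) then x w else 0)"
  using lab_words(1)[where par = par] lab_words(2) by (auto simp: to_word_def of_word_def)

lemma of_word_in_Asp: "of_word m n par x \<in> Asp m n par"
  by (simp add: Asp_def of_word_def)

lemma Asp_outside: "g \<in> Asp m n par \<Longrightarrow> L \<notin> labA m n par \<Longrightarrow> g L = 0"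
  unfolding Asp_def by blast

lemma to_word_unlab: "L \<in> labA m n par \<Longrightarrow> to_word m n par g (unlab n L) = g L"
  using unlab_labA[of L m n par] by (simp add: to_word_def)

text \<open>The map of labels is a bijection whose inverse on words is \<open>pull\<close>, so each
  fibre in \<open>lin_ext\<close> is a single label.\<close>

lemma actA_eq:
  assumes sig: "\<sigma> permutes {..<m}" and tau: "\<tau> permutes {..<n}"
  shows "actA m n par \<sigma> \<tau> g = of_word m n par (wact \<sigma> \<tau> (to_word m n par g :: word \<Rightarrow> 'k::field))"
proof
  fix L :: "nat set \<times> (nat \<Rightarrow> nat)"
  let ?T = "\<lambda>(S, f). (inv \<tau> ` S, restrict (\<sigma> \<circ> f \<circ> \<tau>) ({..<n} - inv \<tau> ` S))"
  let ?c = "\<lambda>(S, f). ordsign \<tau> (inv \<tau> ` S) :: 'k"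
  have tl: "\<tau> i < n" if "i < n" for i using tau_less[OF sig tau] that by simp
  have inv_img: "inv \<tau> ` \<tau> ` S = S" for S
    by (simp add: image_image inv_tau_tau[OF sig tau])
  have T: "?T (lab n (pull \<sigma> \<tau> w)) = lab n w" "?c (lab n (pull \<sigma> \<tau> w)) = ordsign \<tau> (starset w)"
    if w: "w \<in> words {..<m} n" for w
  proof -
    have len: "length w = n" using w by (simp add: words_def)
    have st: "starset (pull \<sigma> \<tau> w) = \<tau> ` starset w" by (rule starset_pull[OF sig tau len])
    show "?c (lab n (pull \<sigma> \<tau> w)) = ordsign \<tau> (starset w)"
      by (simp add: lab_def st inv_img)
    have "restrict (\<sigma> \<circ> restrict (\<lambda>i. the (pull \<sigma> \<tau> w ! i)) ({..<n} - \<tau> ` starset w) \<circ> \<tau>) ({..<n} - starset w) =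
      restrict (\<lambda>i. the (w ! i)) ({..<n} - starset w)"
    proof (rule restrict_ext)
      fix i assume i: "i \<in> {..<n} - starset w"
      then have "w ! i \<noteq> None" using len by (auto simp: starset_def)
      then obtain a where a: "w ! i = Some a" by blast
      have "\<tau> i \<notin> \<tau> ` starset w" using i inj_tau[OF sig tau, of UNIV] by (auto dest: injD)
      then have "(\<sigma> \<circ> restrict (\<lambda>i. the (pull \<sigma> \<tau> w ! i)) ({..<n} - \<tau> ` starset w) \<circ> \<tau>) i = \<sigma> (the (pull \<sigma> \<tau> w ! \<tau> i))"
        using i tl by simp
      also have "pull \<sigma> \<tau> w ! \<tau> i = Some (inv \<sigma> a)"
        using i tl len a by (simp add: pull_def inv_tau_tau[OF sig tau])
      finally show "(\<sigma> \<circ> restrict (\<lambda>i. the (pull \<sigma> \<tau> w ! i)) ({..<n} - \<tau> ` starset w) \<circ> \<tau>) i = the (w ! i)"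
        using a by (simp add: inv_sig_sig[OF sig tau])
    qed
    then show "?T (lab n (pull \<sigma> \<tau> w)) = lab n w"
      by (simp add: lab_def st inv_img)
  qed
  have ex: "\<exists>w. w \<in> words {..<m} n \<and> par (stars w) \<and> x = lab n (pull \<sigma> \<tau> w)" if x: "x \<in> labA m n par" for x
  proof -
    let ?v = "unlab n x"
    have v: "?v \<in> words {..<m} n" "par (stars ?v)" "lab n ?v = x" using unlab_labA[OF x] by auto
    obtain w where w: "w \<in> words {..<m} n" "pull \<sigma> \<tau> w = ?v"
      using pull_bij[OF sig tau] v(1) unfolding bij_betw_def by (metis imageE)
    then have "stars w = stars ?v" using stars_pull[OF sig tau, of w] by (simp add: words_def)
    then show ?thesis using w v by metis
  qed
  show "actA m n par \<sigma> \<tau> g L = of_word m n par (wact \<sigma> \<tau> (to_word m n par g)) L"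
  proof (cases "L \<in> labA m n par")
    case True
    let ?w = "unlab n L"
    have w: "?w \<in> words {..<m} n" "par (stars ?w)" "lab n ?w = L" using unlab_labA[OF True] by auto
    have pw: "pull \<sigma> \<tau> ?w \<in> words {..<m} n" "par (stars (pull \<sigma> \<tau> ?w))"
      using pull_in_words[OF sig tau w(1)] stars_pull[OF sig tau, of ?w] w(2) by auto
    have e: "{x \<in> labA m n par. ?T x = L} = {lab n (pull \<sigma> \<tau> ?w)}"
    proof (intro set_eqI iffI)
      fix x assume "x \<in> {x \<in> labA m n par. ?T x = L}"
      then have x: "x \<in> labA m n par" "?T x = L" by auto
      obtain u where u: "u \<in> words {..<m} n" "x = lab n (pull \<sigma> \<tau> u)" using ex[OF x(1)] by blast
      have "lab n u = L" using T(1)[OF u(1)] x(2) u(2) by simp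
      then have "u = ?w" using lab_words(2)[OF u(1)] by simp
      then show "x \<in> {lab n (pull \<sigma> \<tau> ?w)}" using u by simp
    next
      fix x assume "x \<in> {lab n (pull \<sigma> \<tau> ?w)}"
      then show "x \<in> {x \<in> labA m n par. ?T x = L}"
        using T(1)[OF w(1)] lab_words(1)[where par = par, OF pw] w(3) by simp
    qed
    have "actA m n par \<sigma> \<tau> g L = ?c (lab n (pull \<sigma> \<tau> ?w)) * g (lab n (pull \<sigma> \<tau> ?w))"
      unfolding actA_def lin_ext_def e by simp
    also have "\<dots> = wact \<sigma> \<tau> (to_word m n par g) ?w"
      using T(2)[OF w(1)] pw by (simp add: wact_def to_word_def)
    finally show ?thesis using True by (simp add: of_word_def)
  next
    case False
    have e: "{x \<in> labA m n par. ?T x = L} = {}"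
    proof (rule ccontr)
      assume "{x \<in> labA m n par. ?T x = L} \<noteq> {}"
      then obtain x where x: "x \<in> labA m n par" "?T x = L" by blast
      obtain u where u: "u \<in> words {..<m} n" "par (stars u)" "x = lab n (pull \<sigma> \<tau> u)" using ex[OF x(1)] by blast
      have "lab n u = L" using T(1)[OF u(1)] x(2) u(3) by simp
      then show False using lab_words(1)[where par = par, OF u(1,2)] False by simp
    qed
    show ?thesis using False unfolding actA_def lin_ext_def e by (simp add: of_word_def)
  qed
qed

lemma to_word_actA:
  assumes sig: "\<sigma> permutes {..<m}" and tau: "\<tau> permutes {..<n}" and w: "w \<in> words {..<m} n"
  shows "to_word m n par (actA m n par \<sigma> \<tau> g) w = wact \<sigma> \<tau> (to_word m n par g :: word \<Rightarrow> 'k::field) w"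
proof (cases "par (stars w)")
  case False
  have "stars (pull \<sigma> \<tau> w) = stars w" using w by (intro stars_pull[OF sig tau]) (simp add: words_def)
  then show ?thesis using False by (simp add: to_word_def wact_def)
qed (use w in \<open>simp add: actA_eq[OF sig tau] to_word_of_word\<close>)

section \<open>Direct sums and the equivariant isomorphism\<close>

lemma dsum_iff: "v \<in> dsum V W \<longleftrightarrow> v \<circ> Inl \<in> V \<and> v \<circ> Inr \<in> W"
proof
  assume "v \<in> dsum V W"
  then show "v \<circ> Inl \<in> V \<and> v \<circ> Inr \<in> W" by (auto simp: dsum_def o_def)
next
  assume "v \<circ> Inl \<in> V \<and> v \<circ> Inr \<in> W"
  moreover have "v = (\<lambda>x. case x of Inl a \<Rightarrow> (v \<circ> Inl) a | Inr b \<Rightarrow> (v \<circ> Inr) b)"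
    by (auto split: sum.split)
  ultimately show "v \<in> dsum V W" unfolding dsum_def by blast
qed

lemma Bsp_iff: "b \<in> Bsp P \<longleftrightarrow> (\<not> P \<longrightarrow> b () = 0)"
  by (auto simp: Bsp_def fun_eq_iff)

lemma hodge_words_cong:
  "(\<And>v. v \<in> words {..<m} n \<Longrightarrow> x v = y v) \<Longrightarrow> hodge m n x w = (hodge m n y w :: 'k::field)"
  by (rule hodge_cong)

text \<open>The equality of classes is read at each (m, n). In characteristic zero,
  finite-dimensional representations of a finite group are semisimple, so equal classes mean
  isomorphic representations, once the negative terms have been moved to the other side. Of the sum
  over k and t only k = m + 1, t = n - m - 1 lives at (m, n), and it exists for m < n. Its sign is
  decided by the parity of t, that of a term of S(0) by the parity of the number of stars.\<close>

theorem mainTheorem20: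
  fixes m n :: nat
  shows "rep_iso m n
     (dsum (dsum (Hsp m n :: ((nat \<times> (nat list \<Rightarrow> 'k::field_char_0) \<times> nat list) \<Rightarrow> 'k) set)
                 (Asp m n odd)) (Bsp (m < n \<and> odd (n - m - 1))))
     (dact (dact (actH m n) (actA m n odd)) actB)
     (dsum (Asp m n even) (Bsp (m < n \<and> even (n - m - 1))))
     (dact (actA m n even) actB)"
proof -
  let ?H = "Hsp m n :: ((nat \<times> (nat list \<Rightarrow> 'k) \<times> nat list) \<Rightarrow> 'k) set"
  let ?W = "words {..<m} n" and ?e = "top_sgn {..<m} :: word \<Rightarrow> 'k"
  let ?Po = "m < n \<and> odd (n - m - 1)" and ?Pe = "m < n \<and> even (n - m - 1)"
  let ?D = "dsum (dsum ?H (Asp m n odd)) (Bsp ?Po)" and ?C = "dsum (Asp m n even) (Bsp ?Pe)"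
  let ?tw = "to_word m n odd :: _ \<Rightarrow> word \<Rightarrow> 'k"
  define x :: "(_ \<Rightarrow> 'k) \<Rightarrow> word \<Rightarrow> 'k" where
    "x v w = psi m n (v \<circ> Inl \<circ> Inl) w + hodge m n (?tw (v \<circ> Inl \<circ> Inr)) w + v (Inr ()) * ?e w" for v w
  \<comment> \<open>The extra coordinate is there when n - m is odd: then \<open>top_sgn\<close>
    lies in the odd part, where \<open>hodge\<close> loses it and \<open>top_sum\<close> detects
    it.\<close>
  define F :: "(_ \<Rightarrow> 'k) \<Rightarrow> _ + unit \<Rightarrow> 'k" where
    "F v = (\<lambda>y. case y of Inl L \<Rightarrow> of_word m n even (x v) L
       | Inr u \<Rightarrow> if ?Pe then top_sum {..<m} n (?tw (v \<circ> Inl \<circ> Inr)) else 0)" for v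
  have tw_add: "?tw (\<lambda>u. g u + h u) = (\<lambda>w. ?tw g w + ?tw h w)" and tw_sc: "?tw (\<lambda>u. c * g u) = (\<lambda>w. c * ?tw g w)" for g h c
    by (simp_all add: to_word_def fun_eq_iff)
  have psi_add: "psi m n (\<lambda>u. g u + h u) w = psi m n g w + psi m n h w" and psi_sc: "psi m n (\<lambda>u. c * g u) w = c * psi m n g w" for g h :: "_ \<Rightarrow> 'k" and c w
    by (simp_all add: psi_def)
  have x_add: "x (u + v) = (\<lambda>w. x u w + x v w)" for u v
    by (simp add: x_def fun_eq_iff o_def psi_add tw_add hodge_add algebra_simps)
  have x_sc: "x (sc c u) = (\<lambda>w. c * x u w)" for c u
    by (simp add: x_def fun_eq_iff o_def sc_def psi_sc tw_sc hodge_scale algebra_simps)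
  have lin: "lin_on ?D F"
    unfolding lin_on_def
  proof (intro conjI allI ballI)
    fix u v show "F (u + v) = F u + F v"
      by (auto simp: F_def fun_eq_iff of_word_def x_add o_def tw_add top_sum_add split: sum.split)
  next
    fix c and u :: "((nat \<times> (nat list \<Rightarrow> 'k) \<times> nat list) + (nat set \<times> (nat \<Rightarrow> nat))) + unit \<Rightarrow> 'k"
    have cI: "sc c u \<circ> Inl \<circ> Inr = (\<lambda>p. c * (u \<circ> Inl \<circ> Inr) p)" by (simp add: sc_def fun_eq_iff)
    have cJ: "?tw (sc c u \<circ> Inl \<circ> Inr) = (\<lambda>w. c * ?tw (u \<circ> Inl \<circ> Inr) w)"
      unfolding cI by (rule tw_sc)
    have "F (sc c u) y = c * F u y" for y
    proof (cases y)
      case (Inr z)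
      show ?thesis
        unfolding Inr F_def sum.case cJ top_sum_scale by (cases ?Pe) (simp_all only: if_True if_False mult_zero_right simp_thms)
    qed (simp add: F_def x_sc of_word_def)
    then show "F (sc c u) = sc c (F u)" unfolding sc_def[of c "F u"] by (rule ext)
  qed
  have F_Inl: "F v (Inl L) = of_word m n even (x v) L" for v L
    by (simp only: F_def sum.case)
  have F_Inr: "?Pe \<Longrightarrow> F v (Inr z) = top_sum {..<m} n (?tw (v \<circ> Inl \<circ> Inr))" "\<not> ?Pe \<Longrightarrow> F v (Inr z) = 0" for v z
    unfolding F_def sum.case by (rule if_P if_not_P, assumption)+
  have into: "F v \<in> ?C" for v
  proof -
    have "F v \<circ> Inl = of_word m n even (x v)" by (simp add: fun_eq_iff F_Inl)
    then show ?thesis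
      unfolding dsum_iff Bsp_iff o_apply using of_word_in_Asp F_Inr(2)[of v "()"] by metis
  qed
  have inj: "inj_on F ?D"
  proof (rule inj_onI)
    fix u v assume u: "u \<in> ?D" and v: "v \<in> ?D" and eq: "F u = F v"
    obtain \<phi> where \<phi>: "natural m n \<phi>" "u \<circ> Inl \<circ> Inl = (\<lambda>(N, t, l). \<phi> N t l)"
      using u by (auto simp: dsum_iff Hsp_def o_assoc)
    obtain \<phi>' where \<phi>': "natural m n \<phi>'" "v \<circ> Inl \<circ> Inl = (\<lambda>(N, t, l). \<phi>' N t l)"
      using v by (auto simp: dsum_iff Hsp_def o_assoc)
    define k where "k w = psi m n (u \<circ> Inl \<circ> Inl) w - psi m n (v \<circ> Inl \<circ> Inl) w" for w
    define a where "a w = ?tw (u \<circ> Inl \<circ> Inr) w - ?tw (v \<circ> Inl \<circ> Inr) w" for w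
    define b where "b = u (Inr ()) - v (Inr ())"
    have "b = 0 \<and> (\<forall>w\<in>?W. a w = 0 \<and> k w = 0)"
    proof (rule words_injective)
      show "k w = 0" if "stars w \<noteq> 0" for w using that by (simp add: k_def psi_def)
      show "dif {..<m} k w = 0" if "w \<in> ?W" for w
        using psi_cocycle[OF \<phi>(1) that] psi_cocycle[OF \<phi>'(1) that]
        by (simp add: k_def[abs_def] dif_diff \<phi> \<phi>')
      show "a w = 0" if "even (stars w)" for w using that by (simp add: a_def to_word_def)
      show "b = 0" if "\<not> ?Po" using that u v by (simp add: b_def dsum_iff Bsp_iff)
      show "top_sum {..<m} n a = 0" if "?Pe"
        using fun_cong[OF eq, of "Inr ()"] unfolding F_Inr(1)[OF that] a_def[abs_def] top_sum_diff by simp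
      show "k w + hodge m n a w + b * ?e w = 0" if "w \<in> ?W" "even (stars w)" for w
      proof -
        have "x u w = x v w"
          using fun_cong[OF eq, of "Inl (lab n w)"] lab_words(1)[where par = even, OF that] lab_words(2)[OF that(1)] that(2) by (simp add: F_Inl of_word_def)
        then show ?thesis by (simp add: x_def k_def a_def[abs_def] b_def hodge_diff algebra_simps)
      qed
    qed
    then have b: "b = 0" and a: "\<And>w. w \<in> ?W \<Longrightarrow> a w = 0" and k: "\<And>w. w \<in> ?W \<Longrightarrow> k w = 0" by auto
    have "\<phi> N t l - \<phi>' N t l = 0" for N t l
    proof -
      have "(\<lambda>N t. \<phi> N t - \<phi>' N t) N t l = 0"
      proof (rule psi_zero[OF natural_diff[OF \<phi>(1) \<phi>'(1)]])
        fix w assume "w \<in> ?W"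
        from k[OF this] show "psi m n (\<lambda>(N, t, l). (\<phi> N t - \<phi>' N t) l) w = 0"
          by (auto simp: k_def \<phi>(2) \<phi>'(2) psi_def split: if_splits)
      qed
      then show ?thesis by simp
    qed
    then have h_eq: "u (Inl (Inl p)) = v (Inl (Inl p))" for p
      using fun_cong[OF \<phi>(2), of p] fun_cong[OF \<phi>'(2), of p] by (cases p) simp
    have a_eq: "u (Inl (Inr L)) = v (Inl (Inr L))" for L
    proof (cases "L \<in> labA m n odd")
      case True
      then show ?thesis
        using a[OF unlab_labA(1)[OF True]] to_word_unlab[OF True, of "u \<circ> Inl \<circ> Inr"] to_word_unlab[OF True, of "v \<circ> Inl \<circ> Inr"]
        by (simp add: a_def)
    next
      case False
      then have "(u \<circ> Inl \<circ> Inr) L = 0" "(v \<circ> Inl \<circ> Inr) L = 0"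
        using u v unfolding dsum_iff by (blast intro: Asp_outside)+
      then show ?thesis by simp
    qed
    show "u = v"
    proof
      fix y show "u y = v y"
      proof (cases y)
        case (Inl z)
        then show ?thesis using h_eq a_eq by (cases z) simp_all
      next
        case (Inr z)
        then show ?thesis using b by (simp add: b_def)
      qed
    qed
  qed
  have surj: "\<exists>v\<in>?D. F v = y" if y: "y \<in> ?C" for y
  proof -
    let ?y = "to_word m n even (y \<circ> Inl)"
    have "\<not> ?Pe \<Longrightarrow> y (Inr ()) = 0" using y by (simp add: dsum_iff Bsp_iff)
    from words_surjective[of m n, OF this, of ?y] obtain k a b where
      k: "\<And>w. w \<in> ?W \<and> stars w = 0 \<or> k w = 0" "\<And>w. w \<in> ?W \<Longrightarrow> dif {..<m} k w = 0"
      and a: "\<And>w. w \<in> ?W \<and> odd (stars w) \<or> a w = 0" and b: "\<not> ?Po \<longrightarrow> b = 0"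
      and t: "?Pe \<longrightarrow> top_sum {..<m} n a = y (Inr ())"
      and eq: "\<And>w. w \<in> ?W \<Longrightarrow> even (stars w) \<Longrightarrow> ?y w = k w + hodge m n a w + b * ?e w"
      by blast
    obtain h where h: "h \<in> ?H" "psi m n h = k" using psi_surjective[OF k] by blast
    define v :: "_ + unit \<Rightarrow> 'k" where "v = (\<lambda>z. case z of Inl (Inl p) \<Rightarrow> h p | Inl (Inr L) \<Rightarrow> of_word m n odd a L | Inr u \<Rightarrow> b)"
    have v1: "v \<circ> Inl \<circ> Inl = h" "v \<circ> Inl \<circ> Inr = of_word m n odd a" "v (Inr ()) = b"
      by (auto simp: v_def)
    have tw: "?tw (v \<circ> Inl \<circ> Inr) = a"
      using a by (auto simp: v1 fun_eq_iff to_word_of_word)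
    have xv: "x v w = k w + hodge m n a w + b * ?e w" for w
      by (simp only: x_def tw v1(1,3) h(2))
    have "v \<in> ?D" using h(1) b v1 by (simp add: dsum_iff of_word_in_Asp Bsp_iff)
    moreover have "F v = y"
    proof
      fix z show "F v z = y z"
      proof (cases z)
        case (Inl L)
        show ?thesis
        proof (cases "L \<in> labA m n even")
          case True
          then show ?thesis
            using eq[OF unlab_labA(1,2)[OF True]] to_word_unlab[OF True, of "y \<circ> Inl"]
            by (simp add: Inl F_Inl of_word_def xv)
        next
          case False
          then have "(y \<circ> Inl) L = 0" using y unfolding dsum_iff by (blast intro: Asp_outside)
          then show ?thesis using False by (simp add: Inl F_Inl of_word_def)
        qed
      next
        case (Inr u)
        show ?thesis
        proof (cases ?Pe)
          case True
          have "u = ()" by simp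
          then show ?thesis unfolding Inr F_Inr(1)[OF True] tw using t True by (simp only: simp_thms)
        next
          case False
          then show ?thesis using y unfolding Inr F_Inr(2)[OF False] dsum_iff Bsp_iff o_apply by simp
        qed
      qed
    qed
    ultimately show ?thesis by blast
  qed
  have bij: "bij_betw F ?D ?C"
    unfolding bij_betw_def
  proof (intro conjI inj equalityI subsetI)
    fix y :: "_ \<Rightarrow> 'k" assume "y \<in> ?C"
    then show "y \<in> F ` ?D" using surj by (metis imageI)
  qed (use into in blast)
  have equi: "F (dact (dact (actH m n) (actA m n odd)) actB \<sigma> \<tau> v) = dact (actA m n even) actB \<sigma> \<tau> (F v)"
    if sig: "\<sigma> permutes {..<m}" and tau: "\<tau> permutes {..<n}" and v: "v \<in> ?D" for \<sigma> \<tau> v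
  proof -
    let ?v = "dact (dact (actH m n) (actA m n odd)) actB \<sigma> \<tau> v" and ?s = "of_int (sign \<sigma> * sign \<tau>) :: 'k"
    obtain \<phi> where \<phi>: "natural m n \<phi>" "v \<circ> Inl \<circ> Inl = (\<lambda>(N, t, l). \<phi> N t l)"
      using v by (auto simp: dsum_iff Hsp_def o_assoc)
    have c: "?v \<circ> Inl \<circ> Inl = actH m n \<sigma> \<tau> (v \<circ> Inl \<circ> Inl)" "?v \<circ> Inl \<circ> Inr = actA m n odd \<sigma> \<tau> (v \<circ> Inl \<circ> Inr)"
      "?v (Inr ()) = ?s * v (Inr ())"
      by (simp_all add: dact_def fun_eq_iff o_def actB_def)
    have xv: "x ?v w = wact \<sigma> \<tau> (x v) w" if w: "w \<in> ?W" for w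
    proof -
      have "hodge m n (?tw (actA m n odd \<sigma> \<tau> (v \<circ> Inl \<circ> Inr))) w = hodge m n (wact \<sigma> \<tau> (?tw (v \<circ> Inl \<circ> Inr))) w"
        by (rule hodge_words_cong) (rule to_word_actA[OF sig tau])
      also have "\<dots> = wact \<sigma> \<tau> (hodge m n (?tw (v \<circ> Inl \<circ> Inr))) w" by (rule hodge_wact[OF sig tau w])
      finally have 1: "hodge m n (?tw (actA m n odd \<sigma> \<tau> (v \<circ> Inl \<circ> Inr))) w = wact \<sigma> \<tau> (hodge m n (?tw (v \<circ> Inl \<circ> Inr))) w" .
      have 2: "psi m n (actH m n \<sigma> \<tau> (v \<circ> Inl \<circ> Inl)) w = wact \<sigma> \<tau> (psi m n (v \<circ> Inl \<circ> Inl)) w"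
        unfolding \<phi>(2) by (rule psi_wact[OF \<phi>(1) sig tau w])
      have 3: "?s * v (Inr ()) * ?e w = v (Inr ()) * wact \<sigma> \<tau> ?e w"
        unfolding wact_top_sgn[OF sig tau w] by (simp only: mult_ac)
      show ?thesis unfolding x_def c 1 2 3 by (simp only: wact_def distrib_left mult_ac)
    qed
    have ts: "top_sum {..<m} n (?tw (actA m n odd \<sigma> \<tau> (v \<circ> Inl \<circ> Inr))) = ?s * top_sum {..<m} n (?tw (v \<circ> Inl \<circ> Inr))"
      unfolding top_sum_wact[OF sig tau, symmetric]
      by (rule top_sum_cong, simp, rule to_word_actA[OF sig tau])
    show ?thesis
    proof
      fix z show "F ?v z = dact (actA m n even) actB \<sigma> \<tau> (F v) z"
      proof (cases z)
        case (Inl L)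
        have FI: "F v \<circ> Inl = of_word m n even (x v)" by (simp add: F_Inl fun_eq_iff)
        have "of_word m n even (x ?v) L = of_word m n even (wact \<sigma> \<tau> (to_word m n even (of_word m n even (x v)))) L"
        proof (cases "L \<in> labA m n even")
          case True
          let ?w = "unlab n L"
          have w: "?w \<in> ?W" "even (stars ?w)" using unlab_labA[OF True] by auto
          have "pull \<sigma> \<tau> ?w \<in> ?W" "even (stars (pull \<sigma> \<tau> ?w))"
            using pull_in_words[OF sig tau w(1)] stars_pull[OF sig tau, of ?w] w(2) by auto
          then show ?thesis using True xv[OF w(1)] by (simp add: of_word_def[of m n even _ L] wact_def to_word_of_word)
        qed (simp add: of_word_def)
        then show ?thesis unfolding Inl F_Inl by (simp only: dact_def sum.case FI actA_eq[OF sig tau])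
      next
        case (Inr u)
        have "F ?v (Inr u) = ?s * F v (Inr u)"
        proof (cases ?Pe)
          case True
          show ?thesis unfolding F_Inr(1)[OF True] c ts ..
        next
          case False
          show ?thesis unfolding F_Inr(2)[OF False] by simp
        qed
        then show ?thesis unfolding Inr by (simp only: dact_def[of "actA m n even"] sum.case actB_def o_apply)
      qed
    qed
  qed
  show ?thesis unfolding rep_iso_def using lin bij equi by blast
qed

end
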